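(* Let $(q,h,\beta,\gamma)$ and $(\tilde q,\tilde h,\tilde\beta,\tilde\gamma)$ be two sets of coefficients, with the same $H\in\mathbb{C}$ and the same $d\in(0,\pi)$, and let $B,B^\infty$ and $\tilde B,\tilde B^\infty$ be the corresponding boundary value problems (see context). Let $W$ be a subsequence of both $\sigma(B)$ and $\sigma(\tilde B)$, and let $W^\infty$ be a subsequence of both $\sigma(B^\infty)$ and $\sigma(\tilde B^\infty)$. Suppose: (1) for every value $\lambda_n=\tilde\lambda_{\tilde n}$ occurring in $W$, where $n\in S_B$ and $\tilde n\in S_{\tilde B}$, one has $\kappa_{n+\nu}=\tilde\kappa_{\tilde n+\nu}$ for $\nu=0,1,\dots,k_n-1$, where $k_n$ is the number of occurrences of $\lambda_n$ in $W$; (2) for every value $\lambda_n^\infty=\tilde\lambda_{\tilde n}^\infty$ occurring in $W^\infty$, where $n\in S_{B^\infty}$ and $\tilde n\in S_{\tilde B^\infty}$, one has $\kappa^\infty_{n+\nu}=\tilde\kappa^\infty_{\tilde n+\nu}$ for $\nu=0,1,\dots,k_n^\infty-1$, where $k_n^\infty$ is the number of occurrences of $\lambda_n^\infty$ in $W^\infty$. Let $b\in(0,d)$. Suppose that $q=\tilde q$ a.e. on $[b,\pi]$, that $\beta=\tilde\beta$ and $\gamma=\tilde\gamma$, and that, for some real constant $A$, $$N_W(t)+N_{W^\infty}(t)\ \ge\ A\,N_{\sigma(B)}(t)+\Big(\frac{b}{\pi}-A\Big)N_{\sigma(B^\infty)}(t)-\frac A2$$ for all sufficiently large $t\in\mathbb{R}$.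 Then $h=\tilde h$ and $q=\tilde q$ a.e. on $[0,\pi]$.
   Context: For coefficients $q\in L^1([0,\pi];\mathbb{C})$, $h,H,\gamma\in\mathbb{C}$, $\beta\in\mathbb{R}$ with $\beta>0$, and $d\in(0,\pi)$, consider the equation $-y''+q(x)y=\lambda y$ on $(0,\pi)$ with the boundary condition $y'(0)-hy(0)=0$ and the jump conditions $y(d+0)=\beta y(d-0)$, $y'(d+0)=\beta^{-1}y'(d-0)+\gamma y(d-0)$. Problem $B$ has in addition the condition $y'(\pi)+Hy(\pi)=0$; problem $B^\infty$ has instead the condition $y(\pi)=0$. Let $\varphi(x,\lambda)$ be the solution of the equation satisfying the jump conditions and $\varphi(0,\lambda)=1,\varphi'(0,\lambda)=h$ (prime denotes $d/dx$). The eigenvalues of $B$ and $B^\infty$ are the zeros of the entire functions $\Delta(\lambda)=\varphi'(\pi,\lambda)+H\varphi(\pi,\lambda)$ and $\Delta^\infty(\lambda)=-\varphi(\pi,\lambda)$, respectively; the algebraic multiplicity of an eigenvalue is its order as a zero. $\sigma(B)=\{\lambda_n\}_{n\in\mathbb{N}_0}$ and $\sigma(B^\infty)=\{\lambda_n^\infty\}_{n\in\mathbb{N}_0}$ are the sequences of all eigenvalues, repeated according to algebraic multiplicity, ordered by nondecreasing modulus, with identical eigenvalues adjacent. $S_B=\{n\in\mathbb{N}:\lambda_{n-1}\ne\lambda_n\}\cup\{0\}$ and $S_{B^\infty}=\{n\in\mathbb{N}:\lambda^\infty_{n-1}\ne\lambda^\infty_n\}\cup\{0\}$. For $n\in S_B$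 (resp. $n\in S_{B^\infty}$), $m_n$ (resp. $m_n^\infty$) is the algebraic multiplicity of $\lambda_n$ (resp. $\lambda_n^\infty$). Generalized ratios: for $n\in S_B$, $\nu=0,\dots,m_n-1$, $\kappa_{n+\nu}=\frac1{\nu!}\frac{d^\nu}{d\lambda^\nu}\varphi(\pi,\lambda)|_{\lambda=\lambda_n}$. For $n\in S_{B^\infty}$, $\nu=0,\dots,m_n^\infty-1$, $\kappa^\infty_{n+\nu}=\frac1{\nu!}\frac{d^\nu}{d\lambda^\nu}\varphi'(\pi,\lambda)|_{\lambda=\lambda_n^\infty}$. Symbols with a tilde denote the corresponding objects for $(\tilde q,\tilde h,H,\tilde\beta,\tilde\gamma,d)$. Subsequences may be infinite, finite or empty. For a sequence $X=\{x_n\}$ of complex numbers, $N_X(t)=\#\{n:|x_n|<t\}$. *)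

theory Defs
  imports "HOL-Complex_Analysis.Complex_Analysis"
begin

text \<open>
  Solutions of \<open>- y'' + q y = lam y\<close> with \<open>q\<close> merely integrable are understood in the
  sense of Caratheodory: \<open>y\<close> is differentiable with derivative \<open>dy\<close>, and \<open>dy\<close> is locally
  absolutely continuous with \<open>dy' = (q - lam) y\<close> almost everywhere, i.e. \<open>dy\<close> is an
  indefinite integral of \<open>(q - lam) y\<close>.
\<close>

definition solves_on ::
  "(real \<Rightarrow> complex) \<Rightarrow> complex \<Rightarrow> real set \<Rightarrow> (real \<Rightarrow> complex) \<Rightarrow> (real \<Rightarrow> complex) \<Rightarrow> bool" where
  "solves_on q lam I y dy \<longleftrightarrow>
     (\<forall>x\<in>I. (y has_vector_derivative dy x) (at x within I)) \<and>
     (\<forall>u\<in>I. \<forall>x\<in>I. u \<le> x \<longrightarrow>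
        ((\<lambda>t. (q t - lam) * y t) has_integral (dy x - dy u)) {u..x})"

definition jump_conditions ::
  "real \<Rightarrow> complex \<Rightarrow> real \<Rightarrow> (real \<Rightarrow> complex) \<Rightarrow> (real \<Rightarrow> complex) \<Rightarrow> bool" where
  "jump_conditions \<beta> \<gamma> d y dy \<longleftrightarrow>
     (\<exists>l l'. (y \<longlongrightarrow> l) (at_left d) \<and> (dy \<longlongrightarrow> l') (at_left d) \<and>
             (y \<longlongrightarrow> of_real \<beta> * l) (at_right d) \<and>
             (dy \<longlongrightarrow> inverse (of_real \<beta>) * l' + \<gamma> * l) (at_right d))"

definition is_phi ::
  "(real \<Rightarrow> complex) \<Rightarrow> complex \<Rightarrow> real \<Rightarrow> complex \<Rightarrow> real \<Rightarrow> complex \<Rightarrow>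
   (real \<Rightarrow> complex) \<Rightarrow> (real \<Rightarrow> complex) \<Rightarrow> bool" where
  "is_phi q h \<beta> \<gamma> d lam y dy \<longleftrightarrow>
     solves_on q lam {0..<d} y dy \<and> solves_on q lam {d<..pi} y dy \<and>
     jump_conditions \<beta> \<gamma> d y dy \<and> y 0 = 1 \<and> dy 0 = h"

text \<open>
  The solution and its derivative are uniquely determined on \<open>[0,d) \<union> (d,\<pi>]\<close>; their values
  at \<open>d\<close> (and outside \<open>[0,\<pi>]\<close>) are arbitrary and play no role.
\<close>

definition phi_pair ::
  "(real \<Rightarrow> complex) \<Rightarrow> complex \<Rightarrow> real \<Rightarrow> complex \<Rightarrow> real \<Rightarrow> complex \<Rightarrow>
   (real \<Rightarrow> complex) \<times> (real \<Rightarrow> complex)" where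
  "phi_pair q h \<beta> \<gamma> d lam = (SOME p. is_phi q h \<beta> \<gamma> d lam (fst p) (snd p))"

definition phi ::
  "(real \<Rightarrow> complex) \<Rightarrow> complex \<Rightarrow> real \<Rightarrow> complex \<Rightarrow> real \<Rightarrow> real \<Rightarrow> complex \<Rightarrow> complex" where
  "phi q h \<beta> \<gamma> d x lam = fst (phi_pair q h \<beta> \<gamma> d lam) x"

definition dphi ::
  "(real \<Rightarrow> complex) \<Rightarrow> complex \<Rightarrow> real \<Rightarrow> complex \<Rightarrow> real \<Rightarrow> real \<Rightarrow> complex \<Rightarrow> complex" where
  "dphi q h \<beta> \<gamma> d x lam = snd (phi_pair q h \<beta> \<gamma> d lam) x"

definition Delta ::
  "(real \<Rightarrow> complex) \<Rightarrow> complex \<Rightarrow> complex \<Rightarrow> real \<Rightarrow> complex \<Rightarrow> real \<Rightarrow> complex \<Rightarrow> complex" where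
  "Delta q h H \<beta> \<gamma> d lam = dphi q h \<beta> \<gamma> d pi lam + H * phi q h \<beta> \<gamma> d pi lam"

definition Delta_inf ::
  "(real \<Rightarrow> complex) \<Rightarrow> complex \<Rightarrow> real \<Rightarrow> complex \<Rightarrow> real \<Rightarrow> complex \<Rightarrow> complex" where
  "Delta_inf q h \<beta> \<gamma> d lam = - phi q h \<beta> \<gamma> d pi lam"

definition alg_mult :: "(complex \<Rightarrow> complex) \<Rightarrow> complex \<Rightarrow> nat" where
  "alg_mult f z = (if f z = 0 then nat (zorder f z) else 0)"

text \<open>
  \<open>s\<close> lists all zeros of \<open>f\<close>, repeated according to multiplicity, ordered by nondecreasing
  modulus, with identical values adjacent. Such \<open>s\<close> need not be unique, since distinct
  zeros may have the same modulus.
\<close>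

definition eigenvalue_sequence :: "(complex \<Rightarrow> complex) \<Rightarrow> (nat \<Rightarrow> complex) \<Rightarrow> bool" where
  "eigenvalue_sequence f s \<longleftrightarrow>
     (\<forall>z. finite {n. s n = z} \<and> card {n. s n = z} = alg_mult f z) \<and>
     (\<forall>m n. m \<le> n \<longrightarrow> norm (s m) \<le> norm (s n)) \<and>
     (\<forall>i j k. i \<le> j \<and> j \<le> k \<and> s i = s k \<longrightarrow> s j = s i)"

definition block_starts :: "(nat \<Rightarrow> complex) \<Rightarrow> nat set" where
  "block_starts s = {n. 1 \<le> n \<and> s (n - 1) \<noteq> s n} \<union> {0}"

text \<open>
  Every index is uniquely \<open>n + \<nu>\<close> with \<open>n \<in> block_starts s\<close> and \<open>\<nu>\<close> less than the
  multiplicity of \<open>s n\<close>. At this index the sequence below takes the value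
  \<open>g^(\<nu>)(s n) / \<nu>!\<close>.
\<close>

definition gen_ratio :: "(complex \<Rightarrow> complex) \<Rightarrow> (nat \<Rightarrow> complex) \<Rightarrow> nat \<Rightarrow> complex" where
  "gen_ratio g s j =
     (let n = Max {i \<in> block_starts s. i \<le> j}; \<nu> = j - n
      in (deriv ^^ \<nu>) g (s n) / fact \<nu>)"

definition kappa ::
  "(real \<Rightarrow> complex) \<Rightarrow> complex \<Rightarrow> real \<Rightarrow> complex \<Rightarrow> real \<Rightarrow> (nat \<Rightarrow> complex) \<Rightarrow> nat \<Rightarrow> complex" where
  "kappa q h \<beta> \<gamma> d s = gen_ratio (phi q h \<beta> \<gamma> d pi) s"

definition kappa_inf ::
  "(real \<Rightarrow> complex) \<Rightarrow> complex \<Rightarrow> real \<Rightarrow> complex \<Rightarrow> real \<Rightarrow> (nat \<Rightarrow> complex) \<Rightarrow> nat \<Rightarrow> complex" where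
  "kappa_inf q h \<beta> \<gamma> d s = gen_ratio (dphi q h \<beta> \<gamma> d pi) s"

text \<open>
  A possibly finite or empty sequence is given by \<open>w\<close> restricted to an index set
  \<open>D\<close> of natural numbers, in increasing order of the indices.
\<close>

definition is_subsequence :: "nat set \<Rightarrow> (nat \<Rightarrow> complex) \<Rightarrow> (nat \<Rightarrow> complex) \<Rightarrow> bool" where
  "is_subsequence D w s \<longleftrightarrow> (\<exists>r. strict_mono_on D r \<and> (\<forall>k\<in>D. w k = s (r k)))"

definition occurrences :: "nat set \<Rightarrow> (nat \<Rightarrow> complex) \<Rightarrow> complex \<Rightarrow> nat" where
  "occurrences D w z = card {k \<in> D. w k = z}"

definition counting :: "nat set \<Rightarrow> (nat \<Rightarrow> complex) \<Rightarrow> real \<Rightarrow> nat" where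
  "counting D x t = card {n \<in> D. norm (x n) < t}"

end

theory Submission
  imports Defs
begin

text \<open>
  Write \<open>\<phi>\<close>, \<open>\<phi>t\<close> for the two solutions and put \<open>lam = \<rho>\<^sup>2\<close>, \<open>\<tau> = \<bar>Im \<rho>\<bar>\<close>. At a common eigenvalue the eigenvalue
  equation and the ratio fix the Cauchy data at \<open>\<pi>\<close>, to the order in \<open>lam\<close> given by the
  multiplicity in the subsequence. Both problems coincide on \<open>[b,\<pi>]\<close>, where the Cauchy data are
  transported by a common entire matrix, so \<open>F1 = \<phi>(b) - \<phi>t(b)\<close> and \<open>F2 = \<phi>'(b) - \<phi>t'(b)\<close> vanish at all
  members of both subsequences, with multiplicity. Jensen's formula evaluates \<open>\<integral> N(t)/t dt\<close> over
  \<open>[1,r]\<close> as \<open>2 sqrt r + (ln r)/2 + O(1)\<close> for the spectrum of B and as \<open>2 sqrt r + O(1)\<close> for that of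
  B-infinity. The counting hypothesis therefore gives \<open>F1\<close> and \<open>F2\<close> a logarithmic mean of at least
  \<open>(2 b/\<pi>) sqrt r - O(1)\<close> on circles, which is exactly the mean of \<open>b \<tau>\<close>. Since
  \<open>F1 = O(exp (b \<tau>) / \<bar>\<rho>\<bar>)\<close>, it vanishes identically; the Wronskian of \<open>\<phi>\<close> and \<open>\<phi>t\<close> at \<open>b\<close> is then
  \<open>- \<phi>(b) F2\<close>, whose integral representation yields \<open>F2 = o(exp (b \<tau>))\<close> away from the real
  \<open>\<rho>\<close>-axis, and \<open>F2\<close> vanishes as well. Equality of the Cauchy data at \<open>b\<close> for all \<open>lam\<close> determines
  \<open>q\<close> on \<open>[0,b]\<close> and \<open>h\<close> by a Borg-Marchenko argument.
\<close>

subsection \<open>Indefinite integrals of integrable functions\<close>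

text \<open>The counting hypothesis is exactly critical: integrated against dt/t, it grants
  \<open>F1\<close> and \<open>F2\<close> as many zeros, up to a bounded error, as their growth
  permits. The summand - A/2 keeps this error bounded, since its integral cancels the (A/2) ln r
  that the spectrum of B contributes through the extra factor \<rho> in \<open>Delta\<close>. With
  no excess of zeros, vanishing must come from an excess of decay, and this fixes the order of the
  two steps. A priori \<open>F2\<close> is only O(exp (b \<tau>)), because its leading part is cos
  (b \<rho>) times the constant h - ht plus half the integral of q - qt over [0,b]. In
  \<open>F1\<close> the same constant multiplies sin (b \<rho>) / \<rho>, so \<open>F1\<close> = 0
  is what removes it. The two subsequences may be counted together because \<phi>(\<pi>) and
  \<phi>'(\<pi>) have no common zero. Eigenvalues enter only through integrated counting: Jensen's
  formula is applied on the circles where |\<rho>| is n or n + 1/2, on which the leading terms of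
  the characteristic functions are as large as possible.\<close>

lemma constant_if_increments_small:
  fixes H :: "real \<Rightarrow> 'a::real_normed_vector" and K :: "real \<Rightarrow> real"
  assumes "a \<le> c"
    and small: "\<And>e. e > 0 \<Longrightarrow> \<exists>\<delta>>0. \<forall>x y. a \<le> x \<longrightarrow> x \<le> y \<longrightarrow> y \<le> c \<longrightarrow> y - x < \<delta> \<longrightarrow>
                  norm (H y - H x) \<le> e * (K y - K x)"
  shows "H c = H a"
proof -
  \<comment> \<open>On a uniform partition finer than \<delta> both sides telescope, so the local
    estimate becomes a global one.\<close>
  have le: "norm (H c - H a) \<le> e * (K c - K a)" if e: "e > 0" for e
  proof -
    obtain \<delta> where d: "\<delta> > 0" "\<And>x y. a \<le> x \<Longrightarrow> x \<le> y \<Longrightarrow> y \<le> c \<Longrightarrow> y - x < \<delta> \<Longrightarrow>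
         norm (H y - H x) \<le> e * (K y - K x)"
      using small[OF e] by blast
    obtain N :: nat where N: "(c - a) / \<delta> < real N"
      using reals_Archimedean2 by blast
    have "0 \<le> (c - a) / \<delta>" using assms(1) d(1) by simp
    hence N0: "N > 0" using N by (cases N) auto
    define p where "p i = a + real i * (c - a) / real N" for i
    have p0: "p 0 = a" and pN: "p N = c" using N0 by (auto simp: p_def)
    have step: "p (Suc i) - p i = (c - a) / real N" for i
      by (simp add: p_def add_divide_distrib diff_divide_distrib algebra_simps)
    have pd: "p (Suc i) - p i < \<delta>" for i
      unfolding step using N N0 d(1) by (simp add: field_simps)
    have mono: "p i \<le> p j" if "i \<le> j" for i j
      using that assms(1) unfolding p_def by (simp add: divide_right_mono mult_right_mono)
    have "norm (H c - H a) = norm (\<Sum>i<N. H (p (Suc i)) - H (p i))"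
      using sum_lessThan_telescope[of "\<lambda>i. H (p i)" N] by (simp add: p0 pN)
    also have "\<dots> \<le> (\<Sum>i<N. norm (H (p (Suc i)) - H (p i)))"
      by (rule norm_sum)
    also have "\<dots> \<le> (\<Sum>i<N. e * (K (p (Suc i)) - K (p i)))"
    proof (rule sum_mono)
      fix i assume "i \<in> {..<N}"
      hence "a \<le> p i" "p (Suc i) \<le> c"
        using mono[of 0 i] mono[of "Suc i" N] p0 pN by auto
      then show "norm (H (p (Suc i)) - H (p i)) \<le> e * (K (p (Suc i)) - K (p i))"
        using d(2) pd[of i] mono[of i "Suc i"] by simp
    qed
    also have "\<dots> = e * (K c - K a)"
      using sum_lessThan_telescope[of "\<lambda>i. K (p i)" N] by (simp add: sum_distrib_left[symmetric] p0 pN)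
    finally show ?thesis .
  qed
  have "norm (H c - H a) \<le> 0"
  proof (rule field_le_epsilon)
    fix e :: real assume e: "e > 0"
    \<comment> \<open>\<open>K\<close> need not be monotone; the absolute value and the added 1 give
      a positive denominator whatever the sign of \<open>K c - K a\<close>.\<close>
    let ?M = "\<bar>K c - K a\<bar> + 1"
    have "norm (H c - H a) \<le> e / ?M * (K c - K a)"
      using e by (intro le) (auto simp: add_nonneg_pos)
    also have "\<dots> \<le> e / ?M * ?M"
      using e by (intro mult_left_mono) auto
    also have "\<dots> = e" by (simp add: add_nonneg_pos less_imp_neq[symmetric])
    finally show "norm (H c - H a) \<le> 0 + e" by simp
  qed
  then show ?thesis by simp
qed

lemma absolutely_integrable_mult_continuous:
  fixes f g :: "real \<Rightarrow> 'a::{real_normed_field,euclidean_space}"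
  assumes "f absolutely_integrable_on {a..c}" "continuous_on {a..c} g"
  shows "(\<lambda>t. f t * g t) absolutely_integrable_on {a..c}"
proof -
  have "(\<lambda>t. g t * f t) absolutely_integrable_on {a..c}"
  proof (rule absolutely_integrable_bounded_measurable_product[OF bilinear_times])
    show "g \<in> borel_measurable (lebesgue_on {a..c})"
      using assms(2) by (intro continuous_imp_measurable_on_sets_lebesgue) auto
    show "bounded (g ` {a..c})"
      using assms(2) compact_continuous_image compact_imp_bounded by blast
  qed (use assms in auto)
  then show ?thesis by (simp add: mult.commute)
qed

lemma has_integral_increment:
  fixes f :: "real \<Rightarrow> 'a::banach"
  assumes "(f has_integral I) {a..x}" "(f has_integral J) {a..y}" "a \<le> x" "x \<le> y"
  shows "(f has_integral (J - I)) {x..y}"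
proof -
  have i: "f integrable_on {x..y}"
    using assms integrable_on_subinterval[of f "{a..y}" x y] by auto
  have "integral {a..x} f + integral {x..y} f = integral {a..y} f"
    using assms by (intro Henstock_Kurzweil_Integration.integral_combine) auto
  hence "integral {x..y} f = J - I"
    using assms by (simp add: integral_unique algebra_simps)
  then show ?thesis using i by (metis integrable_integral)
qed

lemma indefinite_integral_continuous_on:
  fixes f F :: "real \<Rightarrow> 'a::banach"
  assumes "\<And>x. x \<in> {a..c} \<Longrightarrow> (f has_integral (F x - F a)) {a..x}"
  shows "continuous_on {a..c} F"
proof (cases "a \<le> c")
  case True
  have "f integrable_on {a..c}" using assms[of c] True by auto
  hence "continuous_on {a..c} (\<lambda>x. F a + integral {a..x} f)"
    by (intro continuous_intros indefinite_integral_continuous_1)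
  then show ?thesis
    by (rule continuous_on_eq) (use integral_unique[OF assms] in simp)
qed auto

text \<open>
  On an interval of length less than \<open>\<delta>\<close> the increment of \<open>F G - \<integral>(f G + F g)\<close> is at most \<open>\<epsilon> \<integral>(\<bar>f\<bar> + \<bar>g\<bar>)\<close>,
  by uniform continuity of \<open>F\<close> and \<open>G\<close>. This avoids differentiation almost everywhere.
\<close>

lemma indefinite_integral_product:
  fixes f g F G :: "real \<Rightarrow> 'a::{real_normed_field,euclidean_space}"
  assumes f: "f absolutely_integrable_on {a..c}" and g: "g absolutely_integrable_on {a..c}"
    and F: "\<And>x. x \<in> {a..c} \<Longrightarrow> (f has_integral (F x - F a)) {a..x}"
    and G: "\<And>x. x \<in> {a..c} \<Longrightarrow> (g has_integral (G x - G a)) {a..x}"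
    and x: "x \<in> {a..c}"
  shows "((\<lambda>t. f t * G t + F t * g t) has_integral (F x * G x - F a * G a)) {a..x}"
proof -
  have cF: "continuous_on {a..c} F" and cG: "continuous_on {a..c} G"
    using indefinite_integral_continuous_on[OF F] indefinite_integral_continuous_on[OF G] by auto
  let ?k = "\<lambda>t. f t * G t + F t * g t"
  have ik: "?k absolutely_integrable_on {a..c}"
    using absolutely_integrable_mult_continuous[OF f cG] absolutely_integrable_mult_continuous[OF g cF]
    by (simp add: mult.commute[of "F _"] set_integral_add(1))
  have ik': "?k integrable_on {a..y}" if "y \<le> c" for y
    using integrable_on_subinterval[OF set_lebesgue_integral_eq_integral(1)[OF ik], of a y] that by auto
  define H where "H y = F y * G y - integral {a..y} ?k" for y
  define K where "K y = integral {a..y} (\<lambda>t. norm (f t) + norm (g t))" for y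
  have iK: "(\<lambda>t. norm (f t) + norm (g t)) integrable_on {a..y}" if "y \<le> c" for y
  proof -
    have "(\<lambda>t. norm (f t) + norm (g t)) integrable_on {a..c}"
      using f g by (intro integrable_add) (simp_all add: absolutely_integrable_on_def)
    then show ?thesis using that integrable_on_subinterval[of _ "{a..c}" a y] by auto
  qed
  have "H x = H a"
  proof (rule constant_if_increments_small[where K = K])
    show "a \<le> x" using x by simp
    fix e :: real assume e: "e > 0"
    have "uniformly_continuous_on {a..c} F" "uniformly_continuous_on {a..c} G"
      using cF cG compact_uniformly_continuous by blast+
    then obtain d1 d2 where d: "d1 > 0" "d2 > 0"
      "\<And>s t. s \<in> {a..c} \<Longrightarrow> t \<in> {a..c} \<Longrightarrow> dist t s < d1 \<Longrightarrow> dist (F t) (F s) < e"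
      "\<And>s t. s \<in> {a..c} \<Longrightarrow> t \<in> {a..c} \<Longrightarrow> dist t s < d2 \<Longrightarrow> dist (G t) (G s) < e"
      using e unfolding uniformly_continuous_on_def by metis
    show "\<exists>\<delta>>0. \<forall>u y. a \<le> u \<longrightarrow> u \<le> y \<longrightarrow> y \<le> x \<longrightarrow> y - u < \<delta> \<longrightarrow>
                  norm (H y - H u) \<le> e * (K y - K u)"
    proof (intro exI[of _ "min d1 d2"] conjI allI impI)
      fix u y assume uy: "a \<le> u" "u \<le> y" "y \<le> x" "y - u < min d1 d2"
      have yc: "y \<le> c" "u \<le> c" using uy x by auto
      have f': "(f has_integral (F y - F u)) {u..y}"
        using has_integral_increment[OF F[of u] F[of y]] uy yc by simp
      have g': "(g has_integral (G y - G u)) {u..y}"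
        using has_integral_increment[OF G[of u] G[of y]] uy yc by simp
      have k': "(?k has_integral (integral {a..y} ?k - integral {a..u} ?k)) {u..y}"
        by (rule has_integral_increment[OF _ _ uy(1,2)]) (use ik' yc in \<open>auto\<close>)
      have K': "((\<lambda>t. norm (f t) + norm (g t)) has_integral (K y - K u)) {u..y}"
        unfolding K_def
        by (rule has_integral_increment[OF _ _ uy(1,2)]) (use iK yc in \<open>auto\<close>)
      have "((\<lambda>t. f t * G y + F u * g t - ?k t) has_integral
              ((F y - F u) * G y + F u * (G y - G u) - (integral {a..y} ?k - integral {a..u} ?k))) {u..y}"
        by (intro has_integral_diff has_integral_add has_integral_mult_left has_integral_mult_right f' g' k')
      hence "((\<lambda>t. f t * (G y - G t) + (F u - F t) * g t) has_integral (H y - H u)) {u..y}"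
        by (simp add: H_def algebra_simps)
      hence "norm (H y - H u) \<le> integral {u..y} (\<lambda>t. e * (norm (f t) + norm (g t)))"
      proof (subst integral_unique[symmetric, of _ "H y - H u"], assumption, intro integral_norm_bound_integral)
        show "(\<lambda>t. e * (norm (f t) + norm (g t))) integrable_on {u..y}"
          using K' by (intro integrable_on_mult_right) auto
        fix t assume t: "t \<in> {u..y}"
        have 1: "norm (G y - G t) \<le> e"
          using d(4)[of t y] uy yc t by (force simp: dist_norm)
        have 2: "norm (F u - F t) \<le> e"
          using d(3)[of t u] uy yc t by (force simp: dist_norm)
        have "norm (f t * (G y - G t) + (F u - F t) * g t) \<le> norm (f t) * e + e * norm (g t)"
          by (intro norm_triangle_le add_mono) (auto simp: norm_mult less_imp_le[OF e] intro!: mult_mono 1 2)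
        then show "norm (f t * (G y - G t) + (F u - F t) * g t) \<le> e * (norm (f t) + norm (g t))"
          by (simp add: algebra_simps)
      qed auto
      also have "\<dots> = e * (K y - K u)"
        using K' by (simp add: integral_unique)
      finally show "norm (H y - H u) \<le> e * (K y - K u)" .
    qed (use d in auto)
  qed
  hence "integral {a..x} ?k = F x * G x - F a * G a"
    by (simp add: H_def algebra_simps)
  then show ?thesis using ik'[of x] x by (metis integrable_integral atLeastAtMost_iff)
qed

text \<open>The chain rule d (K^(n+1) / (n+1)!) = (K^n / n!) dK, proved by induction with the
  product rule. It supplies the factorials in the Gronwall and Picard estimates.\<close>

lemma indefinite_integral_power:
  fixes k K :: "real \<Rightarrow> real"
  assumes k: "k absolutely_integrable_on {a..c}"
    and K: "\<And>x. x \<in> {a..c} \<Longrightarrow> (k has_integral K x) {a..x}"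
    and x: "x \<in> {a..c}"
  shows "((\<lambda>t. k t * K t ^ n / fact n) has_integral (K x ^ Suc n / fact (Suc n))) {a..x}"
  using x
proof (induction n arbitrary: x)
  case 0
  then show ?case using K by simp
next
  case (Suc n)
  have ac: "a \<le> c" using Suc.prems by auto
  have Ka: "K a = 0" using K[of a] ac has_integral_unique[of k "K a" "{a}" 0] has_integral_refl(2)[of k a] by auto
  have K': "(k has_integral (K y - K a)) {a..y}" if "y \<in> {a..c}" for y
    using K[OF that] Ka by simp
  have cK: "continuous_on {a..c} K" by (rule indefinite_integral_continuous_on[OF K'])
  have kn: "(\<lambda>t. k t * (K t ^ n / fact n)) absolutely_integrable_on {a..c}"
    by (intro absolutely_integrable_mult_continuous k continuous_intros cK) auto
  have "((\<lambda>t. k t * (K t ^ Suc n / fact (Suc n)) + K t * (k t * (K t ^ n / fact n))) has_integral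
          (K x * (K x ^ Suc n / fact (Suc n)) - K a * (K a ^ Suc n / fact (Suc n)))) {a..x}"
    by (rule indefinite_integral_product[OF k kn K' _ Suc.prems]) (use Suc.IH Ka in auto)
  \<comment> \<open>K * K^n / n! is (n + 1) times K^(n+1) / (n+1)!, so the two terms of the product
    rule are 1 and n + 1 copies of the same integrand.\<close>
  also have "(\<lambda>t. k t * (K t ^ Suc n / fact (Suc n)) + K t * (k t * (K t ^ n / fact n)))
       = (\<lambda>t. (real n + 2) * (k t * K t ^ Suc n / fact (Suc n)))"
    by (rule ext) (simp add: divide_simps, simp add: algebra_simps)
  finally have "((\<lambda>t. (1 / (real n + 2)) * ((real n + 2) * (k t * K t ^ Suc n / fact (Suc n)))) has_integral
      (1 / (real n + 2)) * (K x * (K x ^ Suc n / fact (Suc n)) - K a * (K a ^ Suc n / fact (Suc n)))) {a..x}"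
    by (rule has_integral_mult_right)
  moreover have "(1 / (real n + 2)) * (K x * (K x ^ Suc n / fact (Suc n)) - K a * (K a ^ Suc n / fact (Suc n)))
      = K x ^ Suc (Suc n) / fact (Suc (Suc n))"
    using Ka by (simp add: field_simps)
  moreover have "(\<lambda>t. (1 / (real n + 2)) * ((real n + 2) * (k t * K t ^ Suc n / fact (Suc n))))
     = (\<lambda>t. k t * K t ^ Suc n / fact (Suc n))"
    by (rule ext) (simp add: divide_simps add_eq_0_iff)
  ultimately show ?case by simp
qed

subsection \<open>The equation on a closed interval\<close>

text \<open>Both components are kept in integrated form from the left endpoint. The equation is then
  a first order system to which product rule, iteration and uniform limits apply directly, although
  \<open>dy\<close> is only absolutely continuous.\<close>

definition ode_sol ::
  "(real \<Rightarrow> complex) \<Rightarrow> complex \<Rightarrow> real \<Rightarrow> real \<Rightarrow> (real \<Rightarrow> complex) \<Rightarrow> (real \<Rightarrow> complex) \<Rightarrow> bool" where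
  "ode_sol q l a c y dy \<longleftrightarrow>
     (\<forall>x\<in>{a..c}. (dy has_integral (y x - y a)) {a..x} \<and>
                  ((\<lambda>t. (q t - l) * y t) has_integral (dy x - dy a)) {a..x})"

lemma ode_solD:
  assumes "ode_sol q l a c y dy" "x \<in> {a..c}"
  shows "(dy has_integral (y x - y a)) {a..x}"
    and "((\<lambda>t. (q t - l) * y t) has_integral (dy x - dy a)) {a..x}"
  using assms unfolding ode_sol_def by auto

lemma ode_sol_continuous:
  assumes "ode_sol q l a c y dy"
  shows "continuous_on {a..c} y" "continuous_on {a..c} dy"
  using indefinite_integral_continuous_on[of a c dy y]
    indefinite_integral_continuous_on[of a c "\<lambda>t. (q t - l) * y t" dy]
    ode_solD[OF assms] by blast+

lemma ode_sol_combination: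
  assumes "ode_sol q l a c y dy" "ode_sol q l a c z dz"
  shows "ode_sol q l a c (\<lambda>x. r * y x + s * z x) (\<lambda>x. r * dy x + s * dz x)"
  unfolding ode_sol_def
proof (intro ballI conjI)
  fix x assume x: "x \<in> {a..c}"
  note y = ode_solD[OF assms(1) x] and z = ode_solD[OF assms(2) x]
  show "((\<lambda>x. r * dy x + s * dz x) has_integral (r * y x + s * z x - (r * y a + s * z a))) {a..x}"
    using has_integral_add[OF has_integral_mult_right[OF y(1), of r] has_integral_mult_right[OF z(1), of s]]
    by (simp add: algebra_simps)
  show "((\<lambda>t. (q t - l) * (r * y t + s * z t)) has_integral (r * dy x + s * dz x - (r * dy a + s * dz a))) {a..x}"
    using has_integral_add[OF has_integral_mult_right[OF y(2), of r] has_integral_mult_right[OF z(2), of s]]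
    by (simp add: algebra_simps)
qed

lemma ode_sol_subinterval:
  assumes "ode_sol q l a c y dy" "a \<le> u" "v \<le> c"
  shows "ode_sol q l u v y dy"
  unfolding ode_sol_def
proof (intro ballI)
  fix x assume x: "x \<in> {u..v}"
  have ux: "u \<in> {a..c}" "x \<in> {a..c}" "a \<le> u" "u \<le> x" using x assms by auto
  note u = ode_solD[OF assms(1) ux(1)] and x = ode_solD[OF assms(1) ux(2)]
  show "(dy has_integral (y x - y u)) {u..x} \<and>
        ((\<lambda>t. (q t - l) * y t) has_integral (dy x - dy u)) {u..x}"
    using has_integral_increment[OF u(1) x(1) ux(3,4)] has_integral_increment[OF u(2) x(2) ux(3,4)]
    by simp
qed

lemma ode_sol_cong:
  assumes "ode_sol q l a c y dy" "\<And>x. x \<in> {a..c} \<Longrightarrow> y x = z x" "\<And>x. x \<in> {a..c} \<Longrightarrow> dy x = dz x"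
  shows "ode_sol q l a c z dz"
  unfolding ode_sol_def
proof (intro ballI)
  fix x assume x: "x \<in> {a..c}"
  have "(dy has_integral (z x - z a)) {a..x}" "((\<lambda>t. (q t - l) * y t) has_integral (dz x - dz a)) {a..x}"
    using ode_solD[OF assms(1) x] assms(2,3) x by auto
  then show "(dz has_integral (z x - z a)) {a..x} \<and>
        ((\<lambda>t. (q t - l) * z t) has_integral (dz x - dz a)) {a..x}"
    using x assms(2,3) has_integral_eq[of "{a..x}" dy dz "z x - z a"]
      has_integral_eq[of "{a..x}" "\<lambda>t. (q t - l) * y t" "\<lambda>t. (q t - l) * z t" "dz x - dz a"] by auto
qed

lemma ode_sol_coefficient_AE:
  assumes "ode_sol q l a c y dy" "negligible {x\<in>{a..c}. q x \<noteq> p x}"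
  shows "ode_sol p l a c y dy"
  unfolding ode_sol_def
proof (intro ballI conjI)
  fix x assume x: "x \<in> {a..c}"
  show "(dy has_integral (y x - y a)) {a..x}" using ode_solD(1)[OF assms(1) x] .
  show "((\<lambda>t. (p t - l) * y t) has_integral (dy x - dy a)) {a..x}"
    by (rule has_integral_spike[OF assms(2) _ ode_solD(2)[OF assms(1) x]]) (use x in auto)
qed

lemma solves_on_imp_ode_sol:
  assumes "solves_on q l I y dy" "{u..v} \<subseteq> I"
  shows "ode_sol q l u v y dy"
  unfolding ode_sol_def
proof (intro ballI conjI)
  fix x assume x: "x \<in> {u..v}"
  have "(y has_vector_derivative dy t) (at t within {u..x})" if "t \<in> {u..x}" for t
  proof -
    have "(y has_vector_derivative dy t) (at t within I)"
      using assms that x unfolding solves_on_def by (meson atLeastAtMost_iff order_trans subsetD)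
    then show ?thesis
      by (rule has_vector_derivative_within_subset) (use assms(2) x in auto)
  qed
  then show "(dy has_integral (y x - y u)) {u..x}"
    using x by (intro fundamental_theorem_of_calculus) auto
  show "((\<lambda>t. (q t - l) * y t) has_integral (dy x - dy u)) {u..x}"
    using assms x unfolding solves_on_def by (meson atLeastAtMost_iff order_trans order_refl subsetD)
qed

lemma ode_sol_imp_solves_on:
  assumes "ode_sol q l a c y dy" "I \<subseteq> {a..c}"
  shows "solves_on q l I y dy"
  unfolding solves_on_def
proof (intro conjI ballI impI)
  fix x assume x: "x \<in> I"
  hence xac: "x \<in> {a..c}" using assms(2) by auto
  have "((\<lambda>u. integral {a..u} dy) has_vector_derivative dy x) (at x within {a..c})"
    by (rule integral_has_vector_derivative[OF ode_sol_continuous(2)[OF assms(1)] xac])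
  hence "((\<lambda>u. y a + integral {a..u} dy) has_vector_derivative dy x) (at x within {a..c})"
    by (auto intro!: derivative_eq_intros)
  moreover have "y a + integral {a..u} dy = y u" if "u \<in> {a..c}" for u
    using integral_unique[OF ode_solD(1)[OF assms(1) that]] by simp
  ultimately have "(y has_vector_derivative dy x) (at x within {a..c})"
    using xac by (metis (no_types, lifting) has_vector_derivative_transform)
  then show "(y has_vector_derivative dy x) (at x within I)"
    by (rule has_vector_derivative_within_subset) (use assms(2) in auto)
next
  fix u x assume "u \<in> I" "x \<in> I" "u \<le> x"
  then have ux: "u \<in> {a..c}" "x \<in> {a..c}" "a \<le> u" "u \<le> x" using assms(2) by auto
  show "((\<lambda>t. (q t - l) * y t) has_integral (dy x - dy u)) {u..x}"
    using has_integral_increment[OF ode_solD(2)[OF assms(1) ux(1)] ode_solD(2)[OF assms(1) ux(2)] ux(3,4)]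
    by simp
qed

section \<open>Gronwall estimate, uniqueness and Wronskians\<close>

text \<open>The integrand bounds the coefficient matrix of the system for all \<open>l\<close> with
  norm at most \<open>R\<close>: 1 comes from y' = dy, the rest from q - l.\<close>

definition growth_rate :: "(real \<Rightarrow> complex) \<Rightarrow> real \<Rightarrow> real \<Rightarrow> real \<Rightarrow> real" where
  "growth_rate q R a x = integral {a..x} (\<lambda>t. 1 + norm (q t) + R)"

lemma growth_rate_integrable:
  fixes q :: "real \<Rightarrow> complex"
  assumes "q absolutely_integrable_on {a..c}"
  shows "(\<lambda>t. 1 + norm (q t) + R) absolutely_integrable_on {a..c}"
  using assms by (intro set_integral_add(1)) (auto simp: absolutely_integrable_on_def)

lemma growth_rate_has_integral:
  assumes "q absolutely_integrable_on {a..c}" "x \<in> {a..c}"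
  shows "((\<lambda>t. 1 + norm (q t) + R) has_integral growth_rate q R a x) {a..x}"
proof -
  have "(\<lambda>t. 1 + norm (q t) + R) integrable_on {a..x}"
    using integrable_on_subinterval[OF set_lebesgue_integral_eq_integral(1)[OF growth_rate_integrable[OF assms(1)]], of a x] assms(2)
    by auto
  then show ?thesis unfolding growth_rate_def by auto
qed

lemma growth_rate_mono:
  assumes "q absolutely_integrable_on {a..c}" "x \<in> {a..c}" "R \<ge> 0"
  shows "0 \<le> growth_rate q R a x" "growth_rate q R a x \<le> growth_rate q R a c"
proof -
  show "0 \<le> growth_rate q R a x"
    by (rule has_integral_nonneg[OF growth_rate_has_integral[OF assms(1,2)]]) (use assms(3) in auto)
  show "growth_rate q R a x \<le> growth_rate q R a c"
    by (rule has_integral_subset_le[OF _ growth_rate_has_integral[OF assms(1,2)] growth_rate_has_integral[OF assms(1)]])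
       (use assms in auto)
qed

lemma growth_rate_power:
  assumes "q absolutely_integrable_on {a..c}" "x \<in> {a..c}"
  shows "((\<lambda>t. (1 + norm (q t) + R) * (growth_rate q R a t ^ n / fact n))
            has_integral (growth_rate q R a x ^ Suc n / fact (Suc n))) {a..x}"
  using indefinite_integral_power[OF growth_rate_integrable[OF assms(1)] growth_rate_has_integral[OF assms(1)] assms(2)]
  by simp

text \<open>
  The two estimates are obtained simultaneously by integrating the real part of \<open>u y' + v y''\<close> for
  suitable constants \<open>u\<close> and \<open>v\<close>.
\<close>

lemma integral_system_bound:
  fixes y dy q :: "real \<Rightarrow> complex" and z dz :: complex
  assumes q: "q absolutely_integrable_on {a..c}" and x: "x \<in> {a..c}" and l: "norm l \<le> R"
    and z: "(dy has_integral z) {a..x}" and dz: "((\<lambda>t. (q t - l) * y t) has_integral dz) {a..x}"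
    and B: "((\<lambda>t. (1 + norm (q t) + R) * B t) has_integral J) {a..x}"
    and le: "\<And>t. t \<in> {a..x} \<Longrightarrow> norm (y t) + norm (dy t) \<le> B t"
  shows "norm z + norm dz \<le> J"
proof -
  have cy: "norm (dy t) + norm ((q t - l) * y t) \<le> (1 + norm (q t) + R) * B t" if "t \<in> {a..x}" for t
  proof -
    have b: "norm (y t) \<le> B t" "norm (dy t) \<le> B t" "0 \<le> B t"
      using le[OF that] norm_ge_zero[of "y t"] norm_ge_zero[of "dy t"] by linarith+
    have "norm (q t - l) \<le> norm (q t) + R"
      using norm_triangle_ineq4[of "q t" l] l by linarith
    hence "norm (q t - l) * norm (y t) \<le> (norm (q t) + R) * B t"
      using b order_trans[OF norm_ge_zero l] by (intro mult_mono) auto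
    then show ?thesis using b by (simp add: norm_mult distrib_right)
  qed
  show ?thesis
  proof -
    define u where "u = cnj (sgn z)"
    define v where "v = cnj (sgn dz)"
    have un: "norm u \<le> 1" "norm v \<le> 1" by (auto simp: u_def v_def norm_sgn)
    have uz: "u * z = of_real (norm z)" "v * dz = of_real (norm dz)"
      by (auto simp: u_def v_def sgn_eq complex_norm_square[symmetric] divide_simps power2_eq_square
            mult.commute)
    have "((\<lambda>t. Re (u * dy t + v * ((q t - l) * y t))) has_integral Re (u * z + v * dz)) {a..x}"
      by (intro has_integral_Re has_integral_add has_integral_mult_right z dz)
    hence "Re (u * z + v * dz) \<le> J"
    proof (rule has_integral_le[OF _ B])
      fix t assume t: "t \<in> {a..x}"
      have "Re (u * dy t + v * ((q t - l) * y t)) \<le> norm (u * dy t + v * ((q t - l) * y t))"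
        by (rule complex_Re_le_cmod)
      also have "\<dots> \<le> norm u * norm (dy t) + norm v * norm ((q t - l) * y t)"
        by (metis norm_triangle_ineq norm_mult)
      also have "\<dots> \<le> 1 * norm (dy t) + 1 * norm ((q t - l) * y t)"
        by (intro add_mono mult_right_mono un) auto
      also have "\<dots> \<le> (1 + norm (q t) + R) * B t" using cy[OF t] by simp
      finally show "Re (u * dy t + v * ((q t - l) * y t)) \<le> (1 + norm (q t) + R) * B t" .
    qed
    then show ?thesis using uz by simp
  qed
qed

text \<open>Gronwall's inequality by iteration: substituting a bound into the integral equation n
  times leaves the crude bound \<open>M\<close> with the weight K^n / n!, which tends to 0, while
  the initial data collect the exponential series.\<close>

lemma ode_sol_bound:
  assumes q: "q absolutely_integrable_on {a..c}" and s: "ode_sol q l a c y dy" and x: "x \<in> {a..c}"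
  shows "norm (y x) + norm (dy x) \<le> (norm (y a) + norm (dy a)) * exp (growth_rate q (norm l) a x)"
proof -
  define C where "C = norm (y a) + norm (dy a)"
  let ?K = "growth_rate q (norm l) a"
  have "continuous_on {a..c} (\<lambda>x. norm (y x) + norm (dy x))"
    using ode_sol_continuous[OF s] by (intro continuous_intros)
  hence "bounded ((\<lambda>x. norm (y x) + norm (dy x)) ` {a..c})"
    by (meson compact_Icc compact_continuous_image compact_imp_bounded)
  then obtain M where M: "\<And>t. t \<in> {a..c} \<Longrightarrow> norm (y t) + norm (dy t) \<le> M"
    unfolding bounded_iff by force
  have est: "norm (y t) + norm (dy t) \<le> C * (\<Sum>j<n. ?K t ^ j / fact j) + M * (?K t ^ n / fact n)"
    if "t \<in> {a..c}" for t n
    using that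
  proof (induction n arbitrary: t)
    case 0
    then show ?case using M by simp
  next
    case (Suc n t)
    have *: "((\<lambda>t. \<Sum>j<n. C * ((1 + norm (q t) + norm l) * (?K t ^ j / fact j))) has_integral
           (\<Sum>j<n. C * (?K t ^ Suc j / fact (Suc j)))) {a..t}"
      using q Suc.prems by (intro has_integral_sum has_integral_mult_right growth_rate_power) auto
    have "((\<lambda>t. (\<Sum>j<n. C * ((1 + norm (q t) + norm l) * (?K t ^ j / fact j)))
               + M * ((1 + norm (q t) + norm l) * (?K t ^ n / fact n))) has_integral
           (\<Sum>j<n. C * (?K t ^ Suc j / fact (Suc j))) + M * (?K t ^ Suc n / fact (Suc n))) {a..t}"
      using q Suc.prems by (intro has_integral_add * has_integral_mult_right growth_rate_power) auto
    moreover have "(\<Sum>j<n. C * ((1 + norm (q s) + norm l) * (?K s ^ j / fact j)))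
               + M * ((1 + norm (q s) + norm l) * (?K s ^ n / fact n)) =
        (1 + norm (q s) + norm l) * (C * (\<Sum>j<n. ?K s ^ j / fact j) + M * (?K s ^ n / fact n))" for s
      by (simp add: sum_distrib_left distrib_left mult.left_commute)
    ultimately have "norm (y t - y a) + norm (dy t - dy a) \<le>
           (\<Sum>j<n. C * (?K t ^ Suc j / fact (Suc j))) + M * (?K t ^ Suc n / fact (Suc n))"
      by (intro integral_system_bound[OF q Suc.prems order_refl ode_solD[OF s Suc.prems]])
         (use Suc in auto)
    moreover have "norm (y t) + norm (dy t) \<le> C + (norm (y t - y a) + norm (dy t - dy a))"
      unfolding C_def using norm_triangle_sub[of "y t" "y a"] norm_triangle_sub[of "dy t" "dy a"] by linarith
    moreover have "C + (\<Sum>j<n. C * (?K t ^ Suc j / fact (Suc j))) = C * (\<Sum>j<Suc n. ?K t ^ j / fact j)"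
      by (subst sum.lessThan_Suc_shift) (simp add: sum_distrib_left distrib_left)
    ultimately show ?case by linarith
  qed
  have K: "(\<lambda>j. ?K x ^ j / fact j) sums exp (?K x)"
    using exp_converges[of "?K x"] by (simp add: field_simps)
  have "(\<lambda>n. C * (\<Sum>j<n. ?K x ^ j / fact j) + M * (?K x ^ n / fact n)) \<longlonglongrightarrow> C * exp (?K x) + M * 0"
    using K by (intro tendsto_intros summable_LIMSEQ_zero[OF sums_summable[OF K]]) (simp add: sums_def)
  then show ?thesis
    unfolding C_def[symmetric] using est[OF x] by (intro LIMSEQ_le_const[where X="\<lambda>n. C * (\<Sum>j<n. ?K x ^ j / fact j) + M * (?K x ^ n / fact n)"]) auto
qed

lemma ode_sol_unique:
  assumes q: "q absolutely_integrable_on {a..c}"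
    and s: "ode_sol q l a c y dy" "ode_sol q l a c z dz" "y a = z a" "dy a = dz a" and x: "x \<in> {a..c}"
  shows "y x = z x" "dy x = dz x"
proof -
  have "norm (1 * y x + (-1) * z x) + norm (1 * dy x + (-1) * dz x) \<le> 0"
    using ode_sol_bound[OF q ode_sol_combination[OF s(1,2), of 1 "-1"] x] s(3,4) by simp
  then show "y x = z x" "dy x = dz x"
    by (smt (verit) diff_add_cancel mult_1 mult_minus1 norm_ge_zero norm_eq_zero add_uminus_conv_diff eq_iff_diff_eq_0)+
qed

lemma ode_sol_representation:
  assumes q: "q absolutely_integrable_on {a..c}"
    and s: "ode_sol q l a c C dC" "ode_sol q l a c S dS" "C a = 1" "dC a = 0" "S a = 0" "dS a = 1"
    and y: "ode_sol q l a c y dy" and x: "x \<in> {a..c}"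
  shows "y x = y a * C x + dy a * S x" "dy x = y a * dC x + dy a * dS x"
  using ode_sol_unique[OF q y ode_sol_combination[OF s(1,2), of "y a" "dy a"] _ _ x] s(3-6) by auto

text \<open>Both solutions belong to the same \<open>l\<close>, which therefore cancels in y z'' -
  y'' z and leaves the difference of the coefficients.\<close>

lemma wronskian_has_integral:
  assumes q: "q absolutely_integrable_on {a..c}" and p: "p absolutely_integrable_on {a..c}"
    and y: "ode_sol q l a c y dy" and z: "ode_sol p l a c z dz" and x: "x \<in> {a..c}"
  shows "((\<lambda>t. (p t - q t) * (y t * z t)) has_integral
           (y x * dz x - dy x * z x - (y a * dz a - dy a * z a))) {a..x}"
proof -
  note c = ode_sol_continuous[OF y] ode_sol_continuous[OF z]
  have i: "(\<lambda>t. (q t - l) * y t) absolutely_integrable_on {a..c}" "(\<lambda>t. (p t - l) * z t) absolutely_integrable_on {a..c}"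
    using p q c by (auto intro!: absolutely_integrable_mult_continuous set_integral_diff(1))
  have "((\<lambda>t. dy t * dz t + y t * ((p t - l) * z t)) has_integral (y x * dz x - y a * dz a)) {a..x}"
    by (rule indefinite_integral_product[OF absolutely_integrable_continuous_real[OF c(2)] i(2)
          ode_solD(1)[OF y] ode_solD(2)[OF z] x])
  moreover have "((\<lambda>t. ((q t - l) * y t) * z t + dy t * dz t) has_integral (dy x * z x - dy a * z a)) {a..x}"
    by (rule indefinite_integral_product[OF i(1) absolutely_integrable_continuous_real[OF c(4)]
          ode_solD(2)[OF y] ode_solD(1)[OF z] x])
  ultimately have "((\<lambda>t. (dy t * dz t + y t * ((p t - l) * z t)) - (((q t - l) * y t) * z t + dy t * dz t))
      has_integral ((y x * dz x - y a * dz a) - (dy x * z x - dy a * z a))) {a..x}"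
    by (rule has_integral_diff)
  then show ?thesis by (simp add: algebra_simps)
qed

lemma wronskian_constant:
  assumes q: "q absolutely_integrable_on {a..c}"
    and y: "ode_sol q l a c y dy" and z: "ode_sol q l a c z dz" and x: "x \<in> {a..c}"
  shows "y x * dz x - dy x * z x = y a * dz a - dy a * z a"
  using has_integral_unique[OF wronskian_has_integral[OF q q y z x], of 0] by simp

section \<open>Picard iteration and entire dependence on the spectral parameter\<close>

text \<open>These are the terms of the Neumann series, not the successive approximations; the
  solution is their sum over n.\<close>

primrec picard :: "(real \<Rightarrow> complex) \<Rightarrow> real \<Rightarrow> complex \<Rightarrow> complex \<Rightarrow> complex \<Rightarrow> nat \<Rightarrow>
    (real \<Rightarrow> complex) \<times> (real \<Rightarrow> complex)" where
  "picard q a y0 y1 l 0 = (\<lambda>x. y0, \<lambda>x. y1)"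
| "picard q a y0 y1 l (Suc n) =
     (\<lambda>x. integral {a..x} (snd (picard q a y0 y1 l n)),
      \<lambda>x. integral {a..x} (\<lambda>t. (q t - l) * fst (picard q a y0 y1 l n) t))"

lemma indefinite_integral_mult_continuous:
  fixes q f :: "real \<Rightarrow> 'a::{real_normed_field,euclidean_space}"
  assumes "q absolutely_integrable_on {a..c}" "continuous_on {a..c} f"
  shows "x \<in> {a..c} \<Longrightarrow> (\<lambda>t. q t * f t) integrable_on {a..x}"
    and "continuous_on {a..c} (\<lambda>x. integral {a..x} (\<lambda>t. q t * f t))"
proof -
  have i: "(\<lambda>t. q t * f t) integrable_on {a..c}"
    using set_lebesgue_integral_eq_integral(1)[OF absolutely_integrable_mult_continuous[OF assms]] .
  then show "continuous_on {a..c} (\<lambda>x. integral {a..x} (\<lambda>t. q t * f t))"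
    by (rule indefinite_integral_continuous_1)
  show "(\<lambda>t. q t * f t) integrable_on {a..x}" if "x \<in> {a..c}"
    using integrable_on_subinterval[OF i, of a x] that by auto
qed

lemma picard_continuous:
  assumes q: "q absolutely_integrable_on {a..c}"
  shows "continuous_on {a..c} (fst (picard q a y0 y1 l n)) \<and> continuous_on {a..c} (snd (picard q a y0 y1 l n))"
proof (induction n)
  case (Suc n)
  have "(\<lambda>t. q t - l) absolutely_integrable_on {a..c}"
    using q by (intro set_integral_diff(1)) auto
  then show ?case
    using Suc indefinite_integral_mult_continuous(2)[of a c "\<lambda>t. q t - l"] by (auto intro!: indefinite_integral_continuous_1 integrable_continuous_real)
qed auto

lemma picard_Suc_has_integral:
  assumes q: "q absolutely_integrable_on {a..c}" and x: "x \<in> {a..c}"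
  shows "(snd (picard q a y0 y1 l n) has_integral fst (picard q a y0 y1 l (Suc n)) x) {a..x}"
    and "((\<lambda>t. (q t - l) * fst (picard q a y0 y1 l n) t) has_integral snd (picard q a y0 y1 l (Suc n)) x) {a..x}"
proof -
  have q': "(\<lambda>t. q t - l) absolutely_integrable_on {a..c}"
    using q by (intro set_integral_diff(1)) auto
  have "continuous_on {a..x} (snd (picard q a y0 y1 l n))"
    using picard_continuous[OF q, of y0 y1 l n] x by (auto elim: continuous_on_subset)
  then show "(snd (picard q a y0 y1 l n) has_integral fst (picard q a y0 y1 l (Suc n)) x) {a..x}"
    by (simp add: integrable_integral integrable_continuous_real)
  show "((\<lambda>t. (q t - l) * fst (picard q a y0 y1 l n) t) has_integral snd (picard q a y0 y1 l (Suc n)) x) {a..x}"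
    using indefinite_integral_mult_continuous(1)[OF q' conjunct1[OF picard_continuous[OF q]] x, of y0 y1 l n]
    by (simp add: integrable_integral)
qed

lemma picard_bound:
  assumes q: "q absolutely_integrable_on {a..c}" and x: "x \<in> {a..c}" and l: "norm l \<le> R"
  shows "norm (fst (picard q a y0 y1 l n) x) + norm (snd (picard q a y0 y1 l n) x)
           \<le> (norm y0 + norm y1) * (growth_rate q R a x ^ n / fact n)"
  using x
proof (induction n arbitrary: x)
  case (Suc n)
  have "((\<lambda>t. (norm y0 + norm y1) * ((1 + norm (q t) + R) * (growth_rate q R a t ^ n / fact n))) has_integral
      (norm y0 + norm y1) * (growth_rate q R a x ^ Suc n / fact (Suc n))) {a..x}"
    by (intro has_integral_mult_right growth_rate_power[OF q Suc.prems])
  hence "((\<lambda>t. (1 + norm (q t) + R) * ((norm y0 + norm y1) * (growth_rate q R a t ^ n / fact n))) has_integral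
      (norm y0 + norm y1) * (growth_rate q R a x ^ Suc n / fact (Suc n))) {a..x}"
    by (simp add: mult.left_commute)
  then show ?case
    by (rule integral_system_bound[OF q Suc.prems l picard_Suc_has_integral[OF q Suc.prems]])
       (use Suc in auto)
qed auto

text \<open>Source of holomorphy: every term of the series is a polynomial in \<open>l\<close>. The
  coefficients are continuous in x so that the induction can integrate them, and zero from
  \<open>N\<close> on so that the degree can grow by one in each step.\<close>

lemma picard_polynomial:
  assumes q: "q absolutely_integrable_on {a..c}"
  shows "\<exists>N P Q. (\<forall>k. continuous_on {a..c} (P k) \<and> continuous_on {a..c} (Q k)) \<and>
           (\<forall>k\<ge>N. P k = (\<lambda>x. 0) \<and> Q k = (\<lambda>x. 0)) \<and>
           (\<forall>l. \<forall>x\<in>{a..c}. fst (picard q a y0 y1 l n) x = (\<Sum>k<N. P k x * l ^ k) \<and>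
                            snd (picard q a y0 y1 l n) x = (\<Sum>k<N. Q k x * l ^ k))"
proof (induction n)
  case 0
  show ?case
    by (rule exI[of _ 1], rule exI[of _ "\<lambda>k x. if k = 0 then y0 else 0"],
        rule exI[of _ "\<lambda>k x. if k = 0 then y1 else 0"]) auto
next
  case (Suc n)
  then obtain N P Q where c: "\<And>k. continuous_on {a..c} (P k)" "\<And>k. continuous_on {a..c} (Q k)"
    and z: "\<And>k. k \<ge> N \<Longrightarrow> P k = (\<lambda>x. 0)" "\<And>k. k \<ge> N \<Longrightarrow> Q k = (\<lambda>x. 0)"
    and e: "\<And>l x. x \<in> {a..c} \<Longrightarrow> fst (picard q a y0 y1 l n) x = (\<Sum>k<N. P k x * l ^ k)"
           "\<And>l x. x \<in> {a..c} \<Longrightarrow> snd (picard q a y0 y1 l n) x = (\<Sum>k<N. Q k x * l ^ k)"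
    by blast
  define P' where "P' k x = integral {a..x} (Q k)" for k x
  \<comment> \<open>Multiplication by \<open>l\<close> shifts the coefficients, so the one with
    index k receives the integral of \<open>P (k - 1)\<close>.\<close>
  define R where "R k x = (case k of 0 \<Rightarrow> 0 | Suc j \<Rightarrow> integral {a..x} (P j))" for k x
  define Q' where "Q' k x = integral {a..x} (\<lambda>t. q t * P k t) - R k x" for k x
  have iP: "P k integrable_on {a..x}" "Q k integrable_on {a..x}" if "x \<in> {a..c}" for k x
    using continuous_on_subset[OF c(1), of "{a..x}"] continuous_on_subset[OF c(2), of "{a..x}"] that
    by (auto intro!: integrable_continuous_real)
  have cR: "continuous_on {a..c} (R k)" for k
    unfolding R_def by (cases k) (auto intro!: indefinite_integral_continuous_1 integrable_continuous_real c)
  show ?case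
  proof (rule exI[of _ "Suc N"], rule exI[of _ P'], rule exI[of _ Q'], intro conjI allI impI ballI)
    fix k
    show "continuous_on {a..c} (P' k)"
      unfolding P'_def by (auto intro!: indefinite_integral_continuous_1 integrable_continuous_real c)
    show "continuous_on {a..c} (Q' k)"
      unfolding Q'_def by (intro continuous_intros cR indefinite_integral_mult_continuous(2) q c)
  next
    fix k assume k: "Suc N \<le> k"
    show "P' k = (\<lambda>x. 0)" using z(2)[of k] k by (auto simp: P'_def)
    show "Q' k = (\<lambda>x. 0)" using z(1)[of k] z(1)[of "k - 1"] k by (cases k) (auto simp: Q'_def R_def)
  next
    fix l x assume x: "x \<in> {a..c}"
    have "((\<lambda>t. \<Sum>k<N. Q k t * l ^ k) has_integral (\<Sum>k<N. P' k x * l ^ k)) {a..x}"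
      unfolding P'_def using iP[OF x]
      by (intro has_integral_sum has_integral_mult_left) (auto simp: integrable_integral)
    moreover have "((\<lambda>t. \<Sum>k<N. Q k t * l ^ k) has_integral fst (picard q a y0 y1 l (Suc n)) x) {a..x}"
      by (rule has_integral_eq[OF _ picard_Suc_has_integral(1)[OF q x]]) (use e(2) x in auto)
    moreover have "P' N x = 0" using z(2)[of N] by (simp add: P'_def)
    ultimately show "fst (picard q a y0 y1 l (Suc n)) x = (\<Sum>k<Suc N. P' k x * l ^ k)"
      using has_integral_unique[of "\<lambda>t. \<Sum>k<N. Q k t * l ^ k"] by simp
    have "((\<lambda>t. (\<Sum>k<N. q t * P k t * l ^ k) - (\<Sum>k<N. P k t * l ^ Suc k)) has_integral
            (\<Sum>k<N. integral {a..x} (\<lambda>t. q t * P k t) * l ^ k) - (\<Sum>k<N. integral {a..x} (P k) * l ^ Suc k)) {a..x}"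
      using iP[OF x] indefinite_integral_mult_continuous(1)[OF q c(1) x]
      by (intro has_integral_sum has_integral_diff has_integral_mult_left) (auto simp: integrable_integral)
    moreover have "(\<Sum>k<N. q t * P k t * l ^ k) - (\<Sum>k<N. P k t * l ^ Suc k)
          = (q t - l) * (\<Sum>k<N. P k t * l ^ k)" for t
    proof -
      have "(\<Sum>k<N. q t * P k t * l ^ k) = q t * (\<Sum>k<N. P k t * l ^ k)"
        by (simp add: sum_distrib_left mult.assoc)
      moreover have "(\<Sum>k<N. P k t * l ^ Suc k) = l * (\<Sum>k<N. P k t * l ^ k)"
        by (simp add: sum_distrib_left mult.left_commute)
      ultimately show ?thesis by (simp only: left_diff_distrib)
    qed
    moreover have "((\<lambda>t. (q t - l) * (\<Sum>k<N. P k t * l ^ k)) has_integral snd (picard q a y0 y1 l (Suc n)) x) {a..x}"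
      by (rule has_integral_eq[OF _ picard_Suc_has_integral(2)[OF q x]]) (use e(1) x in auto)
    ultimately have "snd (picard q a y0 y1 l (Suc n)) x =
       (\<Sum>k<N. integral {a..x} (\<lambda>t. q t * P k t) * l ^ k) - (\<Sum>k<N. integral {a..x} (P k) * l ^ Suc k)"
      using has_integral_unique[of "\<lambda>t. (q t - l) * (\<Sum>k<N. P k t * l ^ k)"] by simp
    also have "(\<Sum>k<N. integral {a..x} (P k) * l ^ Suc k) = (\<Sum>k<Suc N. R k x * l ^ k)"
      by (subst sum.lessThan_Suc_shift) (simp add: R_def)
    also have "(\<Sum>k<N. integral {a..x} (\<lambda>t. q t * P k t) * l ^ k) = (\<Sum>k<Suc N. integral {a..x} (\<lambda>t. q t * P k t) * l ^ k)"
      using z(1)[of N] by simp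
    finally show "snd (picard q a y0 y1 l (Suc n)) x = (\<Sum>k<Suc N. Q' k x * l ^ k)"
      unfolding Q'_def by (simp only: left_diff_distrib sum_subtractf)
  qed
qed

lemma picard_holomorphic:
  assumes q: "q absolutely_integrable_on {a..c}" and x: "x \<in> {a..c}"
  shows "(\<lambda>l. fst (picard q a y0 y1 l n) x) holomorphic_on UNIV" "(\<lambda>l. snd (picard q a y0 y1 l n) x) holomorphic_on UNIV"
proof -
  obtain N P Q where "\<And>l. fst (picard q a y0 y1 l n) x = (\<Sum>k<N. P k x * l ^ k)"
     "\<And>l. snd (picard q a y0 y1 l n) x = (\<Sum>k<N. Q k x * l ^ k)"
    using picard_polynomial[OF q, of y0 y1 n] x by blast
  then show "(\<lambda>l. fst (picard q a y0 y1 l n) x) holomorphic_on UNIV" "(\<lambda>l. snd (picard q a y0 y1 l n) x) holomorphic_on UNIV"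
    by (auto intro!: holomorphic_intros)
qed

text \<open>Against an integrable weight the error is at most the uniform distance times the
  integral of \<open>norm (q t)\<close>. This passes to the limit in the integrated
  equation.\<close>

lemma integral_uniform_limit_mult:
  fixes q :: "real \<Rightarrow> complex"
  assumes q: "q absolutely_integrable_on {a..c}" and x: "x \<in> {a..c}"
    and f: "\<And>n. continuous_on {a..c} (f n)" and u: "uniform_limit {a..c} f g sequentially"
    and i: "\<And>n. ((\<lambda>t. q t * f n t) has_integral I n) {a..x}" and I: "I \<longlonglongrightarrow> J"
  shows "((\<lambda>t. q t * g t) has_integral J) {a..x}"
proof -
  have g: "continuous_on {a..c} g"
    using u f by (intro uniform_limit_theorem[where f=f and F=sequentially]) auto
  have gi: "((\<lambda>t. q t * g t) has_integral (integral {a..x} (\<lambda>t. q t * g t))) {a..x}"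
    using indefinite_integral_mult_continuous(1)[OF q g x] by auto
  have "q absolutely_integrable_on {a..x}"
    using absolutely_integrable_on_subinterval[OF q, of a x] x by auto
  hence qn: "(\<lambda>t. norm (q t)) integrable_on {a..x}"
    by (simp add: absolutely_integrable_on_def)
  let ?A = "integral {a..x} (\<lambda>t. norm (q t))"
  have A0: "0 \<le> ?A" by (rule integral_nonneg[OF qn]) auto
  have "I \<longlonglongrightarrow> integral {a..x} (\<lambda>t. q t * g t)"
  proof (rule LIMSEQ_I)
    fix e :: real assume e: "e > 0"
    define d where "d = e / (?A + 1)"
    have d: "d > 0" using e A0 by (simp add: d_def)
    obtain N where N: "\<And>n t. n \<ge> N \<Longrightarrow> t \<in> {a..c} \<Longrightarrow> dist (f n t) (g t) < d"
      using u d unfolding uniform_limit_iff eventually_sequentially by blast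
    show "\<exists>N. \<forall>n\<ge>N. norm (I n - integral {a..x} (\<lambda>t. q t * g t)) < e"
    proof (intro exI[of _ N] allI impI)
      fix n assume n: "n \<ge> N"
      have h: "((\<lambda>t. q t * f n t - q t * g t) has_integral (I n - integral {a..x} (\<lambda>t. q t * g t))) {a..x}"
        by (rule has_integral_diff[OF i gi])
      have "norm (I n - integral {a..x} (\<lambda>t. q t * g t)) \<le> integral {a..x} (\<lambda>t. d * norm (q t))"
        unfolding integral_unique[OF h, symmetric]
      proof (rule integral_norm_bound_integral)
        show "(\<lambda>t. q t * f n t - q t * g t) integrable_on {a..x}" using h by auto
        show "(\<lambda>t. d * norm (q t)) integrable_on {a..x}" using qn by (rule integrable_on_mult_right)
        fix t assume "t \<in> {a..x}"
        hence "norm (f n t - g t) \<le> d" using N[OF n, of t] x by (simp add: dist_norm)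
        then show "norm (q t * f n t - q t * g t) \<le> d * norm (q t)"
          unfolding right_diff_distrib[symmetric] norm_mult by (subst mult.commute) (auto intro: mult_right_mono)
      qed
      also have "\<dots> = d * ?A" by simp
      also have "\<dots> < d * (?A + 1)" using d by simp
      also have "\<dots> = e" using A0 by (simp add: d_def)
      finally show "norm (I n - integral {a..x} (\<lambda>t. q t * g t)) < e" .
    qed
  qed
  then show ?thesis using LIMSEQ_unique[OF I] gi by simp
qed

lemma ode_sol_exists:
  fixes q :: "real \<Rightarrow> complex"
  assumes q: "q absolutely_integrable_on {a..c}"
  shows "\<exists>Y dY. (\<forall>l. ode_sol q l a c (Y l) (dY l) \<and> (a \<le> c \<longrightarrow> Y l a = y0 \<and> dY l a = y1)) \<and>
            (\<forall>x\<in>{a..c}. (\<lambda>l. Y l x) holomorphic_on UNIV \<and> (\<lambda>l. dY l x) holomorphic_on UNIV)"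
proof -
  let ?f = "\<lambda>n l. fst (picard q a y0 y1 l n)"
  let ?g = "\<lambda>n l. snd (picard q a y0 y1 l n)"
  define Y where "Y l x = (\<Sum>n. ?f n l x)" for l x
  define dY where "dY l x = (\<Sum>n. ?g n l x)" for l x
  \<comment> \<open>Uniform convergence on this product set serves twice: at fixed \<open>l\<close>
    for the limit under the integral, at fixed x for the holomorphy of the limit in
    \<open>l\<close>.\<close>
  define S where "S R = {(l :: complex, x). norm l \<le> R \<and> x \<in> {a..c}}" for R :: real
  have bnd: "norm (?f n l x) \<le> (norm y0 + norm y1) * (growth_rate q R a c ^ n / fact n)"
            "norm (?g n l x) \<le> (norm y0 + norm y1) * (growth_rate q R a c ^ n / fact n)"
    if "norm l \<le> R" "x \<in> {a..c}" for n l x R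
  proof -
    have "growth_rate q R a x ^ n \<le> growth_rate q R a c ^ n"
      using growth_rate_mono[OF q that(2), of R] that(1) norm_ge_zero[of l]
      by (intro power_mono) linarith+
    hence "(norm y0 + norm y1) * (growth_rate q R a x ^ n / fact n) \<le> (norm y0 + norm y1) * (growth_rate q R a c ^ n / fact n)"
      by (intro mult_left_mono divide_right_mono) auto
    then show "norm (?f n l x) \<le> (norm y0 + norm y1) * (growth_rate q R a c ^ n / fact n)"
            "norm (?g n l x) \<le> (norm y0 + norm y1) * (growth_rate q R a c ^ n / fact n)"
      using picard_bound[OF q that(2) that(1), of y0 y1 n] norm_ge_zero[of "?f n l x"] norm_ge_zero[of "?g n l x"]
      by linarith+
  qed
  have sm: "summable (\<lambda>n. (norm y0 + norm y1) * (growth_rate q R a c ^ n / fact n))" for R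
    using summable_exp[of "growth_rate q R a c"] by (intro summable_mult) (simp add: field_simps)
  have uf: "uniform_limit (S R) (\<lambda>n (l, x). \<Sum>i<n. ?f i l x) (\<lambda>(l, x). Y l x) sequentially" for R
    unfolding case_prod_beta' Y_def
    by (rule Weierstrass_m_test[OF _ sm[of R]]) (use bnd(1) in \<open>auto simp: S_def\<close>)
  have ug: "uniform_limit (S R) (\<lambda>n (l, x). \<Sum>i<n. ?g i l x) (\<lambda>(l, x). dY l x) sequentially" for R
    unfolding case_prod_beta' dY_def
    by (rule Weierstrass_m_test[OF _ sm[of R]]) (use bnd(2) in \<open>auto simp: S_def\<close>)
  have ufx: "uniform_limit {a..c} (\<lambda>n x. \<Sum>i<n. ?f i l x) (Y l) sequentially" for l
    using uf[of "norm l"] unfolding uniform_limit_iff S_def by (force elim!: eventually_mono)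
  have ugx: "uniform_limit {a..c} (\<lambda>n x. \<Sum>i<n. ?g i l x) (dY l) sequentially" for l
    using ug[of "norm l"] unfolding uniform_limit_iff S_def by (force elim!: eventually_mono)
  have cf: "continuous_on {a..c} (\<lambda>x. \<Sum>i<n. ?f i l x)" "continuous_on {a..c} (\<lambda>x. \<Sum>i<n. ?g i l x)" for n l
    using picard_continuous[OF q] by (auto intro!: continuous_on_sum)
  have limf: "(\<lambda>n. \<Sum>i<n. ?f i l x) \<longlonglongrightarrow> Y l x" "(\<lambda>n. \<Sum>i<n. ?g i l x) \<longlonglongrightarrow> dY l x" if "x \<in> {a..c}" for l x
    using tendsto_uniform_limitI[OF ufx that] tendsto_uniform_limitI[OF ugx that] by auto
  have sumsuc: "(\<Sum>i<n. ?f (Suc i) l x) = (\<Sum>i<Suc n. ?f i l x) - y0"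
               "(\<Sum>i<n. ?g (Suc i) l x) = (\<Sum>i<Suc n. ?g i l x) - y1" for n l x
    by (subst sum.lessThan_Suc_shift, simp del: picard.simps(2))+
  have init: "Y l a = y0" "dY l a = y1" if "a \<le> c" for l
  proof -
    have "?f n l a = (if n = 0 then y0 else 0)" "?g n l a = (if n = 0 then y1 else 0)" for n
      by (cases n; simp)+
    then show "Y l a = y0" "dY l a = y1"
      unfolding Y_def dY_def using suminf_finite[of "{0}" "\<lambda>n. ?f n l a"] suminf_finite[of "{0}" "\<lambda>n. ?g n l a"] by auto
  qed
  have "ode_sol q l a c (Y l) (dY l)" for l
    unfolding ode_sol_def
  proof (intro ballI conjI)
    fix x assume x: "x \<in> {a..c}"
    hence ac: "a \<le> c" by auto
    have one: "(\<lambda>t. 1 :: complex) absolutely_integrable_on {a..c}" by auto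
    have ql: "(\<lambda>t. q t - l) absolutely_integrable_on {a..c}"
      using q by (intro set_integral_diff(1)) auto
    have "((\<lambda>t. 1 * dY l t) has_integral (Y l x - y0)) {a..x}"
    proof (rule integral_uniform_limit_mult[OF one x cf(2) ugx])
      show "((\<lambda>t. 1 * (\<Sum>i<n. ?g i l t)) has_integral (\<Sum>i<n. ?f (Suc i) l x)) {a..x}" for n
        unfolding mult_1 by (intro has_integral_sum picard_Suc_has_integral(1)[OF q x]) auto
      show "(\<lambda>n. \<Sum>i<n. ?f (Suc i) l x) \<longlonglongrightarrow> Y l x - y0"
        unfolding sumsuc using limf(1)[OF x] by (intro tendsto_intros LIMSEQ_Suc)
    qed
    then show "(dY l has_integral (Y l x - Y l a)) {a..x}" by (simp add: init[OF ac])
    have "((\<lambda>t. (q t - l) * Y l t) has_integral (dY l x - y1)) {a..x}"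
    proof (rule integral_uniform_limit_mult[OF ql x cf(1) ufx])
      show "((\<lambda>t. (q t - l) * (\<Sum>i<n. ?f i l t)) has_integral (\<Sum>i<n. ?g (Suc i) l x)) {a..x}" for n
        unfolding sum_distrib_left by (intro has_integral_sum picard_Suc_has_integral(2)[OF q x]) auto
      show "(\<lambda>n. \<Sum>i<n. ?g (Suc i) l x) \<longlonglongrightarrow> dY l x - y1"
        unfolding sumsuc using limf(2)[OF x] by (intro tendsto_intros LIMSEQ_Suc)
    qed
    then show "((\<lambda>t. (q t - l) * Y l t) has_integral (dY l x - dY l a)) {a..x}" by (simp add: init[OF ac])
  qed
  moreover have "(\<lambda>l. Y l x) holomorphic_on UNIV \<and> (\<lambda>l. dY l x) holomorphic_on UNIV" if x: "x \<in> {a..c}" for x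
  proof
    have sub: "(z, x) \<in> S (norm l + 1)" if "z \<in> cball l 1" for z l
      using that x norm_triangle_sub[of z l] by (auto simp: S_def dist_norm norm_minus_commute)
    show "(\<lambda>l. Y l x) holomorphic_on UNIV"
    proof (rule holomorphic_uniform_sequence[where f="\<lambda>n l. \<Sum>i<n. ?f i l x"])
      show "(\<lambda>l. \<Sum>i<n. ?f i l x) holomorphic_on UNIV" for n
        by (intro holomorphic_intros picard_holomorphic[OF q x])
      fix l :: complex
      have "uniform_limit (cball l 1) (\<lambda>n l. \<Sum>i<n. ?f i l x) (\<lambda>l. Y l x) sequentially"
        using uf[of "norm l + 1"] sub unfolding uniform_limit_iff by (force elim!: eventually_mono)
      then show "\<exists>d>0. cball l d \<subseteq> UNIV \<and> uniform_limit (cball l d) (\<lambda>n l. \<Sum>i<n. ?f i l x) (\<lambda>l. Y l x) sequentially"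
        by (intro exI[of _ 1]) auto
    qed auto
    show "(\<lambda>l. dY l x) holomorphic_on UNIV"
    proof (rule holomorphic_uniform_sequence[where f="\<lambda>n l. \<Sum>i<n. ?g i l x"])
      show "(\<lambda>l. \<Sum>i<n. ?g i l x) holomorphic_on UNIV" for n
        by (intro holomorphic_intros picard_holomorphic[OF q x])
      fix l :: complex
      have "uniform_limit (cball l 1) (\<lambda>n l. \<Sum>i<n. ?g i l x) (\<lambda>l. dY l x) sequentially"
        using ug[of "norm l + 1"] sub unfolding uniform_limit_iff by (force elim!: eventually_mono)
      then show "\<exists>d>0. cball l d \<subseteq> UNIV \<and> uniform_limit (cball l d) (\<lambda>n l. \<Sum>i<n. ?g i l x) (\<lambda>l. dY l x) sequentially"
        by (intro exI[of _ 1]) auto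
    qed auto
  qed
  ultimately show ?thesis using init by blast
qed

subsection \<open>Asymptotics for large spectral parameter\<close>

lemma has_integral_reflect_interval:
  fixes f :: "real \<Rightarrow> 'a::real_normed_vector"
  assumes "(f has_integral i) {u..v}"
  shows "((\<lambda>t. f (s - t)) has_integral i) {s - v..s - u}"
proof -
  have "((\<lambda>x. f (-1 *\<^sub>R x + s)) has_integral (1 / \<bar>-1\<bar> ^ DIM(real)) *\<^sub>R i)
          ((\<lambda>x. (1 / (-1)) *\<^sub>R x + - ((1 / (-1)) *\<^sub>R s)) ` cbox u v)"
    using has_integral_affinity[of f i u v "-1" s] assms by simp
  moreover have "(\<lambda>x. (1 / (-1)) *\<^sub>R x + - ((1 / (-1)) *\<^sub>R s)) ` cbox u v = {s - v..s - u}"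
  proof (intro set_eqI iffI)
    fix x assume "x \<in> {s - v..s - u}"
    then show "x \<in> (\<lambda>x. (1 / (-1)) *\<^sub>R x + - ((1 / (-1)) *\<^sub>R s)) ` cbox u v"
      by (intro image_eqI[of _ _ "s - x"]) auto
  qed auto
  ultimately show ?thesis by (simp add: algebra_simps)
qed

text \<open>Makes estimates for data at the left endpoint available for solutions prescribed at the
  right one; the derivative changes sign.\<close>

lemma ode_sol_reflect:
  assumes "ode_sol q l a c y dy"
  shows "ode_sol (\<lambda>t. q (a + c - t)) l a c (\<lambda>t. y (a + c - t)) (\<lambda>t. - dy (a + c - t))"
  unfolding ode_sol_def
proof (intro ballI)
  fix x assume x: "x \<in> {a..c}"
  then have u: "a + c - x \<in> {a..c}" "c \<in> {a..c}" "a \<le> a + c - x" "a + c - x \<le> c" by auto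
  have "(dy has_integral (y c - y (a + c - x))) {a + c - x..c}"
       "((\<lambda>t. (q t - l) * y t) has_integral (dy c - dy (a + c - x))) {a + c - x..c}"
    using has_integral_increment[OF ode_solD(1)[OF assms u(1)] ode_solD(1)[OF assms u(2)] u(3,4)]
      has_integral_increment[OF ode_solD(2)[OF assms u(1)] ode_solD(2)[OF assms u(2)] u(3,4)] by auto
  from has_integral_neg[OF has_integral_reflect_interval[OF this(1), of "a + c"]]
    has_integral_reflect_interval[OF this(2), of "a + c"]
  show "((\<lambda>t. - dy (a + c - t)) has_integral (y (a + c - x) - y (a + c - a))) {a..x} \<and>
        ((\<lambda>t. (q (a + c - t) - l) * y (a + c - t)) has_integral (- dy (a + c - x) - - dy (a + c - a))) {a..x}"
    by simp
qed

lemma absolutely_integrable_reflect_interval: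
  fixes q :: "real \<Rightarrow> complex"
  assumes "q absolutely_integrable_on {a..c}"
  shows "(\<lambda>t. q (a + c - t)) absolutely_integrable_on {a..c}"
proof -
  have "q integrable_on {a..c}" "(\<lambda>t. norm (q t)) integrable_on {a..c}"
    using assms by (auto simp: absolutely_integrable_on_def)
  then show ?thesis
    unfolding absolutely_integrable_on_def integrable_on_def
    using has_integral_reflect_interval[of q _ a c "a + c"]
      has_integral_reflect_interval[of "\<lambda>t. norm (q t)" _ a c "a + c"] by auto
qed

text \<open>
  For \<open>r\<^sup>2 = - l\<close> the function \<open>u = y' + r y\<close> satisfies \<open>(exp (- r t) u)' = exp (- r t) q y\<close>.
\<close>

lemma ode_sol_exponential_error:
  assumes q: "q absolutely_integrable_on {a..c}" and s: "ode_sol q l a c y dy" and ac: "x \<in> {a..c}"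
    and r: "r * r = - l" "\<bar>Re r\<bar> = \<tau>"
    and M: "\<And>t. t \<in> {a..c} \<Longrightarrow> norm (y t) \<le> M * exp (\<tau> * (t - a))"
  shows "norm (dy x + r * y x - exp (r * of_real (x - a)) * (dy a + r * y a))
           \<le> exp (\<tau> * (x - a)) * (M * integral {a..c} (\<lambda>t. norm (q t)))"
proof -
  note c = ode_sol_continuous[OF s]
  let ?E = "\<lambda>t. exp (- r * of_real (t - a))"
  let ?u = "\<lambda>t. dy t + r * y t"
  have cE: "continuous_on {a..c} ?E" by (intro continuous_intros)
  have E: "((\<lambda>t. - r * ?E t) has_integral (?E x - ?E a)) {a..x}" if "x \<in> {a..c}" for x
  proof (rule fundamental_theorem_of_calculus)
    show "a \<le> x" using that by simp
    fix t
    have "((\<lambda>z. exp (- r * (z - of_real a))) has_field_derivative - r * exp (- r * (of_real t - of_real a))) (at (of_real t))"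
      by (rule derivative_eq_intros refl | simp)+
    then show "(?E has_vector_derivative - r * ?E t) (at t within {a..x})"
      unfolding of_real_diff by (rule has_vector_derivative_real_field)
  qed
  have i: "(\<lambda>t. (q t - l) * y t + r * dy t) absolutely_integrable_on {a..c}"
  proof (rule set_integral_add(1))
    have "(\<lambda>t. q t - l) absolutely_integrable_on {a..c}" using q by (intro set_integral_diff(1)) auto
    then show "(\<lambda>t. (q t - l) * y t) absolutely_integrable_on {a..c}"
      using c(1) by (rule absolutely_integrable_mult_continuous)
    show "(\<lambda>t. r * dy t) absolutely_integrable_on {a..c}"
      using c by (intro absolutely_integrable_continuous_real continuous_intros)
  qed
  have u: "((\<lambda>t. (q t - l) * y t + r * dy t) has_integral (?u x - ?u a)) {a..x}" if "x \<in> {a..c}" for x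
    using has_integral_add[OF ode_solD(2)[OF s that] has_integral_mult_right[OF ode_solD(1)[OF s that], of r]]
    by (simp add: algebra_simps)
  have "((\<lambda>t. (- r * ?E t) * ?u t + ?E t * ((q t - l) * y t + r * dy t)) has_integral
           (?E x * ?u x - ?E a * ?u a)) {a..x}"
    by (rule indefinite_integral_product[OF absolutely_integrable_continuous_real i E u ac])
       (intro continuous_intros)
  also have "(\<lambda>t. (- r * ?E t) * ?u t + ?E t * ((q t - l) * y t + r * dy t)) = (\<lambda>t. ?E t * (q t * y t))"
  proof
    fix t
    have "l = - (r * r)" using r(1) by simp
    then show "(- r * ?E t) * ?u t + ?E t * ((q t - l) * y t + r * dy t) = ?E t * (q t * y t)"
      by (simp add: algebra_simps)
  qed
  finally have "((\<lambda>t. exp (r * of_real (x - a)) * (?E t * (q t * y t))) has_integral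
     exp (r * of_real (x - a)) * (?E x * ?u x - ?u a)) {a..x}"
    by (intro has_integral_mult_right) simp
  moreover have "exp (r * of_real (x - a)) * (?E x * ?u x - ?u a) = ?u x - exp (r * of_real (x - a)) * ?u a"
  proof -
    have "exp (r * of_real (x - a)) * ?E x = 1" by (simp only: mult_minus_left exp_minus) simp
    then show ?thesis by (simp only: right_diff_distrib mult.assoc[symmetric]) simp
  qed
  moreover have "(\<lambda>t. exp (r * of_real (x - a)) * (?E t * (q t * y t))) = (\<lambda>t. exp (r * of_real (x - t)) * (q t * y t))"
  proof
    fix t
    have "exp (r * of_real (x - a)) * ?E t = exp (r * of_real (x - t))"
      by (simp only: exp_add[symmetric]) (simp add: algebra_simps)
    then show "exp (r * of_real (x - a)) * (?E t * (q t * y t)) = exp (r * of_real (x - t)) * (q t * y t)"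
      by (simp only: mult.assoc[symmetric])
  qed
  ultimately have h: "((\<lambda>t. exp (r * of_real (x - t)) * (q t * y t)) has_integral (?u x - exp (r * of_real (x - a)) * ?u a)) {a..x}"
    by simp
  have qn: "(\<lambda>t. norm (q t)) integrable_on {a..c}" using q by (simp add: absolutely_integrable_on_def)
  hence qx: "(\<lambda>t. norm (q t)) integrable_on {a..x}"
    using ac integrable_on_subinterval[OF qn, of a x] by auto
  have M0: "0 \<le> M" using M[of a] ac order_trans[OF norm_ge_zero M[of a]] by auto
  have "norm (?u x - exp (r * of_real (x - a)) * ?u a) \<le> integral {a..x} (\<lambda>t. (exp (\<tau> * (x - a)) * M) * norm (q t))"
    unfolding integral_unique[OF h, symmetric]
  proof (rule integral_norm_bound_integral)
    show "(\<lambda>t. exp (r * of_real (x - t)) * (q t * y t)) integrable_on {a..x}" using h by auto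
    show "(\<lambda>t. (exp (\<tau> * (x - a)) * M) * norm (q t)) integrable_on {a..x}" using qx by (rule integrable_on_mult_right)
    fix t assume t: "t \<in> {a..x}"
    have "Re r * (x - t) \<le> \<tau> * (x - t)" using t r(2) by (intro mult_right_mono) auto
    hence "norm (exp (r * of_real (x - t))) \<le> exp (\<tau> * (x - t))" by simp
    moreover have "norm (y t) \<le> M * exp (\<tau> * (t - a))" using M t ac by auto
    ultimately have "norm (exp (r * of_real (x - t))) * (norm (q t) * norm (y t)) \<le>
        exp (\<tau> * (x - t)) * (norm (q t) * (M * exp (\<tau> * (t - a))))"
      by (intro mult_mono) auto
    also have "\<dots> = (exp (\<tau> * (x - t)) * exp (\<tau> * (t - a))) * M * norm (q t)" by simp
    also have "exp (\<tau> * (x - t)) * exp (\<tau> * (t - a)) = exp (\<tau> * (x - a))"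
      by (simp add: exp_add[symmetric] algebra_simps)
    finally show "norm (exp (r * of_real (x - t)) * (q t * y t)) \<le> (exp (\<tau> * (x - a)) * M) * norm (q t)"
      by (simp add: norm_mult)
  qed
  also have "\<dots> = (exp (\<tau> * (x - a)) * M) * integral {a..x} (\<lambda>t. norm (q t))" by simp
  also have "\<dots> \<le> (exp (\<tau> * (x - a)) * M) * integral {a..c} (\<lambda>t. norm (q t))"
    using M0 qn qx ac by (intro mult_left_mono integral_subset_le) auto
  finally show ?thesis by (simp add: mult.assoc)
qed

lemma norm_exp_iz_le: "norm (exp (\<i> * z)) \<le> exp \<bar>Im z\<bar>" "norm (exp (- \<i> * z)) \<le> exp \<bar>Im z\<bar>"
  by auto

lemma norm_cos_le_exp_Im: "norm (cos z) \<le> exp \<bar>Im z\<bar>" for z :: complex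
proof -
  have "norm (cos z) \<le> (norm (exp (\<i> * z)) + norm (exp (- \<i> * z))) / 2"
    unfolding cos_exp_eq using norm_triangle_ineq[of "exp (\<i> * z)" "exp (- \<i> * z)"] by (simp add: norm_divide)
  also have "\<dots> \<le> (exp \<bar>Im z\<bar> + exp \<bar>Im z\<bar>) / 2"
    by (intro divide_right_mono add_mono norm_exp_iz_le) simp
  finally show ?thesis by simp
qed

lemma norm_sin_le_exp_Im: "norm (sin z) \<le> exp \<bar>Im z\<bar>" for z :: complex
proof -
  have "norm (sin z) \<le> (norm (exp (\<i> * z)) + norm (exp (- \<i> * z))) / 2"
    unfolding sin_exp_eq using norm_triangle_ineq4[of "exp (\<i> * z)" "exp (- \<i> * z)"] by (simp add: norm_divide norm_mult)
  also have "\<dots> \<le> (exp \<bar>Im z\<bar> + exp \<bar>Im z\<bar>) / 2"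
    by (intro divide_right_mono add_mono norm_exp_iz_le) simp
  finally show ?thesis by simp
qed

text \<open>\<open>ode_sol_exponential_error\<close> with r = \<i> \<rho> and r = - \<i> \<rho>: the
  difference of the two estimates, divided by 2 \<i> \<rho>, isolates \<open>y\<close>, and half
  their sum isolates \<open>dy\<close>.\<close>

lemma ode_sol_asymptotics_aux:
  fixes \<rho> :: complex
  assumes q: "q absolutely_integrable_on {a..c}" and s: "ode_sol q (\<rho>\<^sup>2) a c y dy" and x: "x \<in> {a..c}"
    and rho: "\<rho> \<noteq> 0"
    and M: "\<And>t. t \<in> {a..c} \<Longrightarrow> norm (y t) \<le> M * exp (\<bar>Im \<rho>\<bar> * (t - a))"
  defines "Q \<equiv> integral {a..c} (\<lambda>t. norm (q t))" and "X \<equiv> complex_of_real (x - a)"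
  shows "norm (y x - (y a * cos (\<rho> * X) + dy a * sin (\<rho> * X) / \<rho>)) \<le> exp (\<bar>Im \<rho>\<bar> * (x - a)) * (M * Q) / norm \<rho>"
    and "norm (dy x - (- \<rho> * y a * sin (\<rho> * X) + dy a * cos (\<rho> * X))) \<le> exp (\<bar>Im \<rho>\<bar> * (x - a)) * (M * Q)"
proof -
  let ?p = "exp (\<i> * \<rho> * X)" and ?m = "exp (- \<i> * \<rho> * X)"
  have ii: "\<i> * \<rho> * (\<i> * \<rho>) = - \<rho>\<^sup>2" "(- \<i> * \<rho>) * (- \<i> * \<rho>) = - \<rho>\<^sup>2"
    by (simp_all add: power2_eq_square mult.assoc mult.left_commute[of \<rho> \<i>])
  have p: "norm (dy x + \<i> * \<rho> * y x - ?p * (dy a + \<i> * \<rho> * y a)) \<le> exp (\<bar>Im \<rho>\<bar> * (x - a)) * (M * Q)"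
    unfolding X_def Q_def
    by (rule ode_sol_exponential_error[OF q s x ii(1) _ M]) auto
  have m: "norm (dy x + (- \<i> * \<rho>) * y x - ?m * (dy a + (- \<i> * \<rho>) * y a)) \<le> exp (\<bar>Im \<rho>\<bar> * (x - a)) * (M * Q)"
    unfolding X_def Q_def
    by (rule ode_sol_exponential_error[OF q s x ii(2) _ M]) auto
  have c: "cos (\<rho> * X) = (?p + ?m) / 2" "sin (\<rho> * X) = (?p - ?m) / (2 * \<i>)"
    by (simp_all add: cos_exp_eq sin_exp_eq mult.assoc)
  have 1: "y x - (y a * cos (\<rho> * X) + dy a * sin (\<rho> * X) / \<rho>) =
     ((dy x + \<i> * \<rho> * y x - ?p * (dy a + \<i> * \<rho> * y a)) - (dy x + (- \<i> * \<rho>) * y x - ?m * (dy a + (- \<i> * \<rho>) * y a))) / (2 * \<i> * \<rho>)"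
    unfolding c using rho by (simp add: field_simps)
  have 2: "dy x - (- \<rho> * y a * sin (\<rho> * X) + dy a * cos (\<rho> * X)) =
     ((dy x + \<i> * \<rho> * y x - ?p * (dy a + \<i> * \<rho> * y a)) + (dy x + (- \<i> * \<rho>) * y x - ?m * (dy a + (- \<i> * \<rho>) * y a))) / 2"
    unfolding c using rho by (simp add: field_simps)
  have half: "norm (u - v) / (2 * k) \<le> E / k" "norm (u + v) / 2 \<le> E" if "norm u \<le> E" "norm v \<le> E" "k > 0" for u v :: complex and E k :: real
  proof -
    have "norm (u - v) \<le> 2 * E" using norm_triangle_ineq4[of u v] that by linarith
    then show "norm (u - v) / (2 * k) \<le> E / k" using that(3) by (simp add: field_simps)
    show "norm (u + v) / 2 \<le> E" using norm_triangle_ineq[of u v] that by linarith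
  qed
  show "norm (y x - (y a * cos (\<rho> * X) + dy a * sin (\<rho> * X) / \<rho>)) \<le> exp (\<bar>Im \<rho>\<bar> * (x - a)) * (M * Q) / norm \<rho>"
    unfolding 1 using half(1)[OF p m] rho by (simp add: norm_divide norm_mult)
  show "norm (dy x - (- \<rho> * y a * sin (\<rho> * X) + dy a * cos (\<rho> * X))) \<le> exp (\<bar>Im \<rho>\<bar> * (x - a)) * (M * Q)"
    unfolding 2 using half(2)[OF p m, of 1] by (simp add: norm_divide)
qed

lemma trig_combination_bound:
  fixes \<rho> u v :: complex and X :: real
  assumes rho: "\<rho> \<noteq> 0" and X: "0 \<le> X"
  shows "norm (u * cos (\<rho> * of_real X) + v * sin (\<rho> * of_real X) / \<rho>) \<le> (norm v + norm \<rho> * norm u) / norm \<rho> * exp (\<bar>Im \<rho>\<bar> * X)"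
    and "norm (- \<rho> * u * sin (\<rho> * of_real X) + v * cos (\<rho> * of_real X)) \<le> (norm v + norm \<rho> * norm u) * exp (\<bar>Im \<rho>\<bar> * X)"
proof -
  have t: "norm (cos (\<rho> * of_real X)) \<le> exp (\<bar>Im \<rho>\<bar> * X)" "norm (sin (\<rho> * of_real X)) \<le> exp (\<bar>Im \<rho>\<bar> * X)"
    using norm_cos_le_exp_Im[of "\<rho> * of_real X"] norm_sin_le_exp_Im[of "\<rho> * of_real X"] X by (auto simp: abs_mult)
  have "norm (u * cos (\<rho> * of_real X) + v * sin (\<rho> * of_real X) / \<rho>)
      \<le> norm u * norm (cos (\<rho> * of_real X)) + norm v / norm \<rho> * norm (sin (\<rho> * of_real X))"
    by (rule norm_triangle_le) (simp add: norm_mult norm_divide)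
  also have "\<dots> \<le> norm u * exp (\<bar>Im \<rho>\<bar> * X) + norm v / norm \<rho> * exp (\<bar>Im \<rho>\<bar> * X)"
    by (intro add_mono mult_left_mono t) auto
  also have "\<dots> = (norm v + norm \<rho> * norm u) / norm \<rho> * exp (\<bar>Im \<rho>\<bar> * X)"
    using rho by (simp add: field_simps)
  finally show "norm (u * cos (\<rho> * of_real X) + v * sin (\<rho> * of_real X) / \<rho>) \<le> (norm v + norm \<rho> * norm u) / norm \<rho> * exp (\<bar>Im \<rho>\<bar> * X)" .
  have "norm (- \<rho> * u * sin (\<rho> * of_real X) + v * cos (\<rho> * of_real X))
     \<le> norm \<rho> * norm u * norm (sin (\<rho> * of_real X)) + norm v * norm (cos (\<rho> * of_real X))"
    by (rule norm_triangle_le) (simp add: norm_mult)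
  also have "\<dots> \<le> norm \<rho> * norm u * exp (\<bar>Im \<rho>\<bar> * X) + norm v * exp (\<bar>Im \<rho>\<bar> * X)"
    by (intro add_mono mult_left_mono t) auto
  finally show "norm (- \<rho> * u * sin (\<rho> * of_real X) + v * cos (\<rho> * of_real X)) \<le> (norm v + norm \<rho> * norm u) * exp (\<bar>Im \<rho>\<bar> * X)"
    by (simp add: algebra_simps)
qed

text \<open>The bound \<open>M\<close> assumed in the auxiliary lemma is now produced. At a maximum
  of |y| exp (- \<tau> (t - a)) the error is at most M Q / |\<rho>|, hence at most M / 2 by the
  assumption on |\<rho>|, and it can be absorbed: M is at most 2 S / |\<rho>|.\<close>

lemma ode_sol_asymptotics:
  fixes \<rho> :: complex
  assumes q: "q absolutely_integrable_on {a..c}" and s: "ode_sol q (\<rho>\<^sup>2) a c y dy" and x: "x \<in> {a..c}"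
    and rho: "\<rho> \<noteq> 0" "2 * integral {a..c} (\<lambda>t. norm (q t)) \<le> norm \<rho>"
  defines "Q \<equiv> integral {a..c} (\<lambda>t. norm (q t))" and "X \<equiv> complex_of_real (x - a)"
    and "S \<equiv> norm (dy a) + norm \<rho> * norm (y a)"
  shows "norm (y x) \<le> 2 * S / norm \<rho> * exp (\<bar>Im \<rho>\<bar> * (x - a))"
    and "norm (dy x) \<le> 2 * S * exp (\<bar>Im \<rho>\<bar> * (x - a))"
    and "norm (y x - (y a * cos (\<rho> * X) + dy a * sin (\<rho> * X) / \<rho>)) \<le> 2 * Q * S / (norm \<rho>)\<^sup>2 * exp (\<bar>Im \<rho>\<bar> * (x - a))"
    and "norm (dy x - (- \<rho> * y a * sin (\<rho> * X) + dy a * cos (\<rho> * X))) \<le> 2 * Q * S / norm \<rho> * exp (\<bar>Im \<rho>\<bar> * (x - a))"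
proof -
  let ?\<tau> = "\<bar>Im \<rho>\<bar>"
  have ac: "a \<le> c" using x by auto
  have r0: "norm \<rho> > 0" using rho(1) by simp
  have Q0: "Q \<ge> 0" unfolding Q_def using q by (intro integral_nonneg) (auto simp: absolutely_integrable_on_def)
  have "continuous_on {a..c} (\<lambda>t. norm (y t) * exp (- ?\<tau> * (t - a)))"
    using ode_sol_continuous(1)[OF s] by (intro continuous_intros)
  then obtain x0 where x0: "x0 \<in> {a..c}"
    "\<And>t. t \<in> {a..c} \<Longrightarrow> norm (y t) * exp (- ?\<tau> * (t - a)) \<le> norm (y x0) * exp (- ?\<tau> * (x0 - a))"
    using continuous_attains_sup[of "{a..c}"] ac by (metis (no_types, lifting) atLeastatMost_empty_iff2 compact_Icc not_le)
  define M where "M = norm (y x0) * exp (- ?\<tau> * (x0 - a))"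
  have M: "norm (y t) \<le> M * exp (?\<tau> * (t - a))" if "t \<in> {a..c}" for t
    using mult_right_mono[OF x0(2)[OF that] exp_ge_zero[of "?\<tau> * (t - a)"]] unfolding M_def[symmetric]
    by (simp add: mult.assoc exp_add[symmetric])
  have yx0: "norm (y x0) = M * exp (?\<tau> * (x0 - a))" unfolding M_def by (simp add: exp_minus)
  have M0: "M \<ge> 0" unfolding M_def by simp
  have "norm (y x0) \<le> exp (?\<tau> * (x0 - a)) * (M * Q) / norm \<rho> + S / norm \<rho> * exp (?\<tau> * (x0 - a))"
    using ode_sol_asymptotics_aux(1)[OF q s x0(1) rho(1) M] trig_combination_bound(1)[OF rho(1), of "x0 - a" "y a" "dy a"] x0(1)
      norm_triangle_sub[of "y x0" "y a * cos (\<rho> * of_real (x0 - a)) + dy a * sin (\<rho> * of_real (x0 - a)) / \<rho>"]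
    unfolding Q_def S_def by fastforce
  also have "\<dots> = (M * Q / norm \<rho> + S / norm \<rho>) * exp (?\<tau> * (x0 - a))"
    by (simp add: distrib_right)
  finally have "M \<le> M * Q / norm \<rho> + S / norm \<rho>"
    unfolding yx0 by simp
  moreover have "M * Q / norm \<rho> \<le> M / 2"
    using mult_left_mono[OF rho(2) M0] r0 unfolding Q_def[symmetric] by (simp add: field_simps)
  ultimately have "M \<le> 2 * (S / norm \<rho>)" by linarith
  hence MS: "M \<le> 2 * S / norm \<rho>" by simp
  have "norm (y x) \<le> M * exp (?\<tau> * (x - a))" by (rule M[OF x])
  also have "\<dots> \<le> 2 * S / norm \<rho> * exp (?\<tau> * (x - a))" using MS by (intro mult_right_mono) auto
  finally show "norm (y x) \<le> 2 * S / norm \<rho> * exp (?\<tau> * (x - a))" .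
  have MQ: "exp (?\<tau> * (x - a)) * (M * Q) \<le> 2 * Q * S / norm \<rho> * exp (?\<tau> * (x - a))"
    using mult_left_mono[OF mult_right_mono[OF MS Q0] exp_ge_zero[of "?\<tau> * (x - a)"]] by (simp add: mult_ac)
  have "norm (y x - (y a * cos (\<rho> * X) + dy a * sin (\<rho> * X) / \<rho>)) \<le> exp (?\<tau> * (x - a)) * (M * Q) / norm \<rho>"
    using ode_sol_asymptotics_aux(1)[OF q s x rho(1) M] unfolding Q_def X_def .
  also have "\<dots> \<le> (2 * Q * S / norm \<rho> * exp (?\<tau> * (x - a))) / norm \<rho>"
    using MQ by (intro divide_right_mono) auto
  finally show "norm (y x - (y a * cos (\<rho> * X) + dy a * sin (\<rho> * X) / \<rho>)) \<le> 2 * Q * S / (norm \<rho>)\<^sup>2 * exp (?\<tau> * (x - a))"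
    by (simp add: power2_eq_square)
  have e: "norm (dy x - (- \<rho> * y a * sin (\<rho> * X) + dy a * cos (\<rho> * X))) \<le> exp (?\<tau> * (x - a)) * (M * Q)"
    using ode_sol_asymptotics_aux(2)[OF q s x rho(1) M] unfolding Q_def X_def .
  then show "norm (dy x - (- \<rho> * y a * sin (\<rho> * X) + dy a * cos (\<rho> * X))) \<le> 2 * Q * S / norm \<rho> * exp (?\<tau> * (x - a))"
    using MQ by linarith
  have S0: "S \<ge> 0" by (simp add: S_def)
  have "M * Q \<le> S"
  proof -
    have "M * Q \<le> 2 * S / norm \<rho> * Q" using MS Q0 by (rule mult_right_mono)
    also have "\<dots> = S * (2 * Q) / norm \<rho>" by simp
    also have "\<dots> \<le> S * norm \<rho> / norm \<rho>"
      using rho(2) S0 r0 unfolding Q_def[symmetric] by (intro divide_right_mono mult_left_mono) auto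
    finally show ?thesis using r0 by simp
  qed
  hence "exp (?\<tau> * (x - a)) * (M * Q) \<le> exp (?\<tau> * (x - a)) * S" by (intro mult_left_mono) auto
  then show "norm (dy x) \<le> 2 * S * exp (?\<tau> * (x - a))"
    using e trig_combination_bound(2)[OF rho(1), of "x - a" "y a" "dy a"] x
      norm_triangle_sub[of "dy x" "- \<rho> * y a * sin (\<rho> * X) + dy a * cos (\<rho> * X)"]
    unfolding S_def X_def by (simp add: algebra_simps)
qed

text \<open>
  Here \<open>c0\<close> and \<open>c1\<close> are the leading terms of the initial data and \<open>E\<close> is the growth already
  accumulated to the left of \<open>a\<close>, so that the estimate can be chained across the discontinuity.
\<close>

lemma ode_sol_asymptotics_perturbed:
  fixes \<rho> :: complex and c0 c1 :: complex
  assumes q: "q absolutely_integrable_on {a..c}" and s: "ode_sol q (\<rho>\<^sup>2) a c y dy" and x: "x \<in> {a..c}"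
    and rho: "\<rho> \<noteq> 0" "2 * integral {a..c} (\<lambda>t. norm (q t)) \<le> norm \<rho>"
    and init: "norm (y a - c0) \<le> k * E / norm \<rho>" "norm (dy a - c1) \<le> k * E"
    and lead: "norm c0 \<le> m * E" "norm c1 \<le> m * norm \<rho> * E" and one: "1 \<le> norm \<rho>"
  defines "Q \<equiv> integral {a..c} (\<lambda>t. norm (q t))" and "X \<equiv> complex_of_real (x - a)"
  shows "norm (y x - (c0 * cos (\<rho> * X) + c1 * sin (\<rho> * X) / \<rho>)) \<le> (2 * k + 4 * Q * (m + k)) * (E * exp (\<bar>Im \<rho>\<bar> * (x - a))) / norm \<rho>"
    and "norm (dy x - (- \<rho> * c0 * sin (\<rho> * X) + c1 * cos (\<rho> * X))) \<le> (2 * k + 4 * Q * (m + k)) * (E * exp (\<bar>Im \<rho>\<bar> * (x - a)))"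
proof -
  let ?e = "exp (\<bar>Im \<rho>\<bar> * (x - a))" and ?S = "norm (dy a) + norm \<rho> * norm (y a)"
  have xa: "0 \<le> x - a" using x by auto
  have r0: "norm \<rho> > 0" using rho(1) by simp
  have Q0: "Q \<ge> 0" unfolding Q_def using q by (intro integral_nonneg) (auto simp: absolutely_integrable_on_def)
  have kE: "0 \<le> k * E" using init(2) norm_ge_zero order_trans by blast
  have "norm (dy a) \<le> k * E + m * norm \<rho> * E"
    using norm_triangle_sub[of "dy a" c1] init(2) lead(2) by linarith
  moreover have "k * E \<le> k * E * norm \<rho>" using mult_left_mono[OF one kE] by simp
  moreover have "norm (y a) \<le> k * E / norm \<rho> + m * E"
    using norm_triangle_sub[of "y a" c0] init(1) lead(1) by linarith
  hence "norm \<rho> * norm (y a) \<le> norm \<rho> * (k * E / norm \<rho> + m * E)" by (intro mult_left_mono) auto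
  hence "norm \<rho> * norm (y a) \<le> k * E + norm \<rho> * m * E" using r0 by (simp add: field_simps)
  ultimately have S: "?S \<le> 2 * (m + k) * E * norm \<rho>" by (simp add: algebra_simps)
  have d: "norm (dy a - c1) + norm \<rho> * norm (y a - c0) \<le> 2 * k * E"
    using init mult_left_mono[OF init(1), of "norm \<rho>"] r0 by simp
  have Qe: "0 \<le> 2 * Q * ?e" using Q0 by simp
  note A = ode_sol_asymptotics[OF q s x rho, folded Q_def X_def]
  have 1: "norm ((y a - c0) * cos (\<rho> * X) + (dy a - c1) * sin (\<rho> * X) / \<rho>) \<le> 2 * k * E / norm \<rho> * ?e"
    using trig_combination_bound(1)[OF rho(1) xa, of "y a - c0" "dy a - c1", folded X_def]
      mult_right_mono[OF divide_right_mono[OF d, of "norm \<rho>"], of ?e] by simp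
  have 2: "norm (- \<rho> * (y a - c0) * sin (\<rho> * X) + (dy a - c1) * cos (\<rho> * X)) \<le> 2 * k * E * ?e"
    using trig_combination_bound(2)[OF rho(1) xa, of "y a - c0" "dy a - c1", folded X_def]
      mult_right_mono[OF d exp_ge_zero[of "\<bar>Im \<rho>\<bar> * (x - a)"]] by (rule order_trans)
  have S1: "2 * Q * ?S / norm \<rho> * ?e \<le> 4 * Q * (m + k) * (E * ?e)"
  proof -
    have "2 * Q * ?S / norm \<rho> * ?e = (2 * Q * ?e) * ?S / norm \<rho>" by simp
    also have "\<dots> \<le> (2 * Q * ?e) * (2 * (m + k) * E * norm \<rho>) / norm \<rho>"
      using mult_left_mono[OF S Qe] r0 by (intro divide_right_mono) auto
    also have "\<dots> = 4 * Q * (m + k) * (E * ?e)" using r0 by simp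
    finally show ?thesis .
  qed
  hence S2: "2 * Q * ?S / (norm \<rho>)\<^sup>2 * ?e \<le> 4 * Q * (m + k) * (E * ?e) / norm \<rho>"
    using divide_right_mono[OF S1, of "norm \<rho>"] r0 by (simp add: power2_eq_square mult.commute)
  have "norm (y x - (c0 * cos (\<rho> * X) + c1 * sin (\<rho> * X) / \<rho>)) \<le>
     norm (y x - (y a * cos (\<rho> * X) + dy a * sin (\<rho> * X) / \<rho>)) + norm ((y a - c0) * cos (\<rho> * X) + (dy a - c1) * sin (\<rho> * X) / \<rho>)"
    using norm_triangle_ineq[of "y x - (y a * cos (\<rho> * X) + dy a * sin (\<rho> * X) / \<rho>)" "(y a - c0) * cos (\<rho> * X) + (dy a - c1) * sin (\<rho> * X) / \<rho>"]
    by (simp add: algebra_simps diff_divide_distrib)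
  also have "\<dots> \<le> 4 * Q * (m + k) * (E * ?e) / norm \<rho> + 2 * k * E / norm \<rho> * ?e"
    using A(3) S2 1 by linarith
  also have "\<dots> = (2 * k + 4 * Q * (m + k)) * (E * ?e) / norm \<rho>"
    by (simp add: add_divide_distrib algebra_simps)
  finally show "norm (y x - (c0 * cos (\<rho> * X) + c1 * sin (\<rho> * X) / \<rho>)) \<le> (2 * k + 4 * Q * (m + k)) * (E * ?e) / norm \<rho>" .
  have "norm (dy x - (- \<rho> * c0 * sin (\<rho> * X) + c1 * cos (\<rho> * X))) \<le>
     norm (dy x - (- \<rho> * y a * sin (\<rho> * X) + dy a * cos (\<rho> * X))) + norm (- \<rho> * (y a - c0) * sin (\<rho> * X) + (dy a - c1) * cos (\<rho> * X))"
    using norm_triangle_ineq[of "dy x - (- \<rho> * y a * sin (\<rho> * X) + dy a * cos (\<rho> * X))" "- \<rho> * (y a - c0) * sin (\<rho> * X) + (dy a - c1) * cos (\<rho> * X)"]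
    by (simp add: algebra_simps)
  also have "\<dots> \<le> 4 * Q * (m + k) * (E * ?e) + 2 * k * E * ?e"
    using A(4) S1 2 by linarith
  also have "\<dots> = (2 * k + 4 * Q * (m + k)) * (E * ?e)"
    by (simp add: algebra_simps)
  finally show "norm (dy x - (- \<rho> * c0 * sin (\<rho> * X) + c1 * cos (\<rho> * X))) \<le> (2 * k + 4 * Q * (m + k)) * (E * ?e)" .
qed

section \<open>Lower bounds for trigonometric functions on circles\<close>

lemma norm_sin_squared_cosh: "(norm (sin z))\<^sup>2 = (cosh (Im z))\<^sup>2 - (cos (Re z))\<^sup>2" for z :: complex
proof -
  have "(norm (sin z))\<^sup>2 = (sin (Re z) * cosh (Im z))\<^sup>2 + (cos (Re z) * sinh (Im z))\<^sup>2"
    by (simp add: cmod_power2 Re_sin Im_sin cosh_field_def sinh_field_def exp_minus field_simps)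
  also have "\<dots> = (cosh (Im z))\<^sup>2 - (cos (Re z))\<^sup>2"
    by (simp add: power_mult_distrib sin_squared_eq cosh_square_eq algebra_simps)
  finally show ?thesis .
qed

lemma norm_cos_squared_cosh: "(norm (cos z))\<^sup>2 = (cosh (Im z))\<^sup>2 - (sin (Re z))\<^sup>2" for z :: complex
  using norm_sin_squared_cosh[of "of_real (pi / 2) - z"]
  by (simp add: sin_diff cos_diff sin_of_real cos_of_real)

lemma norm_trig_le_cosh: "norm (sin z) \<le> cosh (Im z)" "norm (cos z) \<le> cosh (Im z)" for z :: complex
  by (rule power2_le_imp_le; simp add: norm_sin_squared_cosh norm_cos_squared_cosh)+

text \<open>
  \<open>\<bar>cos z\<bar>\<^sup>2 = cosh\<^sup>2 (Im z) - sin\<^sup>2 (Re z)\<close>, and on the circles in question either the first term is large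
  or \<open>\<bar>Re \<rho>\<bar>\<close> is so close to \<open>\<bar>\<rho>\<bar>\<close> that the second one is small.
\<close>

lemma trig_lower_bound:
  fixes L \<kappa> :: real
  assumes L: "0 < L" and k: "0 < \<kappa>" "\<kappa> < 1"
  shows "\<exists>R0>0. \<forall>\<rho>::complex. norm \<rho> \<ge> R0 \<longrightarrow>
     (sin (L * norm \<rho>) = 0 \<longrightarrow> norm (cos (of_real L * \<rho>)) \<ge> \<kappa> * cosh (L * Im \<rho>)) \<and>
     (cos (L * norm \<rho>) = 0 \<longrightarrow> norm (sin (of_real L * \<rho>)) \<ge> \<kappa> * cosh (L * Im \<rho>))"
proof -
  \<comment> \<open>If the subtracted square is at most \<epsilon> squared times cosh squared,
    exactly the factor \<kappa> squared remains.\<close>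
  define \<epsilon> where "\<epsilon> = sqrt (1 - \<kappa>\<^sup>2)"
  have k2: "\<kappa>\<^sup>2 < 1" using k by (simp add: power_less_one_iff)
  have e: "\<epsilon> > 0" "\<epsilon>\<^sup>2 = 1 - \<kappa>\<^sup>2" using k2 by (auto simp: \<epsilon>_def)
  \<comment> \<open>If \<epsilon> cosh (L Im \<rho>) < 1 then |Im \<rho>| is at most
    \<open>Y\<close>, and |\<rho>| - |Re \<rho>| is at most Y^2 / |\<rho>|. The choice of
    \<open>R0\<close> makes this at most \<epsilon> / L.\<close>
  define Y where "Y = 2 / (\<epsilon> * L)"
  have Y: "Y > 0" using e L by (simp add: Y_def)
  define R0 where "R0 = L * Y\<^sup>2 / \<epsilon>"
  have R0: "R0 > 0" using L Y e by (simp add: R0_def)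
  have key: "\<kappa> * cosh (L * Im \<rho>) \<le> N" 
    if r: "norm \<rho> \<ge> R0" and N: "N \<ge> 0" "N\<^sup>2 = (cosh (L * Im \<rho>))\<^sup>2 - g\<^sup>2" "\<bar>g\<bar> \<le> 1" "\<bar>g\<bar> \<le> \<bar>sin (L * norm \<rho> - L * \<bar>Re \<rho>\<bar>)\<bar>"
    for \<rho> :: complex and N g
  proof -
    let ?C = "cosh (L * Im \<rho>)"
    have g: "g\<^sup>2 \<le> \<epsilon>\<^sup>2 * ?C\<^sup>2"
    proof (cases "\<epsilon> * ?C \<ge> 1")
      case True
      hence "1 \<le> (\<epsilon> * ?C)\<^sup>2" by (simp add: one_le_power)
      moreover have "g\<^sup>2 \<le> 1" using N(3) by (simp add: abs_square_le_1)
      ultimately show ?thesis by (simp add: power_mult_distrib)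
    next
      case False
      have "exp w \<le> 2 * cosh w" for w :: real by (simp add: cosh_field_def)
      from this[of "\<bar>L * Im \<rho>\<bar>"] have "exp \<bar>L * Im \<rho>\<bar> \<le> 2 * ?C" by (simp only: cosh_real_abs)
      moreover have "\<bar>L * Im \<rho>\<bar> \<le> exp \<bar>L * Im \<rho>\<bar>" using exp_ge_add_one_self[of "\<bar>L * Im \<rho>\<bar>"] by linarith
      ultimately have "\<bar>L * Im \<rho>\<bar> \<le> 2 * ?C" by linarith
      hence "L * \<bar>Im \<rho>\<bar> \<le> 2 * ?C" using L by (simp add: abs_mult)
      also have "\<dots> \<le> 2 / \<epsilon>" using False e by (simp add: field_simps)
      finally have y: "\<bar>Im \<rho>\<bar> \<le> Y" using L e by (simp add: Y_def field_simps)
      have rp: "norm \<rho> > 0" using R0 r by linarith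
      have "(norm \<rho> - \<bar>Re \<rho>\<bar>) * norm \<rho> \<le> (norm \<rho> - \<bar>Re \<rho>\<bar>) * (norm \<rho> + \<bar>Re \<rho>\<bar>)"
        using abs_Re_le_cmod[of \<rho>] by (intro mult_left_mono) auto
      also have "\<dots> = (Im \<rho>)\<^sup>2" by (simp add: algebra_simps power2_eq_square cmod_power2[unfolded power2_eq_square])
      also have "\<dots> \<le> Y\<^sup>2" using y Y by (metis abs_le_square_iff abs_of_pos)
      finally have "norm \<rho> - \<bar>Re \<rho>\<bar> \<le> Y\<^sup>2 / norm \<rho>" using rp by (simp add: field_simps)
      also have "\<dots> \<le> Y\<^sup>2 / R0" using r R0 rp by (intro divide_left_mono mult_pos_pos) auto
      also have "\<dots> = \<epsilon> / L" using Y e L by (simp add: R0_def)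
      finally have "L * (norm \<rho> - \<bar>Re \<rho>\<bar>) \<le> \<epsilon>" using L by (simp add: field_simps)
      hence "\<bar>g\<bar> \<le> \<epsilon>"
        using N(4) abs_sin_x_le_abs_x[of "L * norm \<rho> - L * \<bar>Re \<rho>\<bar>"] abs_Re_le_cmod[of \<rho>] L
        by (simp add: right_diff_distrib)
      hence "\<bar>g\<bar> \<le> \<epsilon> * ?C" using mult_left_mono[OF cosh_real_ge_1[of "L * Im \<rho>"], of \<epsilon>] e by linarith
      then show ?thesis using e by (metis abs_le_square_iff abs_of_nonneg abs_ge_zero order_trans power_mult_distrib)
    qed
    have "(\<kappa> * ?C)\<^sup>2 \<le> N\<^sup>2" using g unfolding N(2) power_mult_distrib e(2) by (simp add: algebra_simps)
    then show ?thesis using N(1) by (rule power2_le_imp_le)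
  qed
  have tr: "\<bar>sin (L * Re \<rho>)\<bar> = \<bar>sin (L * \<bar>Re \<rho>\<bar>)\<bar>" "\<bar>cos (L * Re \<rho>)\<bar> = \<bar>cos (L * \<bar>Re \<rho>\<bar>)\<bar>" for \<rho> :: complex
    by (auto simp: abs_if)
  show ?thesis
  proof (intro exI[of _ R0] conjI allI impI R0)
    fix \<rho> :: complex assume r: "R0 \<le> norm \<rho>"
    \<comment> \<open>At a zero of sin (L |\<rho>|) or of cos (L |\<rho>|) the addition theorem
      reduces the subtracted term, up to sign, to the sine of this small difference.\<close>
    let ?d = "L * norm \<rho> - L * \<bar>Re \<rho>\<bar>"
    have sp: "L * \<bar>Re \<rho>\<bar> = L * norm \<rho> - ?d" by simp
    show "\<kappa> * cosh (L * Im \<rho>) \<le> norm (cos (of_real L * \<rho>))" if s: "sin (L * norm \<rho>) = 0"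
    proof (rule key[OF r, where g="sin (L * Re \<rho>)"])
      show "(norm (cos (of_real L * \<rho>)))\<^sup>2 = (cosh (L * Im \<rho>))\<^sup>2 - (sin (L * Re \<rho>))\<^sup>2"
        by (simp add: norm_cos_squared_cosh)
      have "\<bar>cos (L * norm \<rho>)\<bar> = 1" using s sin_zero_abs_cos_one by blast
      then show "\<bar>sin (L * Re \<rho>)\<bar> \<le> \<bar>sin ?d\<bar>"
        unfolding tr by (subst sp) (simp only: sin_diff s, simp add: abs_mult)
    qed auto
    show "\<kappa> * cosh (L * Im \<rho>) \<le> norm (sin (of_real L * \<rho>))" if s: "cos (L * norm \<rho>) = 0"
    proof (rule key[OF r, where g="cos (L * Re \<rho>)"])
      show "(norm (sin (of_real L * \<rho>)))\<^sup>2 = (cosh (L * Im \<rho>))\<^sup>2 - (cos (L * Re \<rho>))\<^sup>2"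
        by (simp add: norm_sin_squared_cosh)
      have "\<bar>sin (L * norm \<rho>)\<bar> = 1" using s sin_cos_squared_add[of "L * norm \<rho>"] by (auto simp: power2_eq_1_iff)
      then show "\<bar>cos (L * Re \<rho>)\<bar> \<le> \<bar>sin ?d\<bar>"
        unfolding tr by (subst sp) (simp only: cos_diff s, simp add: abs_mult)
    qed auto
  qed
qed

subsection \<open>Jensen's formula and zero counting\<close>

lemma alg_mult_eqI:
  assumes g: "g holomorphic_on UNIV" "g z \<noteq> 0" and f: "\<And>w. f w = (w - z) ^ n * g w"
  shows "alg_mult f z = n"
proof -
  have "zorder f z = int n"
    by (rule zorder_eqI[where S = UNIV and g = g]) (use g f in \<open>auto simp: power_int_def\<close>)
  then show ?thesis using f[of z] g(2) by (cases "n = 0") (auto simp: alg_mult_def)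
qed

text \<open>The cofactor is the quotient away from z and is given by \<open>zor_poly\<close> near z;
  the two expressions agree on the overlap, so it is entire.\<close>

lemma alg_mult_factor:
  assumes f: "f holomorphic_on UNIV" and nz: "f w0 \<noteq> 0"
  obtains g where "g holomorphic_on UNIV" "\<And>w. f w = (w - z) ^ alg_mult f z * g w" "g z \<noteq> 0"
proof (cases "f z = 0")
  case False
  then show ?thesis using that[of f] f by (simp add: alg_mult_def)
next
  case True
  define n where "n = alg_mult f z"
  define g0 where "g0 = zor_poly f z"
  obtain r where r: "r > 0" "g0 holomorphic_on cball z r"
      "\<And>w. w \<in> cball z r \<Longrightarrow> f w = g0 w * (w - z) ^ n \<and> g0 w \<noteq> 0"
  proof -
    have "\<exists>w\<in>UNIV. f w \<noteq> 0" using nz by auto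
    from zorder_exist_zero[OF f open_UNIV connected_UNIV UNIV_I this, of z] True
    have "\<exists>r>0. g0 holomorphic_on cball z r \<and> (\<forall>w\<in>cball z r. f w = g0 w * (w - z) ^ n \<and> g0 w \<noteq> 0)"
      unfolding g0_def n_def alg_mult_def by simp
    then show ?thesis using that by blast
  qed
  define g where "g w = (if w = z then g0 z else f w / (w - z) ^ n)" for w
  have gg0: "g w = g0 w" if "w \<in> ball z r" for w
    using r(3)[of w] that by (auto simp: g_def)
  have "g holomorphic_on (ball z r \<union> (- {z}))"
  proof (rule holomorphic_on_Un)
    show "g holomorphic_on ball z r"
      by (rule holomorphic_transform[of g0]) (use gg0 r(2) in \<open>auto intro: holomorphic_on_subset\<close>)
    show "g holomorphic_on - {z}"
      by (rule holomorphic_transform[of "\<lambda>w. f w / (w - z) ^ n"])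
         (use f in \<open>auto simp: g_def intro!: holomorphic_intros intro: holomorphic_on_subset\<close>)
  qed auto
  moreover have "ball z r \<union> (- {z}) = UNIV" using r(1) by auto
  moreover have "f w = (w - z) ^ n * g w" for w
    using r(3)[of z] r(1) True by (cases "w = z") (auto simp: g_def)
  moreover have "g z \<noteq> 0" using r(3)[of z] r(1) by (simp add: g_def)
  ultimately show ?thesis using that unfolding n_def by auto
qed

lemma alg_mult_mult_nonzero:
  assumes p: "p holomorphic_on UNIV" "p z \<noteq> 0" and g: "g holomorphic_on UNIV" "g w0 \<noteq> 0"
  shows "alg_mult (\<lambda>w. p w * g w) z = alg_mult g z"
proof -
  obtain k where k: "k holomorphic_on UNIV" "\<And>w. g w = (w - z) ^ alg_mult g z * k w" "k z \<noteq> 0"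
    using alg_mult_factor[OF g] by blast
  show ?thesis
    by (rule alg_mult_eqI[of "\<lambda>w. p w * k w"])
       (use p k in \<open>auto intro!: holomorphic_intros simp: k(2)[symmetric] mult.left_commute\<close>)
qed

text \<open>Multiplicities outside \<open>A\<close> are carried along because the next factor is
  split off from the cofactor, and so that \<open>jensen\<close> can apply the lemma twice in
  succession.\<close>

lemma alg_mult_factor_finite:
  assumes A: "finite A" and f: "f holomorphic_on UNIV" and nz: "f w0 \<noteq> 0"
  shows "\<exists>g. g holomorphic_on UNIV \<and> (\<forall>w. f w = (\<Prod>z\<in>A. (w - z) ^ alg_mult f z) * g w) \<and>
             (\<forall>z\<in>A. g z \<noteq> 0) \<and> (\<forall>z. z \<notin> A \<longrightarrow> alg_mult g z = alg_mult f z)"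
  using A
proof (induction A rule: finite_induct)
  case empty
  then show ?case using f by (intro exI[of _ f]) auto
next
  case (insert a A)
  then obtain g where g: "g holomorphic_on UNIV" "\<And>w. f w = (\<Prod>z\<in>A. (w - z) ^ alg_mult f z) * g w"
     "\<And>z. z \<in> A \<Longrightarrow> g z \<noteq> 0" "\<And>z. z \<notin> A \<Longrightarrow> alg_mult g z = alg_mult f z" by blast
  have gw0: "g w0 \<noteq> 0" using nz g(2)[of w0] by auto
  obtain k where k: "k holomorphic_on UNIV" "\<And>w. g w = (w - a) ^ alg_mult g a * k w" "k a \<noteq> 0"
    using alg_mult_factor[OF g(1) gw0] by blast
  have kw0: "k w0 \<noteq> 0" using gw0 k(2)[of w0] by auto
  show ?case
  proof (intro exI[of _ k] conjI allI ballI impI)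
    show "f w = (\<Prod>z\<in>insert a A. (w - z) ^ alg_mult f z) * k w" for w
      using insert.hyps g(4)[of a] by (simp add: g(2)[of w] k(2)[of w] mult_ac)
    show "k z \<noteq> 0" if "z \<in> insert a A" for z
      using that k(3) g(3)[of z] k(2)[of z] by auto
    show "alg_mult k z = alg_mult f z" if "z \<notin> insert a A" for z
    proof -
      have "alg_mult (\<lambda>w. (w - a) ^ alg_mult g a * k w) z = alg_mult k z"
        by (rule alg_mult_mult_nonzero[OF _ _ k(1) kw0]) (use that in \<open>auto intro!: holomorphic_intros\<close>)
      then show ?thesis using g(4)[of z] that by (simp add: k(2)[symmetric])
    qed
  qed (use k in auto)
qed

lemma finite_zeros_ball:
  assumes f: "f holomorphic_on UNIV" and nz: "f w0 \<noteq> 0"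
  shows "finite {z. f z = 0 \<and> norm z < r}"
proof (cases "f constant_on UNIV")
  case True
  then have "f z \<noteq> 0" for z using nz unfolding constant_on_def by auto
  then show ?thesis by simp
next
  case False
  have "finite {z \<in> cball 0 r. f z = 0}"
    by (rule holomorphic_compact_finite_zeros[OF f]) (use False in auto)
  then show ?thesis by (rule finite_subset[rotated]) auto
qed

text \<open>A zero-free function on a disc has a holomorphic logarithm, and the real part of
  Cauchy's formula for it at the centre is the mean value property of ln |g|.\<close>

lemma mean_log_nonvanishing:
  assumes g: "g holomorphic_on ball 0 R" "\<And>z. z \<in> ball 0 R \<Longrightarrow> g z \<noteq> 0" and r: "0 < r" "r < R"
  shows "((\<lambda>x. ln (norm (g (circlepath 0 r x)))) has_integral ln (norm (g 0))) {0..1}"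
proof -
  obtain l where l: "l holomorphic_on ball 0 R" "\<And>z. z \<in> ball 0 R \<Longrightarrow> g z = exp (l z)"
    using contractible_imp_holomorphic_log[OF g(1) convex_imp_contractible[OF convex_ball] g(2)] by blast
  have "l holomorphic_on cball 0 r" using r by (intro holomorphic_on_subset[OF l(1)]) auto
  hence "((\<lambda>u. l u / (u - 0)) has_contour_integral (2 * of_real pi * \<i> * l 0)) (circlepath 0 r)"
    using r by (intro Cauchy_integral_circlepath_simple) auto
  hence "((\<lambda>x. l (circlepath 0 r x) / (circlepath 0 r x) * vector_derivative (circlepath 0 r) (at x within {0..1}))
     has_integral (2 * of_real pi * \<i> * l 0)) {0..1}"
    unfolding has_contour_integral_def by simp
  hence "((\<lambda>x. (2 * of_real pi * \<i>) * l (circlepath 0 r x)) has_integral (2 * of_real pi * \<i> * l 0)) {0..1}"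
  proof (rule has_integral_eq[rotated])
    fix x :: real assume "x \<in> {0..1}"
    then have vd: "vector_derivative (circlepath 0 r) (at x within {0..1}) = 2 * of_real pi * \<i> * circlepath 0 r x"
      by (simp add: vector_derivative_circlepath01) (simp add: circlepath)
    have "circlepath 0 r x \<noteq> 0" using r by (simp add: circlepath)
    then show "l (circlepath 0 r x) / (circlepath 0 r x) * vector_derivative (circlepath 0 r) (at x within {0..1})
        = (2 * of_real pi * \<i>) * l (circlepath 0 r x)"
      unfolding vd by simp
  qed
  hence "((\<lambda>x. (1 / (2 * of_real pi * \<i>)) * ((2 * of_real pi * \<i>) * l (circlepath 0 r x))) has_integral
           (1 / (2 * of_real pi * \<i>)) * (2 * of_real pi * \<i> * l 0)) {0..1}"
    by (rule has_integral_mult_right)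
  hence "((\<lambda>x. Re (l (circlepath 0 r x))) has_integral Re (l 0)) {0..1}"
    by (intro has_integral_Re) simp
  moreover have "ln (norm (g 0)) = Re (l 0)" using l(2)[of 0] r by simp
  moreover have "ln (norm (g (circlepath 0 r x))) = Re (l (circlepath 0 r x))" for x
    using l(2)[of "circlepath 0 r x"] r by (simp add: circlepath norm_mult)
  ultimately show ?thesis by simp
qed

text \<open>
  On the circle \<open>\<bar>z\<bar> = r\<close> one has \<open>r \<bar>z - a\<bar> = \<bar>r\<^sup>2 - cnj a z\<bar>\<close>, and the right-hand side has no zero in the
  closed disc.
\<close>

lemma mean_log_linear:
  assumes "norm a < r"
  shows "((\<lambda>x. ln (norm (circlepath 0 r x - a))) has_integral ln r) {0..1}"
proof -
  have r: "r > 0" using assms norm_ge_zero[of a] by linarith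
  \<comment> \<open>The harmonic mean of r and the modulus r^2 / |a| of the zero of
    \<open>?g\<close>, written so that it also makes sense for a = 0.\<close>
  define R where "R = 2 * r\<^sup>2 / (r + norm a)"
  have ra: "r + norm a > 0" using r by (simp add: add_pos_nonneg)
  have "r * (r + norm a) < 2 * r\<^sup>2" using assms r by (simp add: power2_eq_square algebra_simps)
  hence R: "r < R" unfolding R_def using ra by (simp add: field_simps)
  have "norm a * R \<le> r\<^sup>2"
    unfolding R_def using ra assms mult_right_mono[of "2 * norm a" "r + norm a" "r\<^sup>2"]
    by (simp add: field_simps)
  let ?g = "\<lambda>z. of_real (r\<^sup>2) - cnj a * z"
  have g: "?g z \<noteq> 0" if z: "z \<in> ball 0 R" for z
  proof
    assume "?g z = 0"
    hence "cnj a * z = of_real (r\<^sup>2)" by simp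
    hence e: "norm a * norm z = r\<^sup>2" using r
      by (metis abs_of_pos complex_mod_cnj norm_mult norm_of_real zero_less_power)
    hence "norm a \<noteq> 0" using r by auto
    hence "norm a * norm z < norm a * R" using z by (intro mult_strict_left_mono) auto
    then show False using e \<open>norm a * R \<le> r\<^sup>2\<close> by simp
  qed
  have "((\<lambda>x. ln (norm (?g (circlepath 0 r x)))) has_integral ln (norm (?g 0))) {0..1}"
    by (rule mean_log_nonvanishing[OF _ g r R]) (intro holomorphic_intros)
  hence "((\<lambda>x. ln (norm (?g (circlepath 0 r x))) - ln r) has_integral (ln (norm (?g 0)) - ln r * (1 - 0))) {0..1}"
    using has_integral_const_real[of "ln r" 0 1] by (intro has_integral_diff) auto
  moreover have "ln (norm (?g 0)) - ln r * (1 - 0) = ln r"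
    using r by (simp add: norm_power ln_realpow)
  moreover have "ln (norm (?g (circlepath 0 r x))) - ln r = ln (norm (circlepath 0 r x - a))" for x
  proof -
    let ?p = "circlepath 0 r x"
    have np: "norm ?p = r" using r by (simp add: circlepath norm_mult)
    have "of_real (r\<^sup>2) = ?p * cnj ?p" using np by (metis complex_norm_square)
    hence "?g ?p = ?p * cnj (?p - a)" by (simp add: algebra_simps)
    hence e: "norm (?g ?p) = r * norm (?p - a)" by (simp add: norm_mult np del: complex_cnj_diff)
    have "?p \<noteq> a" using np assms by auto
    then show ?thesis unfolding e using r by (simp add: ln_mult)
  qed
  ultimately show ?thesis by simp
qed

text \<open>
  This is \<open>\<integral> N(t)/t dt\<close> over \<open>[1,r]\<close>; the cut-off at 1 makes zeros at the origin harmless.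
\<close>

definition log_zero_sum :: "(complex \<Rightarrow> complex) \<Rightarrow> real \<Rightarrow> real" where
  "log_zero_sum f r = (\<Sum>z | f z = 0 \<and> norm z < r. real (alg_mult f z) * ln (r / max 1 (norm z)))"

lemma jensen:
  assumes f: "f holomorphic_on UNIV" and nz: "f w0 \<noteq> 0"
  shows "\<exists>C. \<forall>r>1. (\<forall>z. norm z = r \<longrightarrow> f z \<noteq> 0) \<longrightarrow>
     ((\<lambda>x. ln (norm (f (circlepath 0 r x)))) has_integral (log_zero_sum f r + C)) {0..1}"
proof -
  define A1 where "A1 = {z. f z = 0 \<and> norm z < 1}"
  have A1: "finite A1" unfolding A1_def by (rule finite_zeros_ball[OF f nz])
  obtain g1 where g1: "g1 holomorphic_on UNIV" "\<And>w. f w = (\<Prod>z\<in>A1. (w - z) ^ alg_mult f z) * g1 w"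
     "\<And>z. z \<in> A1 \<Longrightarrow> g1 z \<noteq> 0" "\<And>z. z \<notin> A1 \<Longrightarrow> alg_mult g1 z = alg_mult f z"
    using alg_mult_factor_finite[OF A1 f nz] by blast
  have g1w0: "g1 w0 \<noteq> 0" using nz g1(2)[of w0] by auto
  have g10: "g1 0 \<noteq> 0" using g1(2)[of 0] g1(3)[of 0] by (cases "0 \<in> A1") (auto simp: A1_def)
  show ?thesis
  \<comment> \<open>In \<open>g1\<close> only the zeros in the open unit disc are divided out, so
    this constant is the same for all r. The remaining zeros inside the circle are split off
    separately below.\<close>
  proof (intro exI[of _ "ln (norm (g1 0))"] allI impI)
    fix r :: real assume r: "r > 1" and circ: "\<forall>z. norm z = r \<longrightarrow> f z \<noteq> 0"
    define A where "A = {z. f z = 0 \<and> norm z < r} - A1"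
    have fin: "finite {z. f z = 0 \<and> norm z < r}" by (rule finite_zeros_ball[OF f nz])
    have A: "finite A" using fin by (simp add: A_def)
    have un: "{z. f z = 0 \<and> norm z < r} = A1 \<union> A" "A1 \<inter> A = {}" using r by (auto simp: A_def A1_def)
    obtain g where g: "g holomorphic_on UNIV" "\<And>w. g1 w = (\<Prod>z\<in>A. (w - z) ^ alg_mult g1 z) * g w"
       "\<And>z. z \<in> A \<Longrightarrow> g z \<noteq> 0"
      using alg_mult_factor_finite[OF A g1(1) g1w0] by blast
    have mA: "alg_mult g1 z = alg_mult f z" if "z \<in> A" for z using g1(4) that by (auto simp: A_def)
    have gf: "f w = (\<Prod>z\<in>A1 \<union> A. (w - z) ^ alg_mult f z) * g w" for w
      using un(2) A A1 by (simp add: g1(2)[of w] g(2)[of w] mA prod.union_disjoint mult.assoc)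
    have gnz: "g w \<noteq> 0" if "w \<in> cball 0 r" for w
    proof (cases "norm w = r \<or> f w \<noteq> 0")
      case True
      then show ?thesis using gf[of w] circ by auto
    next
      case False
      hence "w \<in> A1 \<union> A" using un that by auto
      then show ?thesis using g(3) g1(3)[of w] g(2)[of w] by auto
    qed
    \<comment> \<open>\<open>mean_log_nonvanishing\<close> wants an open disc larger than the
      circle. The closed disc is compact and disjoint from the closed zero set, so it has positive
      distance from it.\<close>
    have "closed {w. g w = 0}"
      using holomorphic_on_imp_continuous_on[OF g(1)] by (intro closed_Collect_eq) auto
    moreover have "cball 0 r \<inter> {w. g w = 0} = {}" using gnz by auto
    ultimately obtain e where e: "e > 0" "\<And>u w. u \<in> cball 0 r \<Longrightarrow> g w = 0 \<Longrightarrow> e \<le> dist u w"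
      using separate_compact_closed[OF compact_cball, of "{w. g w = 0}" 0 r] by blast
    have gball: "g w \<noteq> 0" if w: "w \<in> ball 0 (r + e)" for w
    proof (cases "norm w \<le> r")
      case False
      \<comment> \<open>The radial projection of \<open>w\<close> onto the circle; its distance from
        \<open>w\<close> is norm w - r, less than \<open>e\<close>.\<close>
      define u where "u = of_real (r / norm w) * w"
      have nw: "norm w > 0" using False r by linarith
      have nu: "norm u = r" using nw r by (simp add: u_def norm_mult norm_divide)
      have "w - u = of_real (1 - r / norm w) * w" by (simp add: u_def algebra_simps)
      hence "norm (w - u) = \<bar>1 - r / norm w\<bar> * norm w" by (simp add: norm_mult del: of_real_diff of_real_divide)
      moreover have "0 \<le> 1 - r / norm w" using False nw by simp
      moreover have "(1 - r / norm w) * norm w = norm w - r" using nw by (simp add: left_diff_distrib)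
      ultimately have "norm (w - u) = norm w - r" by simp
      with nu have "dist u w < e" "u \<in> cball 0 r" using w by (auto simp: dist_norm norm_minus_commute)
      then show ?thesis using e(2)[of u w] by auto
    qed (use gnz in auto)
    have Ig: "((\<lambda>x. ln (norm (g (circlepath 0 r x)))) has_integral ln (norm (g 0))) {0..1}"
      by (rule mean_log_nonvanishing[where R="r + e"])
         (use gball e r in \<open>auto intro: holomorphic_on_subset[OF g(1)]\<close>)
    have Iz: "((\<lambda>x. \<Sum>z\<in>A1 \<union> A. real (alg_mult f z) * ln (norm (circlepath 0 r x - z))) has_integral
         (\<Sum>z\<in>A1 \<union> A. real (alg_mult f z) * ln r)) {0..1}"
      by (intro has_integral_sum has_integral_mult_right mean_log_linear)
         (use A A1 un in auto)
    have eq: "(\<Sum>z\<in>A1 \<union> A. real (alg_mult f z) * ln (norm (circlepath 0 r x - z))) + ln (norm (g (circlepath 0 r x)))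
        = ln (norm (f (circlepath 0 r x)))" for x
    proof -
      let ?p = "circlepath 0 r x"
      have np: "norm ?p = r" using r by (simp add: circlepath norm_mult)
      have nzp: "?p - z \<noteq> 0" if "z \<in> A1 \<union> A" for z
      proof -
        have "norm z < r" using that un by auto
        then show ?thesis using np by auto
      qed
      have "ln (norm (f ?p)) = ln ((\<Prod>z\<in>A1 \<union> A. norm (?p - z) ^ alg_mult f z) * norm (g ?p))"
        by (simp add: gf[of ?p] norm_mult prod_norm[symmetric] norm_power)
      also have "\<dots> = ln (\<Prod>z\<in>A1 \<union> A. norm (?p - z) ^ alg_mult f z) + ln (norm (g ?p))"
        using nzp gnz[of ?p] np by (intro ln_mult_pos prod_pos) (auto intro!: zero_less_power)
      also have "ln (\<Prod>z\<in>A1 \<union> A. norm (?p - z) ^ alg_mult f z) = (\<Sum>z\<in>A1 \<union> A. ln (norm (?p - z) ^ alg_mult f z))"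
        using nzp A A1 by (intro ln_prod) auto
      also have "\<dots> = (\<Sum>z\<in>A1 \<union> A. real (alg_mult f z) * ln (norm (?p - z)))"
        by (simp add: ln_realpow)
      finally show ?thesis by simp
    qed
    have "ln (norm (g1 0)) = ln ((\<Prod>z\<in>A. norm z ^ alg_mult f z) * norm (g 0))"
      by (simp add: g(2)[of 0] mA norm_mult prod_norm[symmetric] norm_power)
    also have "\<dots> = ln (\<Prod>z\<in>A. norm z ^ alg_mult f z) + ln (norm (g 0))"
      using gnz[of 0] r by (intro ln_mult_pos prod_pos) (auto simp: A_def A1_def intro!: zero_less_power)
    also have "ln (\<Prod>z\<in>A. norm z ^ alg_mult f z) = (\<Sum>z\<in>A. ln (norm z ^ alg_mult f z))"
      using A by (intro ln_prod) (auto simp: A_def A1_def)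
    also have "\<dots> = (\<Sum>z\<in>A. real (alg_mult f z) * ln (norm z))"
      by (simp add: ln_realpow)
    finally have c: "ln (norm (g1 0)) = (\<Sum>z\<in>A. real (alg_mult f z) * ln (norm z)) + ln (norm (g 0))" .
    have "log_zero_sum f r = (\<Sum>z\<in>A1. real (alg_mult f z) * ln (r / max 1 (norm z))) + (\<Sum>z\<in>A. real (alg_mult f z) * ln (r / max 1 (norm z)))"
      unfolding log_zero_sum_def un(1) using A A1 un(2) by (intro sum.union_disjoint) auto
    also have "(\<Sum>z\<in>A1. real (alg_mult f z) * ln (r / max 1 (norm z))) = (\<Sum>z\<in>A1. real (alg_mult f z) * ln r)"
      by (intro sum.cong) (auto simp: A1_def max_def)
    also have "(\<Sum>z\<in>A. real (alg_mult f z) * ln (r / max 1 (norm z))) = (\<Sum>z\<in>A. real (alg_mult f z) * ln r - real (alg_mult f z) * ln (norm z))"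
    proof (intro sum.cong refl)
      fix z assume "z \<in> A"
      hence "1 \<le> norm z" by (auto simp: A_def A1_def)
      then show "real (alg_mult f z) * ln (r / max 1 (norm z)) = real (alg_mult f z) * ln r - real (alg_mult f z) * ln (norm z)"
        using r by (auto simp: max_def ln_div right_diff_distrib)
    qed
    also have "\<dots> = (\<Sum>z\<in>A. real (alg_mult f z) * ln r) - (\<Sum>z\<in>A. real (alg_mult f z) * ln (norm z))"
      by (rule sum_subtractf)
    also have "(\<Sum>z\<in>A1. real (alg_mult f z) * ln r) + \<dots> = (\<Sum>z\<in>A1 \<union> A. real (alg_mult f z) * ln r) - (\<Sum>z\<in>A. real (alg_mult f z) * ln (norm z))"
      using A A1 un(2) by (simp add: sum.union_disjoint)
    finally have "(\<Sum>z\<in>A1 \<union> A. real (alg_mult f z) * ln r) + ln (norm (g 0)) = log_zero_sum f r + ln (norm (g1 0))"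
      using c by simp
    then show "((\<lambda>x. ln (norm (f (circlepath 0 r x)))) has_integral (log_zero_sum f r + ln (norm (g1 0)))) {0..1}"
      using has_integral_add[OF Iz Ig] unfolding eq by simp
  qed
qed

section \<open>Integrated counting functions of sequences\<close>

text \<open>The counterpart of \<open>log_zero_sum\<close> for an indexed sequence: the integral of
  N(t)/t over [1,r], as \<open>counting_over_t_has_integral\<close> shows.\<close>

definition log_counting_sum :: "nat set \<Rightarrow> (nat \<Rightarrow> complex) \<Rightarrow> real \<Rightarrow> real" where
  "log_counting_sum D x r = (\<Sum>n | n \<in> D \<and> norm (x n) < r. ln (r / max 1 (norm (x n))))"

lemma has_integral_step_over_t:
  fixes a r :: real
  assumes "1 \<le> r" "a < r"
  shows "((\<lambda>t. (if a < t then 1 else 0) / t) has_integral ln (r / max 1 a)) {1..r}"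
proof -
  let ?m = "max 1 a"
  have m: "1 \<le> ?m" "?m \<le> r" using assms by auto
  have "((\<lambda>t. 1 / t) has_integral (ln r - ln ?m)) {?m..r}"
  proof (rule fundamental_theorem_of_calculus[OF m(2)])
    fix t assume "t \<in> {?m..r}"
    hence "t > 0" using m by auto
    then show "(ln has_vector_derivative 1 / t) (at t within {?m..r})"
      unfolding has_real_derivative_iff_has_vector_derivative[symmetric]
      by (auto intro!: derivative_eq_intros)
  qed
  hence 2: "((\<lambda>t. (if a < t then 1 else 0) / t) has_integral (ln r - ln ?m)) {?m..r}"
    by (rule has_integral_spike_finite[of "{?m}", rotated 2]) auto
  have 1: "((\<lambda>t. (if a < t then 1 else 0) / t) has_integral 0) {1..?m}"
    by (rule has_integral_spike_finite[of "{1}" _ _ "\<lambda>t. 0"]) (auto simp: max_def split: if_splits)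
  show ?thesis
    using has_integral_combine[OF m 1 2] m by (simp add: ln_div)
qed

lemma counting_over_t_has_integral:
  assumes fin: "finite {n \<in> D. norm (x n) < r}" and r: "1 \<le> r"
  shows "((\<lambda>t. real (counting D x t) / t) has_integral log_counting_sum D x r) {1..r}"
proof -
  let ?F = "{n \<in> D. norm (x n) < r}"
  have "((\<lambda>t. \<Sum>n\<in>?F. (if norm (x n) < t then 1 else 0) / t) has_integral log_counting_sum D x r) {1..r}"
    unfolding log_counting_sum_def using fin r by (intro has_integral_sum has_integral_step_over_t) auto
  then show ?thesis
  proof (rule has_integral_eq[rotated])
    fix t assume t: "t \<in> {1..r}"
    have "(\<Sum>n\<in>?F. (if norm (x n) < t then 1 else 0) / t) = (\<Sum>n\<in>?F. if norm (x n) < t then 1 else 0) / t"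
      by (simp add: sum_divide_distrib)
    also have "(\<Sum>n\<in>?F. if norm (x n) < t then 1 else 0 :: real) = real (card {n \<in> ?F. norm (x n) < t})"
      using fin by (subst sum.inter_filter[symmetric]) auto
    also have "{n \<in> ?F. norm (x n) < t} = {n \<in> D. norm (x n) < t}" using t by auto
    finally show "(\<Sum>n\<in>?F. (if norm (x n) < t then 1 else 0) / t) = real (counting D x t) / t"
      by (simp add: counting_def)
  qed
qed

lemma log_counting_sum_mono:
  assumes "finite {n \<in> D. norm (x n) < r'}" "1 \<le> r" "r \<le> r'"
  shows "log_counting_sum D x r \<le> log_counting_sum D x r'"
proof -
  have "log_counting_sum D x r \<le> (\<Sum>n | n \<in> D \<and> norm (x n) < r. ln (r' / max 1 (norm (x n))))"
    unfolding log_counting_sum_def using assms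
    by (intro sum_mono ln_mono divide_right_mono divide_pos_pos) auto
  also have "\<dots> \<le> log_counting_sum D x r'"
    unfolding log_counting_sum_def using assms
    by (intro sum_mono2) (auto intro!: ln_ge_zero simp: le_divide_eq max_def split: if_splits)
  finally show ?thesis .
qed

lemma log_counting_sum_by_value:
  assumes fin: "finite {n \<in> D. norm (x n) < r}" and T: "finite T" "x ` {n \<in> D. norm (x n) < r} \<subseteq> T" "\<And>z. z \<in> T \<Longrightarrow> norm z < r"
  shows "log_counting_sum D x r = (\<Sum>z\<in>T. real (occurrences D x z) * ln (r / max 1 (norm z)))"
proof -
  let ?F = "{n \<in> D. norm (x n) < r}"
  have "log_counting_sum D x r = (\<Sum>z\<in>T. \<Sum>n\<in>{n \<in> ?F. x n = z}. ln (r / max 1 (norm (x n))))"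
    unfolding log_counting_sum_def using sum.group[OF fin T(1,2), of "\<lambda>n. ln (r / max 1 (norm (x n)))"] by simp
  also have "\<dots> = (\<Sum>z\<in>T. real (occurrences D x z) * ln (r / max 1 (norm z)))"
  proof (intro sum.cong refl)
    fix z assume "z \<in> T"
    hence "{n \<in> ?F. x n = z} = {n \<in> D. x n = z}" using T(3) by auto
    then show "(\<Sum>n\<in>{n \<in> ?F. x n = z}. ln (r / max 1 (norm (x n)))) = real (occurrences D x z) * ln (r / max 1 (norm z))"
      by (simp add: occurrences_def)
  qed
  finally show ?thesis .
qed

lemma eigenvalue_sequence_props:
  assumes s: "eigenvalue_sequence f s" and f: "f holomorphic_on UNIV" and nz: "f w0 \<noteq> 0"
  shows "f (s n) = 0" "finite {n. norm (s n) < r}" "log_counting_sum UNIV s r = log_zero_sum f r"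
    "f z = 0 \<Longrightarrow> z \<in> range s"
proof -
  have fin: "finite {n. s n = z}" "card {n. s n = z} = alg_mult f z" for z
    using s unfolding eigenvalue_sequence_def by blast+
  show zero: "f (s n) = 0" for n
    using fin[of "s n"] by (auto simp: alg_mult_def split: if_splits)
  have "{n. norm (s n) < r} \<subseteq> (\<Union>z\<in>{z. f z = 0 \<and> norm z < r}. {n. s n = z})" using zero by auto
  then show F: "finite {n. norm (s n) < r}"
    by (rule finite_subset) (use finite_zeros_ball[OF f nz] fin in auto)
  have "log_counting_sum UNIV s r = (\<Sum>z | f z = 0 \<and> norm z < r. real (occurrences UNIV s z) * ln (r / max 1 (norm z)))"
    by (rule log_counting_sum_by_value) (use F zero finite_zeros_ball[OF f nz] in auto)
  then show "log_counting_sum UNIV s r = log_zero_sum f r"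
    by (simp add: log_zero_sum_def occurrences_def fin)
  assume z: "f z = 0"
  obtain g where g: "g holomorphic_on UNIV" "\<And>w. f w = (w - z) ^ alg_mult f z * g w" "g z \<noteq> 0"
    using alg_mult_factor[OF f nz] by blast
  have "alg_mult f z \<noteq> 0" using g(2)[of z] g(3) z by (metis mult_1 power_0)
  hence "{n. s n = z} \<noteq> {}" using fin(2)[of z] by (metis card.empty)
  then show "z \<in> range s" by auto
qed

text \<open>Squaring maps the upper half of the circle |\<rho>| = R once onto the circle of radius
  R^2. Means over circles in \<open>l\<close> thus become integrals over [0,1] in which |Im \<rho>|
  is R sin (\<pi> x).\<close>

lemma circlepath_square:
  fixes R x :: real
  defines "\<rho> \<equiv> of_real R * exp (\<i> * of_real (pi * x))"
  assumes "0 \<le> R" "x \<in> {0..1}"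
  shows "circlepath 0 (R\<^sup>2) x = \<rho>\<^sup>2" "norm \<rho> = R" "\<bar>Im \<rho>\<bar> = R * sin (pi * x)"
proof -
  show "circlepath 0 (R\<^sup>2) x = \<rho>\<^sup>2"
    unfolding circlepath \<rho>_def by (simp add: power_mult_distrib exp_double[symmetric] mult_ac)
  show "norm \<rho> = R" using assms(2) by (simp add: \<rho>_def norm_mult)
  have "0 \<le> sin (pi * x)" using assms(3) by (intro sin_ge_zero) auto
  then show "\<bar>Im \<rho>\<bar> = R * sin (pi * x)" using assms(2)
    unfolding \<rho>_def cis_conv_exp[symmetric] by (simp add: abs_mult)
qed

lemma has_integral_sin_pi: "((\<lambda>x. sin (pi * x)) has_integral (2 / pi)) {0..1}"
proof -
  have "((\<lambda>x. sin (pi * x)) has_integral (- cos (pi * 1) / pi - (- cos (pi * 0) / pi))) {0..1}"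
  proof (rule fundamental_theorem_of_calculus)
    fix x :: real
    show "((\<lambda>x. - cos (pi * x) / pi) has_vector_derivative sin (pi * x)) (at x within {0..1})"
      unfolding has_real_derivative_iff_has_vector_derivative[symmetric]
      by (auto intro!: derivative_eq_intros)
  qed auto
  then show ?thesis by simp
qed

text \<open>On an admissible circle both bounds for ln |f| have the form constant + k ln R + \<pi> R
  sin (\<pi> x). The last term has mean 2 R, and Jensen's formula identifies the mean of ln |f| with
  \<open>log_zero_sum\<close> up to a constant.\<close>

lemma log_zero_sum_asymptotics_on_circles:
  fixes k :: real
  assumes f: "f holomorphic_on UNIV" and c: "c > 0" and R0: "R0 > 1"
    and up: "\<And>\<rho>. norm \<rho> \<ge> R0 \<Longrightarrow> norm (f (\<rho>\<^sup>2)) \<le> C * norm \<rho> powr k * exp (pi * \<bar>Im \<rho>\<bar>)"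
    and low: "\<And>\<rho> n. norm \<rho> \<ge> R0 \<Longrightarrow> norm \<rho> = real n + s \<Longrightarrow> c * norm \<rho> powr k * exp (pi * \<bar>Im \<rho>\<bar>) \<le> norm (f (\<rho>\<^sup>2))"
  shows "\<exists>C'. \<forall>n. R0 \<le> real n + s \<longrightarrow> \<bar>log_zero_sum f ((real n + s)\<^sup>2) - 2 * (real n + s) - k * ln (real n + s)\<bar> \<le> C'"
proof -
  \<comment> \<open>Comparing the two bounds at a real \<rho> on an admissible circle forces C > 0,
    so that ln C makes sense below. If there is no such circle, the claim is vacuous.\<close>
  have C: "C > 0 \<or> (\<forall>n. \<not> R0 \<le> real n + s)"
  proof (rule disjCI)
    assume "\<not> (\<forall>n. \<not> R0 \<le> real n + s)"
    then obtain n where n: "R0 \<le> real n + s" by auto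
    let ?r = "of_real (real n + s) :: complex"
    have nr: "norm ?r = real n + s" using n R0 by (simp add: norm_of_real del: of_real_add)
    have "0 < c * norm ?r powr k * exp (pi * \<bar>Im ?r\<bar>)" using c n R0 nr by auto
    also have "\<dots> \<le> C * norm ?r powr k * exp (pi * \<bar>Im ?r\<bar>)" using up[of ?r] low[of ?r n] n nr by simp
    finally show "C > 0" by (simp add: zero_less_mult_iff)
  qed
  show ?thesis
  proof (cases "\<forall>n. \<not> R0 \<le> real n + s")
    case False
    hence C: "C > 0" using C by auto
    obtain n0 where n0: "R0 \<le> real n0 + s" using False by auto
    have "f ((of_real (real n0 + s))\<^sup>2) \<noteq> 0"
    proof -
      let ?r = "of_real (real n0 + s) :: complex"
      have nr: "norm ?r = real n0 + s" using n0 R0 by (simp add: norm_of_real del: of_real_add)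
      have "0 < c * norm ?r powr k * exp (pi * \<bar>Im ?r\<bar>)" using c n0 R0 nr by auto
      also have "\<dots> \<le> norm (f (?r\<^sup>2))" using low[of ?r n0] n0 nr by simp
      finally show ?thesis by auto
    qed
    then obtain J where J: "\<And>r. r > 1 \<Longrightarrow> (\<And>z. norm z = r \<Longrightarrow> f z \<noteq> 0) \<Longrightarrow>
       ((\<lambda>x. ln (norm (f (circlepath 0 r x)))) has_integral (log_zero_sum f r + J)) {0..1}"
      using jensen[OF f] by metis
    show ?thesis
    proof (intro exI[of _ "\<bar>ln c\<bar> + \<bar>ln C\<bar> + \<bar>J\<bar>"] allI impI)
      fix n assume n: "R0 \<le> real n + s"
      define R where "R = real n + s"
      have R: "R > 1" "R \<ge> R0" using n R0 by (auto simp: R_def)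
      have bounds: "ln c + k * ln R + pi * (R * sin (pi * x)) \<le> ln (norm (f (circlepath 0 (R\<^sup>2) x)))"
        "ln (norm (f (circlepath 0 (R\<^sup>2) x))) \<le> ln C + k * ln R + pi * (R * sin (pi * x))" if x: "x \<in> {0..1}" for x
      proof -
        define \<rho> where "\<rho> = of_real R * exp (\<i> * of_real (pi * x))"
        have rho: "circlepath 0 (R\<^sup>2) x = \<rho>\<^sup>2" "norm \<rho> = R" "\<bar>Im \<rho>\<bar> = R * sin (pi * x)"
          using circlepath_square[of R x] R x by (auto simp: \<rho>_def)
        have l: "c * R powr k * exp (pi * (R * sin (pi * x))) \<le> norm (f (\<rho>\<^sup>2))"
          using low[of \<rho> n] rho R by (simp add: R_def)
        have u: "norm (f (\<rho>\<^sup>2)) \<le> C * R powr k * exp (pi * (R * sin (pi * x)))"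
          using up[of \<rho>] rho R by simp
        have p: "c * R powr k * exp (pi * (R * sin (pi * x))) > 0" using c R by simp
        have "ln (c * R powr k * exp (pi * (R * sin (pi * x)))) \<le> ln (norm (f (\<rho>\<^sup>2)))"
          using l p by (intro ln_mono) auto
        moreover have "ln (norm (f (\<rho>\<^sup>2))) \<le> ln (C * R powr k * exp (pi * (R * sin (pi * x))))"
          using u l p by (intro ln_mono) linarith+
        ultimately show "ln c + k * ln R + pi * (R * sin (pi * x)) \<le> ln (norm (f (circlepath 0 (R\<^sup>2) x)))"
          "ln (norm (f (circlepath 0 (R\<^sup>2) x))) \<le> ln C + k * ln R + pi * (R * sin (pi * x))"
          using c C R by (simp_all add: rho ln_mult ln_powr)
      qed
      have nzc: "f z \<noteq> 0" if "norm z = R\<^sup>2" for z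
      proof -
        have nr: "norm (csqrt z) = R" using that R by (simp add: real_sqrt_unique)
        have "0 < c * norm (csqrt z) powr k * exp (pi * \<bar>Im (csqrt z)\<bar>)" using c R nr by auto
        also have "\<dots> \<le> norm (f ((csqrt z)\<^sup>2))" using low[of "csqrt z" n] nr R by (simp add: R_def)
        finally show ?thesis by auto
      qed
      have R2: "R\<^sup>2 > 1" using R by (simp add: one_less_power)
      have I: "((\<lambda>x. ln (norm (f (circlepath 0 (R\<^sup>2) x)))) has_integral (log_zero_sum f (R\<^sup>2) + J)) {0..1}"
        by (rule J[OF R2 nzc])
      have K: "((\<lambda>x. v + k * ln R + pi * (R * sin (pi * x))) has_integral (v + k * ln R + 2 * R)) {0..1}" for v
        using has_integral_add[OF has_integral_const_real[of "v + k * ln R" 0 1]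
            has_integral_mult_right[OF has_integral_mult_right[OF has_integral_sin_pi, of R], of pi]]
        by (simp add: mult.commute)
      have "ln c + k * ln R + 2 * R \<le> log_zero_sum f (R\<^sup>2) + J"
        by (rule has_integral_le[OF K I]) (use bounds in auto)
      moreover have "log_zero_sum f (R\<^sup>2) + J \<le> ln C + k * ln R + 2 * R"
        by (rule has_integral_le[OF I K]) (use bounds in auto)
      ultimately show "\<bar>log_zero_sum f ((real n + s)\<^sup>2) - 2 * (real n + s) - k * ln (real n + s)\<bar> \<le> \<bar>ln c\<bar> + \<bar>ln C\<bar> + \<bar>J\<bar>"
        unfolding R_def[symmetric] by linarith
    qed
  qed auto
qed

text \<open>Monotonicity fills the gaps. R = sqrt r lies between radii R1 and R1 + 1 of admissible
  circles; passing to them changes 2 R by at most 2, and k ln R by at most k since ln changes by at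
  most 1.\<close>

lemma log_sum_asymptotics_from_circles:
  fixes Z :: "real \<Rightarrow> real" and k s C R0 :: real
  assumes mono: "\<And>r r'. 1 \<le> r \<Longrightarrow> r \<le> r' \<Longrightarrow> Z r \<le> Z r'" and s: "0 \<le> s" "s < 1" and k: "0 \<le> k"
    and circ: "\<And>n. R0 \<le> real n + s \<Longrightarrow> \<bar>Z ((real n + s)\<^sup>2) - 2 * (real n + s) - k * ln (real n + s)\<bar> \<le> C"
  shows "\<exists>r0 C'. \<forall>r\<ge>r0. \<bar>Z r - 2 * sqrt r - k / 2 * ln r\<bar> \<le> C'"
proof (rule exI[of _ "(max R0 1 + 3)\<^sup>2"], rule exI[of _ "C + 2 + k"], intro allI impI)
  fix r :: real assume r: "(max R0 1 + 3)\<^sup>2 \<le> r"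
  define R where "R = sqrt r"
  have R: "max R0 1 + 3 \<le> R" unfolding R_def using r by (intro real_le_rsqrt) auto
  have rR: "r = R\<^sup>2" unfolding R_def using r by (metis order_trans real_sqrt_pow2 zero_le_power2)
  define n where "n = nat \<lfloor>R - s\<rfloor>"
  define R1 where "R1 = real n + s"
  have n: "real n \<le> R - s" "R - s < real n + 1" unfolding n_def using R s by linarith+
  have R1: "R1 \<le> R" "R < R1 + 1" "R0 \<le> R1" "2 \<le> R1" using n R by (auto simp: R1_def)
  have "R1\<^sup>2 \<le> R\<^sup>2" "R\<^sup>2 \<le> (R1 + 1)\<^sup>2" "1 \<le> R1\<^sup>2" "1 \<le> R\<^sup>2" using R1 by (auto intro!: power_mono one_le_power)
  hence Z: "Z (R1\<^sup>2) \<le> Z r" "Z r \<le> Z ((R1 + 1)\<^sup>2)" unfolding rR by (intro mono; simp)+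
  have c1: "\<bar>Z (R1\<^sup>2) - 2 * R1 - k * ln R1\<bar> \<le> C" using circ[of n] R1 by (simp add: R1_def)
  have c2: "\<bar>Z ((R1 + 1)\<^sup>2) - 2 * (R1 + 1) - k * ln (R1 + 1)\<bar> \<le> C"
    using circ[of "Suc n"] R1 by (simp add: R1_def algebra_simps)
  have l1: "ln R - 1 \<le> ln R1"
  proof -
    have "R / R1 \<le> 1 + 1" using R1 by (simp add: field_simps)
    also have "\<dots> \<le> exp 1" by (rule exp_ge_add_one_self)
    finally have "ln (R / R1) \<le> ln (exp 1)" using R1 by (intro ln_mono) auto
    then show ?thesis using R1 by (simp add: ln_div)
  qed
  have l2: "ln (R1 + 1) \<le> ln R + 1"
  proof -
    have "(R1 + 1) / R \<le> 1 + 1" using R1 by (simp add: field_simps)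
    also have "\<dots> \<le> exp 1" by (rule exp_ge_add_one_self)
    finally have "ln ((R1 + 1) / R) \<le> ln (exp 1)" using R1 by (intro ln_mono) auto
    then show ?thesis using R1 by (simp add: ln_div)
  qed
  have kb: "k * ln R - k \<le> k * ln R1" "k * ln (R1 + 1) \<le> k * ln R + k"
    using mult_left_mono[OF l1 k] mult_left_mono[OF l2 k] by (auto simp: algebra_simps)
  have kr: "k / 2 * ln r = k * ln R" using R unfolding rR by (simp add: ln_realpow)
  have "Z r \<le> 2 * (R1 + 1) + (k * ln R + k) + C"
    using Z(2) c2 kb(2) unfolding abs_le_iff by linarith
  moreover have "2 * R1 + (k * ln R - k) - C \<le> Z r"
    using Z(1) c1 kb(1) unfolding abs_le_iff by linarith
  ultimately show "\<bar>Z r - 2 * sqrt r - k / 2 * ln r\<bar> \<le> C + 2 + k"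
    using R1(1,2) unfolding R_def[symmetric] kr by (intro abs_leI) argo+
qed

text \<open>
  \<open>2 b / \<pi> sqrt r\<close> is the mean of \<open>b \<bar>Im \<rho>\<bar>\<close> over the circle \<open>\<bar>\<rho>\<^sup>2\<bar> = r\<close>. On half of the circle
  \<open>\<bar>\<rho>\<bar> \<le> 2 \<bar>Im \<rho>\<bar>\<close> holds, so arbitrarily small constants \<open>\<epsilon>\<close> there push the mean of \<open>ln \<bar>F\<bar>\<close> below the
  lower bound coming from the zeros.
\<close>

lemma entire_zero_if_too_many_zeros:
  fixes b C C' r0 R0 :: real
  assumes F: "F holomorphic_on UNIV" and b: "0 \<le> b" and C: "C > 0"
    and up: "\<And>\<rho>. R0 \<le> norm \<rho> \<Longrightarrow> norm (F (\<rho>\<^sup>2)) \<le> C * exp (b * \<bar>Im \<rho>\<bar>)"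
    and small: "\<And>\<epsilon>. \<epsilon> > 0 \<Longrightarrow> \<exists>R. \<forall>\<rho>. R \<le> norm \<rho> \<longrightarrow> norm \<rho> \<le> 2 * \<bar>Im \<rho>\<bar> \<longrightarrow> norm (F (\<rho>\<^sup>2)) \<le> \<epsilon> * exp (b * \<bar>Im \<rho>\<bar>)"
    and many: "\<And>w r. F w \<noteq> 0 \<Longrightarrow> r0 \<le> r \<Longrightarrow> 2 * b / pi * sqrt r - C' \<le> log_zero_sum F r"
  shows "F z = 0"
proof (rule ccontr)
  assume nz: "F z \<noteq> 0"
  obtain J where J: "\<And>r. r > 1 \<Longrightarrow> (\<And>z. norm z = r \<Longrightarrow> F z \<noteq> 0) \<Longrightarrow>
       ((\<lambda>x. ln (norm (F (circlepath 0 r x)))) has_integral (log_zero_sum F r + J)) {0..1}"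
    using jensen[OF F nz] by metis
  \<comment> \<open>With this choice the mean of the upper bound for ln |F| is 2 b R / \<pi> - (|C'|
    + |J| + 1), which is at least 1 below the lower bound that the zeros impose through Jensen's
    formula.\<close>
  define K where "K = \<bar>ln C\<bar> + 2 * (\<bar>C'\<bar> + \<bar>J\<bar> + 1)"
  obtain R1 where R1: "\<And>\<rho>. R1 \<le> norm \<rho> \<Longrightarrow> norm \<rho> \<le> 2 * \<bar>Im \<rho>\<bar> \<Longrightarrow> norm (F (\<rho>\<^sup>2)) \<le> exp (- K) * exp (b * \<bar>Im \<rho>\<bar>)"
    using small[of "exp (- K)"] by auto
  define a where "a = max (max \<bar>r0\<bar> 1) (max (R0\<^sup>2) (R1\<^sup>2)) + 1"
  \<comment> \<open>Only finitely many radii are moduli of zeros in the larger disc, so some radius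
    in the interval of length 1 gives a circle free of zeros.\<close>
  have "finite (norm ` {z. F z = 0 \<and> norm z < a + 1})"
    using finite_zeros_ball[OF F nz] by auto
  moreover have "infinite {a..<a + 1}" by simp
  ultimately have "\<not> {a..<a + 1} \<subseteq> norm ` {z. F z = 0 \<and> norm z < a + 1}" using finite_subset by blast
  then obtain r where "r \<in> {a..<a + 1}" and r3: "r \<notin> norm ` {z. F z = 0 \<and> norm z < a + 1}" by blast
  hence r: "a \<le> r" "r < a + 1" by auto
  have circ: "F z \<noteq> 0" if "norm z = r" for z using r r3 that by auto
  define R where "R = sqrt r"
  have rr: "r > 1" "r \<ge> r0" "r \<ge> R0\<^sup>2" "r \<ge> R1\<^sup>2" using r(1) unfolding a_def by linarith+
  have rR: "r = R\<^sup>2" "R > 1" using rr by (auto simp: R_def)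
  have RR: "R \<ge> R0" "R \<ge> R1" unfolding R_def using rr by (auto intro: real_le_rsqrt)
  have I: "((\<lambda>x. ln (norm (F (circlepath 0 r x)))) has_integral (log_zero_sum F r + J)) {0..1}"
    by (rule J[OF rr(1) circ])
  \<comment> \<open>For x in [1/4, 3/4] one has sin (\<pi> x) > 1/2, that is, the region |\<rho>|
    \<le> 2 |Im \<rho>| in which the small constant exp (- K) may be used.\<close>
  let ?h = "\<lambda>x::real. if x \<in> {1/4..3/4} then - K - \<bar>ln C\<bar> else 0 :: real"
  have h: "(?h has_integral ((- K - \<bar>ln C\<bar>) / 2)) {0..1}"
  proof -
    have "((\<lambda>x. - K - \<bar>ln C\<bar>) has_integral ((- K - \<bar>ln C\<bar>) / 2)) {1/4..3/4::real}"
      using has_integral_const_real[of "- K - \<bar>ln C\<bar>" "1/4" "3/4"] by simp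
    then show ?thesis
      by (subst has_integral_restrict) auto
  qed
  have U: "((\<lambda>x. \<bar>ln C\<bar> + ?h x + b * (R * sin (pi * x))) has_integral (\<bar>ln C\<bar> + (- K - \<bar>ln C\<bar>) / 2 + b * (R * (2 / pi)))) {0..1}"
    using has_integral_add[OF has_integral_add[OF has_integral_const_real[of "\<bar>ln C\<bar>" 0 1] h]
        has_integral_mult_right[OF has_integral_mult_right[OF has_integral_sin_pi, of R], of b]]
    by simp
  have "log_zero_sum F r + J \<le> \<bar>ln C\<bar> + (- K - \<bar>ln C\<bar>) / 2 + b * (R * (2 / pi))"
  proof (rule has_integral_le[OF I U])
    fix x :: real assume x: "x \<in> {0..1}"
    define \<rho> where "\<rho> = of_real R * exp (\<i> * of_real (pi * x))"
    have rho: "circlepath 0 r x = \<rho>\<^sup>2" "norm \<rho> = R" "\<bar>Im \<rho>\<bar> = R * sin (pi * x)"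
      using circlepath_square[of R x] rR x by (auto simp: \<rho>_def)
    have Fnz: "norm (F (\<rho>\<^sup>2)) > 0" using circ[of "\<rho>\<^sup>2"] rho rR by (simp add: norm_power)
    show "ln (norm (F (circlepath 0 r x))) \<le> \<bar>ln C\<bar> + ?h x + b * (R * sin (pi * x))"
    proof (cases "x \<in> {1/4..3/4}")
      case True
      have "sin (pi * x) \<ge> 1 / 2"
      proof -
        have "pi * (1 / 4) \<le> pi * x" "pi * x \<le> pi * (3 / 4)" using True by (auto intro!: mult_left_mono)
        hence "\<bar>pi * x - pi / 2\<bar> \<le> pi / 4" by linarith
        hence "cos (pi / 4) \<le> cos \<bar>pi * x - pi / 2\<bar>" using pi_gt_zero by (intro cos_monotone_0_pi_le) auto
        moreover have "cos (pi * x - pi / 2) = sin (pi * x)" by (simp add: cos_diff)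
        moreover have "1 \<le> sqrt 2" by simp
        ultimately show ?thesis unfolding cos_45 cos_abs_real by linarith
      qed
      hence "R * (1 / 2) \<le> R * sin (pi * x)" using rR by (intro mult_left_mono) auto
      hence "norm \<rho> \<le> 2 * \<bar>Im \<rho>\<bar>" using rho by simp
      hence "norm (F (\<rho>\<^sup>2)) \<le> exp (- K) * exp (b * \<bar>Im \<rho>\<bar>)" using R1[of \<rho>] rho RR by simp
      hence "ln (norm (F (\<rho>\<^sup>2))) \<le> ln (exp (- K) * exp (b * \<bar>Im \<rho>\<bar>))" using Fnz by (intro ln_mono) auto
      also have "\<dots> = - K + b * \<bar>Im \<rho>\<bar>" by (simp add: ln_mult)
      finally show ?thesis using True rho by simp
    next
      case False
      have "norm (F (\<rho>\<^sup>2)) \<le> C * exp (b * \<bar>Im \<rho>\<bar>)" using up[of \<rho>] rho RR by simp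
      hence "ln (norm (F (\<rho>\<^sup>2))) \<le> ln (C * exp (b * \<bar>Im \<rho>\<bar>))" using Fnz by (intro ln_mono) auto
      also have "\<dots> = ln C + b * \<bar>Im \<rho>\<bar>" using C by (simp add: ln_mult)
      finally have "ln (norm (F (\<rho>\<^sup>2))) \<le> \<bar>ln C\<bar> + 0 + b * (R * sin (pi * x))" using rho by simp
      then show ?thesis unfolding rho(1) if_not_P[OF False] .
    qed
  qed
  moreover have "2 * b / pi * R - C' \<le> log_zero_sum F r" using many[OF nz rr(2)] by (simp add: R_def)
  moreover have "2 * b / pi * R = b * (R * (2 / pi))" by simp
  ultimately show False unfolding K_def by argo
qed

subsection \<open>The solution with a discontinuity and its eigenvalues\<close>

lemma sigma_finite_lebesgue_measure: "sigma_finite_measure (lebesgue :: 'a::euclidean_space measure)"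
proof
  obtain A :: "'a set set" where A: "countable A" "A \<subseteq> sets lborel" "\<Union>A = space lborel" "\<forall>a\<in>A. emeasure lborel a \<noteq> \<infinity>"
    using lborel.sigma_finite_countable by blast
  then show "\<exists>A. countable A \<and> A \<subseteq> sets (lebesgue :: 'a measure) \<and> \<Union>A = space (lebesgue :: 'a measure) \<and> (\<forall>a\<in>A. emeasure lebesgue a \<noteq> \<infinity>)"
    by (intro exI[of _ A]) (auto simp: emeasure_completion subset_iff sets_completionI_sets)
qed

text \<open>Extended by zero, f has vanishing integral over every half line. The half lines are
  closed under intersection and generate the Borel sets, so the integral vanishes over every Borel
  set, and then over every Lebesgue set, which is Borel up to a null set.\<close>

lemma AE_zero_if_integrals_zero:
  fixes f :: "real \<Rightarrow> complex"
  assumes f: "f absolutely_integrable_on {a..c}" and z: "\<And>x. x \<in> {a..c} \<Longrightarrow> (f has_integral 0) {a..x}"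
  shows "negligible {x \<in> {a..c}. f x \<noteq> 0}"
proof -
  define g where "g x = indicat_real {a..c} x *\<^sub>R f x" for x
  have g: "integrable lebesgue g" using f unfolding set_integrable_def g_def .
  have gi: "set_integrable lebesgue B g" if "B \<in> sets lebesgue" for B
    using g that unfolding set_integrable_def by (intro integrable_mult_indicator)
  have borel0: "(LINT x:B|lebesgue. g x) = 0" if "B \<in> sets borel" for B
  proof -
    let ?G = "range (\<lambda>u::real. {..u})"
    have B: "B \<in> sigma_sets UNIV ?G" using that unfolding borel_eq_atMost by simp
    have Int: "Int_stable ?G" by (auto simp: Int_stable_def)
    have leb: "A \<in> sets lebesgue" if "A \<in> sigma_sets UNIV ?G" for A
    proof -
      have "A \<in> sets borel" using that unfolding borel_eq_atMost by simp
      then show ?thesis by simp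
    qed
    have basic: "(LINT x:{..u}|lebesgue. g x) = 0" for u
    proof -
      have "(LINT x:{..u}|lebesgue. g x) = (LINT x:{a..min u c}|lebesgue. f x)"
        unfolding set_lebesgue_integral_def g_def
        by (intro Bochner_Integration.integral_cong) (auto simp: indicator_def)
      also have "\<dots> = integral {a..min u c} f"
        by (intro set_lebesgue_integral_eq_integral absolutely_integrable_on_subinterval[OF f]) auto
      also have "\<dots> = 0"
        using z[of "min u c"] by (cases "a \<le> min u c") (auto simp: integral_unique)
      finally show ?thesis .
    qed
    have univ: "(LINT x:UNIV|lebesgue. g x) = 0"
    proof -
      have "(LINT x:UNIV|lebesgue. g x) = (LINT x:{..c}|lebesgue. g x)"
        unfolding set_lebesgue_integral_def g_def
        by (intro Bochner_Integration.integral_cong) (auto simp: indicator_def)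
      then show ?thesis using basic by simp
    qed
    show ?thesis
    proof (induction rule: sigma_sets_induct_disjoint[OF Int _ B])
      case (1) then show ?case by simp
    next
      case (2 A) then show ?case using basic by auto
    next
      case 3 then show ?case by (simp add: set_lebesgue_integral_def)
    next
      case (4 A)
      have "(LINT x:A \<union> (UNIV - A)|lebesgue. g x) = (LINT x:A|lebesgue. g x) + (LINT x:UNIV - A|lebesgue. g x)"
        using leb[OF 4(1)] by (intro set_integral_Un gi) auto
      then show ?case using univ 4(2) by simp
    next
      case (5 A)
      have "(LINT x:(\<Union>i. A i)|lebesgue. g x) = (\<Sum>i. (LINT x:A i|lebesgue. g x))"
      proof (rule lebesgue_integral_countable_add)
        show "A i \<in> sets lebesgue" for i using 5(2) leb by auto
        then show "set_integrable lebesgue (\<Union>i. A i) g" by (intro gi sets.countable_UN) auto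
        show "A i \<inter> A j = {}" if "i \<noteq> j" for i j using 5(1) that by (auto simp: disjoint_family_on_def)
      qed
      then show ?case using 5(3) by simp
    qed
  qed
  have "AE x in lebesgue. g x = 0"
  proof (rule sigma_finite_measure.density_zero[OF sigma_finite_lebesgue_measure g])
    fix A :: "real set" assume A: "A \<in> sets lebesgue"
    obtain C T where CT: "fsigma C" "T \<in> null_sets lebesgue" "C \<union> T = A" "disjnt C T"
      using lebesgue_set_almost_fsigma[OF A] by blast
    obtain F where F: "\<forall>n::nat. closed (F n)" "C = (\<Union>n. F n)" using CT(1) by (auto elim!: fsigma.cases)
    have C: "C \<in> sets borel" unfolding F(2) using F(1) by (intro sets.countable_UN) (auto intro: borel_closed)
    have CL: "C \<in> sets lebesgue" using C by simp
    have "(LINT x:A|lebesgue. g x) = (LINT x:C|lebesgue. g x)"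
    proof (rule set_integral_null_delta[OF g A])
      have "(A - C) \<union> (C - A) \<subseteq> T" using CT(3) by auto
      then show "(A - C) \<union> (C - A) \<in> null_sets lebesgue"
        using CT(2) A CL by (intro null_sets_subset[OF CT(2)]) auto
    qed (use C in simp)
    then show "(LINT x:A|lebesgue. g x) = 0" using borel0[OF C] by simp
  qed
  hence "{x. g x \<noteq> 0} \<in> null_sets lebesgue"
    by (simp add: eventually_ae_filter_negligible AE_iff_null_sets[symmetric] negligible_iff_null_sets) (meson negligible_iff_null_sets negligible_subset)
  moreover have "{x. g x \<noteq> 0} = {x \<in> {a..c}. f x \<noteq> 0}" by (auto simp: g_def indicator_def)
  ultimately show ?thesis by (simp add: negligible_iff_null_sets)
qed

text \<open>Subtracting the two equations leaves (q - p) y with vanishing indefinite integral; y has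
  no zero and can be cancelled.\<close>

lemma ode_sol_determines_coefficient:
  assumes q: "q absolutely_integrable_on {a..c}" and p: "p absolutely_integrable_on {a..c}"
    and "ode_sol q l a c y dy" "ode_sol p l a c y dy" and nz: "\<And>x. x \<in> {a..c} \<Longrightarrow> y x \<noteq> 0"
  shows "negligible {x \<in> {a..c}. q x \<noteq> p x}"
proof -
  have "(\<lambda>x. (q x - p x) * y x) absolutely_integrable_on {a..c}"
    using ode_sol_continuous(1)[OF assms(3)] q p
    by (intro absolutely_integrable_mult_continuous set_integral_diff(1))
  moreover have "((\<lambda>x. (q x - p x) * y x) has_integral 0) {a..x}" if "x \<in> {a..c}" for x
    using has_integral_diff[OF ode_solD(2)[OF assms(3) that] ode_solD(2)[OF assms(4) that]]
    by (simp add: algebra_simps)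
  ultimately have "negligible {x \<in> {a..c}. (q x - p x) * y x \<noteq> 0}"
    by (rule AE_zero_if_integrals_zero)
  moreover have "{x \<in> {a..c}. (q x - p x) * y x \<noteq> 0} = {x \<in> {a..c}. q x \<noteq> p x}"
    using nz by auto
  ultimately show ?thesis by simp
qed

section \<open>The solution across the discontinuity\<close>

lemma growth_rate_interval_mono:
  fixes q :: "real \<Rightarrow> complex"
  assumes q: "q absolutely_integrable_on {a..c}" and u: "a \<le> u" "u \<le> x" "x \<le> c" and R: "0 \<le> R"
  shows "growth_rate q R u x \<le> growth_rate q R a c"
  unfolding growth_rate_def
proof (rule integral_subset_le)
  note i = set_lebesgue_integral_eq_integral(1)[OF growth_rate_integrable[OF q, of R]]
  show "(\<lambda>t. 1 + norm (q t) + R) integrable_on {a..c}" by (rule i)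
  show "(\<lambda>t. 1 + norm (q t) + R) integrable_on {u..x}"
    using u by (intro integrable_on_subinterval[OF i]) auto
qed (use u R in auto)

lemma solves_on_cong:
  assumes "solves_on q l I y dy" "\<And>x. x \<in> I \<Longrightarrow> y x = z x" "\<And>x. x \<in> I \<Longrightarrow> dy x = dz x" "\<And>u x. u \<in> I \<Longrightarrow> x \<in> I \<Longrightarrow> {u..x} \<subseteq> I"
  shows "solves_on q l I z dz"
  unfolding solves_on_def
proof (intro conjI ballI impI)
  fix x assume x: "x \<in> I"
  have "(y has_vector_derivative dy x) (at x within I)" using assms(1) x unfolding solves_on_def by auto
  then show "(z has_vector_derivative dz x) (at x within I)"
    using assms(2,3) x by (metis has_vector_derivative_transform)
next
  fix u x assume ux: "u \<in> I" "x \<in> I" "u \<le> x"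
  have "((\<lambda>t. (q t - l) * y t) has_integral (dz x - dz u)) {u..x}"
    using assms(1,3) ux unfolding solves_on_def by metis
  then show "((\<lambda>t. (q t - l) * z t) has_integral (dz x - dz u)) {u..x}"
  proof (rule has_integral_eq[rotated])
    fix t assume "t \<in> {u..x}"
    hence "t \<in> I" using assms(4)[OF ux(1,2)] by blast
    then show "(q t - l) * y t = (q t - l) * z t" by (simp add: assms(2))
  qed
qed

lemma jump_solution_is_phi:
  assumes d: "0 < d" "d < pi"
    and Y: "ode_sol q l 0 d Y dY" "Y 0 = 1" "dY 0 = h"
    and Z: "ode_sol q l d pi Z dZ" "Z d = of_real \<beta> * Y d" "dZ d = inverse (of_real \<beta>) * dY d + \<gamma> * Y d"
  shows "is_phi q h \<beta> \<gamma> d l (\<lambda>x. if x < d then Y x else Z x) (\<lambda>x. if x < d then dY x else dZ x)"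
proof -
  let ?y = "\<lambda>x. if x < d then Y x else Z x" and ?dy = "\<lambda>x. if x < d then dY x else dZ x"
  have left: "((\<lambda>x. if x < d then f x else g x) \<longlongrightarrow> f d) (at_left d)"
    if "continuous_on {0..d} f" for f g :: "real \<Rightarrow> complex"
  proof -
    have "(f \<longlongrightarrow> f d) (at d within {0..d})" using that d by (auto simp: continuous_on_def)
    hence "(f \<longlongrightarrow> f d) (at_left d)" using d by (simp add: at_within_Icc_at_left)
    then show ?thesis
      by (rule Lim_transform_eventually) (auto simp: eventually_at_filter)
  qed
  have right: "((\<lambda>x. if x < d then f x else g x) \<longlongrightarrow> g d) (at_right d)"
    if "continuous_on {d..pi} g" for f g :: "real \<Rightarrow> complex"
  proof -
    have "(g \<longlongrightarrow> g d) (at d within {d..pi})" using that d by (auto simp: continuous_on_def)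
    hence "(g \<longlongrightarrow> g d) (at_right d)" using d by (simp add: at_within_Icc_at_right)
    then show ?thesis
      by (rule Lim_transform_eventually) (auto simp: eventually_at_filter)
  qed
  have "solves_on q l {0..<d} Y dY" by (rule ode_sol_imp_solves_on[OF Y(1)]) auto
  hence 1: "solves_on q l {0..<d} ?y ?dy" by (rule solves_on_cong) auto
  have "solves_on q l {d<..pi} Z dZ" by (rule ode_sol_imp_solves_on[OF Z(1)]) auto
  hence 2: "solves_on q l {d<..pi} ?y ?dy" by (rule solves_on_cong) auto
  have "jump_conditions \<beta> \<gamma> d ?y ?dy"
    unfolding jump_conditions_def
  proof (rule exI[of _ "Y d"], rule exI[of _ "dY d"], intro conjI)
    show "(?y \<longlongrightarrow> of_real \<beta> * Y d) (at_right d)"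
      unfolding Z(2)[symmetric] by (rule right[OF ode_sol_continuous(1)[OF Z(1)]])
    show "(?dy \<longlongrightarrow> inverse (of_real \<beta>) * dY d + \<gamma> * Y d) (at_right d)"
      unfolding Z(3)[symmetric] by (rule right[OF ode_sol_continuous(2)[OF Z(1)]])
  qed (rule left, rule ode_sol_continuous[OF Y(1)])+
  then show ?thesis using 1 2 d Y unfolding is_phi_def by auto
qed

text \<open>To the right of \<open>d\<close> the solution is known only through one-sided limits, so
  it is compared with \<open>Z\<close> from a point u > d. The Gronwall factor is bounded
  independently of u, and letting u tend to d makes the difference vanish.\<close>

lemma is_phi_unique:
  assumes q: "q absolutely_integrable_on {0..pi}" and d: "0 < d" "d < pi"
    and Y: "ode_sol q l 0 d Y dY" "Y 0 = 1" "dY 0 = h"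
    and Z: "ode_sol q l d pi Z dZ" "Z d = of_real \<beta> * Y d" "dZ d = inverse (of_real \<beta>) * dY d + \<gamma> * Y d"
    and p: "is_phi q h \<beta> \<gamma> d l y dy"
  shows "\<And>x. x \<in> {0..<d} \<Longrightarrow> y x = Y x \<and> dy x = dY x" "\<And>x. x \<in> {d<..pi} \<Longrightarrow> y x = Z x \<and> dy x = dZ x"
proof -
  have s: "solves_on q l {0..<d} y dy" "solves_on q l {d<..pi} y dy" "jump_conditions \<beta> \<gamma> d y dy" "y 0 = 1" "dy 0 = h"
    using p unfolding is_phi_def by auto
  show left: "y x = Y x \<and> dy x = dY x" if x: "x \<in> {0..<d}" for x
  proof -
    have 1: "ode_sol q l 0 x y dy" by (rule solves_on_imp_ode_sol[OF s(1)]) (use x in auto)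
    have 2: "ode_sol q l 0 x Y dY" by (rule ode_sol_subinterval[OF Y(1)]) (use x in auto)
    have qx: "q absolutely_integrable_on {0..x}"
      by (rule absolutely_integrable_on_subinterval[OF q]) (use x d in auto)
    show ?thesis using ode_sol_unique[OF qx 1 2, of x] s Y x by auto
  qed
  obtain l0 l1 where l: "(y \<longlongrightarrow> l0) (at_left d)" "(dy \<longlongrightarrow> l1) (at_left d)" "(y \<longlongrightarrow> of_real \<beta> * l0) (at_right d)"
     "(dy \<longlongrightarrow> inverse (of_real \<beta>) * l1 + \<gamma> * l0) (at_right d)"
    using s(3) unfolding jump_conditions_def by blast
  have ev: "eventually (\<lambda>x. x \<in> {0..<d}) (at_left d)"
    using eventually_at_left_real[OF d(1)] by (rule eventually_mono) auto
  have lim: "(Y \<longlongrightarrow> Y d) (at_left d)" "(dY \<longlongrightarrow> dY d) (at_left d)"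
    using ode_sol_continuous[OF Y(1)] d by (auto simp: continuous_on_def at_within_Icc_at_left[symmetric])
  have "(y \<longlongrightarrow> Y d) (at_left d)"
    by (rule Lim_transform_eventually[OF lim(1)]) (use ev left in \<open>auto elim!: eventually_mono\<close>)
  hence l0: "l0 = Y d" using l(1) tendsto_unique trivial_limit_at_left_real by blast
  have "(dy \<longlongrightarrow> dY d) (at_left d)"
    by (rule Lim_transform_eventually[OF lim(2)]) (use ev left in \<open>auto elim!: eventually_mono\<close>)
  hence l1: "l1 = dY d" using l(2) tendsto_unique trivial_limit_at_left_real by blast
  have limZ: "(Z \<longlongrightarrow> Z d) (at_right d)" "(dZ \<longlongrightarrow> dZ d) (at_right d)"
    using ode_sol_continuous[OF Z(1)] d by (auto simp: continuous_on_def at_within_Icc_at_right[symmetric])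
  have D: "((\<lambda>u. 1 * y u + (-1) * Z u) \<longlongrightarrow> 0) (at_right d)" "((\<lambda>u. 1 * dy u + (-1) * dZ u) \<longlongrightarrow> 0) (at_right d)"
    using tendsto_diff[OF l(3) limZ(1)] tendsto_diff[OF l(4) limZ(2)] Z(2,3) l0 l1 by simp_all
  show "y x = Z x \<and> dy x = dZ x" if x: "x \<in> {d<..pi}" for x
  proof -
    define K where "K = exp (growth_rate q (norm l) 0 pi)"
    let ?e = "\<lambda>u. 1 * y u + (-1) * Z u" and ?de = "\<lambda>u. 1 * dy u + (-1) * dZ u"
    have "norm (?e x) + norm (?de x) \<le> (norm (?e u) + norm (?de u)) * K" if u: "u \<in> {d<..<x}" for u
    proof -
      have 1: "ode_sol q l u x y dy" by (rule solves_on_imp_ode_sol[OF s(2)]) (use x u in auto)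
      have 2: "ode_sol q l u x Z dZ" by (rule ode_sol_subinterval[OF Z(1)]) (use x u in auto)
      have qx: "q absolutely_integrable_on {u..x}"
        by (rule absolutely_integrable_on_subinterval[OF q]) (use x u d in auto)
      have "norm (?e x) + norm (?de x) \<le> (norm (?e u) + norm (?de u)) * exp (growth_rate q (norm l) u x)"
        using ode_sol_bound[OF qx ode_sol_combination[OF 1 2, of 1 "-1"], of x] u by simp
      also have "\<dots> \<le> (norm (?e u) + norm (?de u)) * K"
        unfolding K_def using x u d by (intro mult_left_mono) (auto intro!: growth_rate_interval_mono[OF q])
      finally show ?thesis .
    qed
    hence "eventually (\<lambda>u. norm (?e x) + norm (?de x) \<le> (norm (?e u) + norm (?de u)) * K) (at_right d)"
      using eventually_at_right_real[of d x] x by (auto elim!: eventually_mono)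
    moreover have "((\<lambda>u. (norm (?e u) + norm (?de u)) * K) \<longlongrightarrow> (norm (0::complex) + norm (0::complex)) * K) (at_right d)"
      by (intro tendsto_intros D)
    ultimately have "norm (?e x) + norm (?de x) \<le> 0"
      using tendsto_lowerbound[of "\<lambda>u. (norm (?e u) + norm (?de u)) * K" 0 "at_right d"] by simp
    hence "norm (?e x) = 0" "norm (?de x) = 0"
      using norm_ge_zero[of "?e x"] norm_ge_zero[of "?de x"] by linarith+
    then show ?thesis by simp
  qed
qed

text \<open>Replaces the choice in \<open>phi_pair\<close> by explicit families on [0,d] and
  [d,\<pi>]. The data of the right family depend on \<open>l\<close>, so it is built as an entire
  combination of two solutions with fixed data at \<open>d\<close>.\<close>

lemma phi_structure:
  assumes q: "q absolutely_integrable_on {0..pi}" and d: "0 < d" "d < pi"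
  obtains Y dY Z dZ where
    "\<And>l. ode_sol q l 0 d (Y l) (dY l)" "\<And>l. Y l 0 = 1" "\<And>l. dY l 0 = h"
    "\<And>l. ode_sol q l d pi (Z l) (dZ l)" "\<And>l. Z l d = of_real \<beta> * Y l d"
    "\<And>l. dZ l d = inverse (of_real \<beta>) * dY l d + \<gamma> * Y l d"
    "\<And>x. x \<in> {0..d} \<Longrightarrow> (\<lambda>l. Y l x) holomorphic_on UNIV" "\<And>x. x \<in> {0..d} \<Longrightarrow> (\<lambda>l. dY l x) holomorphic_on UNIV"
    "\<And>l. phi q h \<beta> \<gamma> d pi l = Z l pi" "\<And>l. dphi q h \<beta> \<gamma> d pi l = dZ l pi"
    "phi q h \<beta> \<gamma> d pi holomorphic_on UNIV" "dphi q h \<beta> \<gamma> d pi holomorphic_on UNIV"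
proof -
  have q1: "q absolutely_integrable_on {0..d}" "q absolutely_integrable_on {d..pi}"
    using d by (auto intro: absolutely_integrable_on_subinterval[OF q])
  obtain Y dY where Y: "\<And>l. ode_sol q l 0 d (Y l) (dY l)" "\<And>l. Y l 0 = 1" "\<And>l. dY l 0 = h"
    "\<And>x. x \<in> {0..d} \<Longrightarrow> (\<lambda>l. Y l x) holomorphic_on UNIV" "\<And>x. x \<in> {0..d} \<Longrightarrow> (\<lambda>l. dY l x) holomorphic_on UNIV"
    using ode_sol_exists[OF q1(1), of 1 h] d by fastforce
  obtain C dC where C: "\<And>l. ode_sol q l d pi (C l) (dC l)" "\<And>l. C l d = 1" "\<And>l. dC l d = 0"
    "\<And>x. x \<in> {d..pi} \<Longrightarrow> (\<lambda>l. C l x) holomorphic_on UNIV" "\<And>x. x \<in> {d..pi} \<Longrightarrow> (\<lambda>l. dC l x) holomorphic_on UNIV"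
    using ode_sol_exists[OF q1(2), of 1 0] d by fastforce
  obtain S dS where S: "\<And>l. ode_sol q l d pi (S l) (dS l)" "\<And>l. S l d = 0" "\<And>l. dS l d = 1"
    "\<And>x. x \<in> {d..pi} \<Longrightarrow> (\<lambda>l. S l x) holomorphic_on UNIV" "\<And>x. x \<in> {d..pi} \<Longrightarrow> (\<lambda>l. dS l x) holomorphic_on UNIV"
    using ode_sol_exists[OF q1(2), of 0 1] d by fastforce
  define z0 where "z0 l = of_real \<beta> * Y l d" for l
  define z1 where "z1 l = inverse (of_real \<beta>) * dY l d + \<gamma> * Y l d" for l
  define Z where "Z l = (\<lambda>x. z0 l * C l x + z1 l * S l x)" for l
  define dZ where "dZ l = (\<lambda>x. z0 l * dC l x + z1 l * dS l x)" for l
  have Z: "ode_sol q l d pi (Z l) (dZ l)" "Z l d = of_real \<beta> * Y l d" "dZ l d = inverse (of_real \<beta>) * dY l d + \<gamma> * Y l d" for l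
    using ode_sol_combination[OF C(1) S(1), of l "z0 l" "z1 l"] C(2,3) S(2,3)
    by (auto simp: Z_def dZ_def z0_def z1_def)
  have P: "is_phi q h \<beta> \<gamma> d l (fst (phi_pair q h \<beta> \<gamma> d l)) (snd (phi_pair q h \<beta> \<gamma> d l))" for l
    unfolding phi_pair_def
    by (rule someI[of _ "(\<lambda>x. if x < d then Y l x else Z l x, \<lambda>x. if x < d then dY l x else dZ l x)"])
       (simp only: fst_conv snd_conv, rule jump_solution_is_phi[OF d Y(1-3) Z])
  have pi: "phi q h \<beta> \<gamma> d pi l = Z l pi" "dphi q h \<beta> \<gamma> d pi l = dZ l pi" for l
    unfolding phi_def dphi_def using is_phi_unique(2)[OF q d Y(1)[of l] Y(2)[of l] Y(3)[of l] Z(1)[of l] Z(2)[of l] Z(3)[of l] P[of l], of pi] d by auto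
  have hz: "z0 holomorphic_on UNIV" "z1 holomorphic_on UNIV"
    unfolding z0_def z1_def using Y(4,5)[of d] d by (auto intro!: holomorphic_intros)
  have hol: "(\<lambda>l. Z l pi) holomorphic_on UNIV" "(\<lambda>l. dZ l pi) holomorphic_on UNIV"
    unfolding Z_def dZ_def using C(4,5)[of pi] S(4,5)[of pi] d hz by (auto intro!: holomorphic_intros)
  have "phi q h \<beta> \<gamma> d pi = (\<lambda>l. Z l pi)" "dphi q h \<beta> \<gamma> d pi = (\<lambda>l. dZ l pi)" using pi by auto
  then show ?thesis using that[OF Y(1-3) Z Y(4,5) pi] hol by simp
qed

section \<open>Transfer of Cauchy data from \<pi> back to b\<close>

text \<open>The transfer matrix has determinant 1 by constancy of the Wronskian, so its inverse has
  the same entries up to sign and order and is again entire in \<open>l\<close>.\<close>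

lemma ode_sol_backward:
  assumes q: "q absolutely_integrable_on {a..c}" and ac: "a \<le> c"
    and s: "ode_sol q l a c C dC" "ode_sol q l a c S dS" "C a = 1" "dC a = 0" "S a = 0" "dS a = 1"
    and y: "ode_sol q l a c y dy"
  shows "y a = dS c * y c - S c * dy c" "dy a = C c * dy c - dC c * y c"
proof -
  have c: "c \<in> {a..c}" using ac by auto
  have r: "y c = y a * C c + dy a * S c" "dy c = y a * dC c + dy a * dS c"
    using ode_sol_representation[OF q s y c] by auto
  have w: "C c * dS c - dC c * S c = 1"
    using wronskian_constant[OF q s(1,2) c] s(3-6) by simp
  have "dS c * y c - S c * dy c = y a * (C c * dS c - dC c * S c)"
    unfolding r by (simp add: algebra_simps)
  then show "y a = dS c * y c - S c * dy c" using w by simp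
  have "C c * dy c - dC c * y c = dy a * (C c * dS c - dC c * S c)"
    unfolding r by (simp add: algebra_simps)
  then show "dy a = C c * dy c - dC c * y c" using w by simp
qed

lemma backward_transfer:
  assumes q: "q absolutely_integrable_on {a..c}" and ac: "a \<le> c"
  obtains e11 e12 e21 e22 where
    "e11 holomorphic_on UNIV" "e12 holomorphic_on UNIV" "e21 holomorphic_on UNIV" "e22 holomorphic_on UNIV"
    "\<And>l y dy. ode_sol q l a c y dy \<Longrightarrow> y a = e11 l * y c + e12 l * dy c"
    "\<And>l y dy. ode_sol q l a c y dy \<Longrightarrow> dy a = e21 l * y c + e22 l * dy c"
proof -
  have c: "c \<in> {a..c}" using ac by auto
  obtain C dC where C: "\<And>l. ode_sol q l a c (C l) (dC l)" "\<And>l. C l a = 1" "\<And>l. dC l a = 0"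
    "(\<lambda>l. C l c) holomorphic_on UNIV" "(\<lambda>l. dC l c) holomorphic_on UNIV"
    using ode_sol_exists[OF q, of 1 0] c by fastforce
  obtain S dS where S: "\<And>l. ode_sol q l a c (S l) (dS l)" "\<And>l. S l a = 0" "\<And>l. dS l a = 1"
    "(\<lambda>l. S l c) holomorphic_on UNIV" "(\<lambda>l. dS l c) holomorphic_on UNIV"
    using ode_sol_exists[OF q, of 0 1] c by fastforce
  show ?thesis
    by (rule that[of "\<lambda>l. dS l c" "\<lambda>l. - S l c" "\<lambda>l. - dC l c" "\<lambda>l. C l c"])
       (use ode_sol_backward[OF q ac C(1) S(1) C(2,3) S(2,3)] C S in \<open>auto intro!: holomorphic_intros\<close>)
qed

lemma jump_backward:
  fixes \<beta> :: real and z y dz dy \<gamma> :: complex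
  assumes "\<beta> \<noteq> 0" "z = of_real \<beta> * y" "dz = inverse (of_real \<beta>) * dy + \<gamma> * y"
  shows "y = inverse (of_real \<beta>) * z" "dy = of_real \<beta> * dz - \<gamma> * z"
  using assms by (auto simp: field_simps)

text \<open>The entries are fixed before the solution is chosen. Two problems with the same
  coefficients on [b,\<pi>] therefore share them, and a difference of data at \<pi> is mapped to the
  difference of data at \<open>b\<close>.\<close>

lemma transfer_from_pi:
  fixes \<beta> :: real
  assumes q: "q absolutely_integrable_on {b..pi}" and d: "b \<le> d" "d \<le> pi" and \<beta>: "\<beta> \<noteq> 0"
  obtains e11 e12 e21 e22 where
    "e11 holomorphic_on UNIV" "e12 holomorphic_on UNIV" "e21 holomorphic_on UNIV" "e22 holomorphic_on UNIV"
    "\<And>l y dy z dz. ode_sol q l b d y dy \<Longrightarrow> ode_sol q l d pi z dz \<Longrightarrow> z d = of_real \<beta> * y d \<Longrightarrow>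
        dz d = inverse (of_real \<beta>) * dy d + \<gamma> * y d \<Longrightarrow>
        y b = e11 l * z pi + e12 l * dz pi \<and> dy b = e21 l * z pi + e22 l * dz pi"
proof -
  have q1: "q absolutely_integrable_on {b..d}" "q absolutely_integrable_on {d..pi}"
    using d by (auto intro: absolutely_integrable_on_subinterval[OF q])
  obtain f11 f12 f21 f22 where f:
    "f11 holomorphic_on UNIV" "f12 holomorphic_on UNIV" "f21 holomorphic_on UNIV" "f22 holomorphic_on UNIV"
    "\<And>l y dy. ode_sol q l b d y dy \<Longrightarrow> y b = f11 l * y d + f12 l * dy d"
    "\<And>l y dy. ode_sol q l b d y dy \<Longrightarrow> dy b = f21 l * y d + f22 l * dy d"
    using backward_transfer[OF q1(1) d(1)] by metis
  obtain g11 g12 g21 g22 where g: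
    "g11 holomorphic_on UNIV" "g12 holomorphic_on UNIV" "g21 holomorphic_on UNIV" "g22 holomorphic_on UNIV"
    "\<And>l y dy. ode_sol q l d pi y dy \<Longrightarrow> y d = g11 l * y pi + g12 l * dy pi"
    "\<And>l y dy. ode_sol q l d pi y dy \<Longrightarrow> dy d = g21 l * y pi + g22 l * dy pi"
    using backward_transfer[OF q1(2) d(2)] by metis
  let ?i = "inverse (of_real \<beta>) :: complex" and ?b = "of_real \<beta> :: complex"
  show ?thesis
  proof (rule that[of
      "\<lambda>l. f11 l * (?i * g11 l) + f12 l * (?b * g21 l - \<gamma> * g11 l)"
      "\<lambda>l. f11 l * (?i * g12 l) + f12 l * (?b * g22 l - \<gamma> * g12 l)"
      "\<lambda>l. f21 l * (?i * g11 l) + f22 l * (?b * g21 l - \<gamma> * g11 l)"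
      "\<lambda>l. f21 l * (?i * g12 l) + f22 l * (?b * g22 l - \<gamma> * g12 l)"])
    fix l y dy z dz
    assume s: "ode_sol q l b d y dy" "ode_sol q l d pi z dz" and j: "z d = ?b * y d" "dz d = ?i * dy d + \<gamma> * y d"
    note jb = jump_backward[OF \<beta> j]
    show "y b = (f11 l * (?i * g11 l) + f12 l * (?b * g21 l - \<gamma> * g11 l)) * z pi + (f11 l * (?i * g12 l) + f12 l * (?b * g22 l - \<gamma> * g12 l)) * dz pi \<and>
      dy b = (f21 l * (?i * g11 l) + f22 l * (?b * g21 l - \<gamma> * g11 l)) * z pi + (f21 l * (?i * g12 l) + f22 l * (?b * g22 l - \<gamma> * g12 l)) * dz pi"
      unfolding f(5)[OF s(1)] f(6)[OF s(1)] jb g(5)[OF s(2)] g(6)[OF s(2)] by (simp add: algebra_simps)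
  qed (use f g in \<open>auto intro!: holomorphic_intros\<close>)
qed

section \<open>Multiplicities, blocks of equal eigenvalues and subsequences\<close>

lemma deriv_zeros_mult:
  assumes "f holomorphic_on UNIV" "g holomorphic_on UNIV" "\<And>\<nu>. \<nu> < k \<Longrightarrow> (deriv ^^ \<nu>) f z = 0" "\<nu> < k"
  shows "(deriv ^^ \<nu>) (\<lambda>w. g w * f w) z = 0"
  using assms by (subst higher_deriv_mult[of _ UNIV]) (auto intro!: sum.neutral)

lemma alg_mult_eq_Least:
  assumes f: "f holomorphic_on UNIV" and nz: "f w \<noteq> 0"
  shows "(deriv ^^ alg_mult f z) f z \<noteq> 0" "\<And>\<nu>. \<nu> < alg_mult f z \<Longrightarrow> (deriv ^^ \<nu>) f z = 0"
proof -
  have "\<exists>n. (deriv ^^ n) f z \<noteq> 0"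
    using holomorphic_fun_eq_0_on_connected[OF f open_UNIV connected_UNIV, of z w] nz by auto
  define n where "n = (LEAST n. (deriv ^^ n) f z \<noteq> 0)"
  have n: "(deriv ^^ n) f z \<noteq> 0" unfolding n_def using \<open>\<exists>n. _\<close> by (rule LeastI_ex)
  have less: "(deriv ^^ i) f z = 0" if "i < n" for i using not_less_Least that unfolding n_def by blast
  have "zorder f z = int n" by (rule zorder_zero_eqI[OF f open_UNIV]) (use n less in auto)
  moreover have "f z \<noteq> 0 \<Longrightarrow> n = 0" using less[of 0] by auto
  moreover have "f z = 0 \<Longrightarrow> n > 0" using n by (cases n) auto
  ultimately have "alg_mult f z = n" unfolding alg_mult_def by auto
  then show "(deriv ^^ alg_mult f z) f z \<noteq> 0" "\<And>\<nu>. \<nu> < alg_mult f z \<Longrightarrow> (deriv ^^ \<nu>) f z = 0" using n less by auto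
qed

text \<open>Equal values are adjacent, so a block is an interval of indices, and the last block
  start not exceeding n + \<nu> is n itself.\<close>

lemma eigenvalue_block:
  assumes s: "eigenvalue_sequence f s" and n: "n \<in> block_starts s" and nu: "\<nu> < card {k. s k = s n}"
  shows "gen_ratio g s (n + \<nu>) = (deriv ^^ \<nu>) g (s n) / fact \<nu>"
proof -
  have adj: "\<And>i j k. i \<le> j \<Longrightarrow> j \<le> k \<Longrightarrow> s i = s k \<Longrightarrow> s j = s i"
    using s unfolding eigenvalue_sequence_def by blast
  have fin: "finite {k. s k = s n}" using s unfolding eigenvalue_sequence_def by blast
  have before: "s k \<noteq> s n" if "k < n" for k
  proof
    assume "s k = s n"
    moreover have "1 \<le> n" "s (n - 1) \<noteq> s n" using n that by (auto simp: block_starts_def)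
    moreover have "k \<le> n - 1" "n - 1 \<le> n" using that by auto
    ultimately show False using adj[of k "n - 1" n] by metis
  qed
  have upto: "s i = s n" if "n \<le> i" "i \<le> n + \<nu>" for i
  proof (rule ccontr)
    assume ne: "s i \<noteq> s n"
    \<comment> \<open>If the run of equal values broke off by index n + \<nu>, it would fit into
      \<nu> indices, contrary to \<nu> being less than its cardinality.\<close>
    have "{k. s k = s n} \<subseteq> {n..<n + \<nu>}"
    proof
      fix k assume k: "k \<in> {k. s k = s n}"
      have "n \<le> k" using before[of k] k by (cases "k < n") auto
      moreover have "k < i" using adj[of n i k] k ne that(1) by (cases "k < i") auto
      ultimately show "k \<in> {n..<n + \<nu>}" using that by auto
    qed
    hence "card {k. s k = s n} \<le> card {n..<n + \<nu>}" by (intro card_mono) auto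
    then show False using nu by simp
  qed
  have "Max {i \<in> block_starts s. i \<le> n + \<nu>} = n"
  proof (rule Max_eqI)
    show "finite {i \<in> block_starts s. i \<le> n + \<nu>}" by simp
    show "n \<in> {i \<in> block_starts s. i \<le> n + \<nu>}" using n by simp
    fix i assume i: "i \<in> {i \<in> block_starts s. i \<le> n + \<nu>}"
    show "i \<le> n"
    proof (rule ccontr)
      assume "\<not> i \<le> n"
      hence ni: "n \<le> i" "i \<le> n + \<nu>" "n \<le> i - 1" "i - 1 \<le> n + \<nu>" "i \<noteq> 0" using i by auto
      hence "s (i - 1) = s i" using upto[of i] upto[of "i - 1"] by simp
      then show False using i ni(5) by (auto simp: block_starts_def)
    qed
  qed
  then show ?thesis unfolding gen_ratio_def by simp
qed

lemma block_start_exists: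
  assumes "z \<in> range s"
  obtains n where "n \<in> block_starts s" "s n = z"
proof -
  define n where "n = (LEAST n. s n = z)"
  have "s n = z" unfolding n_def using assms by (auto intro: LeastI)
  moreover have "s (n - 1) \<noteq> z" if "1 \<le> n" using not_less_Least[of "n - 1" "\<lambda>n. s n = z"] that unfolding n_def by auto
  ultimately show ?thesis using that[of n] by (cases "n = 0") (auto simp: block_starts_def)
qed

lemma subsequence_occurrences:
  assumes sub: "is_subsequence D x s" and s: "eigenvalue_sequence f s"
  shows "occurrences D x z \<le> alg_mult f z" "finite {k \<in> D. x k = z}"
    "finite {n. norm (s n) < r} \<Longrightarrow> finite {k \<in> D. norm (x k) < r}" "k \<in> D \<Longrightarrow> x k \<in> range s"
proof -
  obtain r' where r': "strict_mono_on D r'" "\<And>k. k \<in> D \<Longrightarrow> x k = s (r' k)"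
    using sub unfolding is_subsequence_def by blast
  have inj: "inj_on r' D" using r'(1) by (rule strict_mono_on_imp_inj_on)
  have fin: "finite {n. s n = z}" "card {n. s n = z} = alg_mult f z" for z
    using s unfolding eigenvalue_sequence_def by blast+
  have im: "r' ` {k \<in> D. x k = z} \<subseteq> {n. s n = z}" using r'(2) by auto
  have inj': "inj_on r' {k \<in> D. x k = z}" using inj by (rule inj_on_subset) auto
  show "finite {k \<in> D. x k = z}" by (rule finite_imageD[OF finite_subset[OF im fin(1)] inj'])
  show "occurrences D x z \<le> alg_mult f z"
    unfolding occurrences_def fin(2)[symmetric] using card_inj_on_le[OF inj' im fin(1)] .
  show "finite {k \<in> D. norm (x k) < r}" if "finite {n. norm (s n) < r}"
  proof -
    have "r' ` {k \<in> D. norm (x k) < r} \<subseteq> {n. norm (s n) < r}" using r'(2) by auto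
    hence "finite (r' ` {k \<in> D. norm (x k) < r})" using that by (rule finite_subset)
    moreover have "inj_on r' {k \<in> D. norm (x k) < r}" using inj by (rule inj_on_subset) auto
    ultimately show ?thesis by (rule finite_imageD)
  qed
  show "x k \<in> range s" if "k \<in> D" using r'(2)[OF that] by auto
qed

section \<open>Asymptotics at \<pi> across the discontinuity\<close>

text \<open>Separates the frequencies. With A = \<rho> d and B = \<rho> (\<pi> - d) the sum A + B is
  \<pi> \<rho>, while A - B is \<rho> (2 d - \<pi>) and has smaller exponential type. For positive
  \<beta> its weight is also smaller: |bm| < bp.\<close>

lemma jump_trig_identities:
  fixes A B :: complex and \<beta> :: real
  assumes "\<beta> \<noteq> 0"
  defines "bp \<equiv> (\<beta> + 1 / \<beta>) / 2" and "bm \<equiv> (\<beta> - 1 / \<beta>) / 2"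
  shows "of_real \<beta> * cos A * cos B - inverse (of_real \<beta>) * sin A * sin B = of_real bp * cos (A + B) + of_real bm * cos (A - B)"
    and "of_real \<beta> * cos A * sin B + inverse (of_real \<beta>) * sin A * cos B = of_real bp * sin (A + B) + of_real bm * sin (B - A)"
proof -
  have b: "complex_of_real \<beta> = of_real bp + of_real bm" "inverse (complex_of_real \<beta>) = of_real bp - of_real bm"
    unfolding bp_def bm_def of_real_add[symmetric] of_real_diff[symmetric] of_real_inverse[symmetric]
    by (simp_all add: field_simps)
  show "of_real \<beta> * cos A * cos B - inverse (of_real \<beta>) * sin A * sin B = of_real bp * cos (A + B) + of_real bm * cos (A - B)"
    unfolding b(2) unfolding b(1) by (simp add: cos_add cos_diff algebra_simps)
  show "of_real \<beta> * cos A * sin B + inverse (of_real \<beta>) * sin A * cos B = of_real bp * sin (A + B) + of_real bm * sin (B - A)"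
    unfolding b(2) unfolding b(1) by (simp add: sin_add sin_diff algebra_simps)
qed

lemma exp_le_two_cosh: "exp \<bar>x\<bar> \<le> 2 * cosh x" for x :: real
proof -
  have "exp w \<le> 2 * cosh w" for w :: real by (simp add: cosh_field_def)
  from this[of "\<bar>x\<bar>"] show ?thesis by (simp only: cosh_real_abs)
qed

text \<open>
  The leading terms of \<open>\<phi>(\<pi>,\<rho>\<^sup>2)\<close> and, up to the factor \<open>- \<rho>\<close>, of \<open>\<phi>'(\<pi>,\<rho>\<^sup>2)\<close>.
\<close>

definition jump_cos :: "real \<Rightarrow> real \<Rightarrow> complex \<Rightarrow> complex" where
  "jump_cos \<beta> d \<rho> = of_real \<beta> * cos (\<rho> * of_real d) * cos (\<rho> * of_real (pi - d)) - inverse (of_real \<beta>) * sin (\<rho> * of_real d) * sin (\<rho> * of_real (pi - d))"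

definition jump_sin :: "real \<Rightarrow> real \<Rightarrow> complex \<Rightarrow> complex" where
  "jump_sin \<beta> d \<rho> = of_real \<beta> * cos (\<rho> * of_real d) * sin (\<rho> * of_real (pi - d)) + inverse (of_real \<beta>) * sin (\<rho> * of_real d) * cos (\<rho> * of_real (pi - d))"

text \<open>The frequency \<pi> dominates. It is bounded below where \<pi> |\<rho>| is a zero of sin
  for the cosine and of cos for the sine, hence the integer and half-integer radii. They are written
  as n + s to match the later counting lemmas.\<close>

lemma jump_trig_lower_bound:
  fixes \<beta> d :: real
  assumes \<beta>: "\<beta> > 0" and d: "0 < d" "d < pi"
  shows "\<exists>c>0. \<exists>R0. \<forall>\<rho> n. R0 \<le> norm \<rho> \<longrightarrow>
     (norm \<rho> = real n + 0 \<longrightarrow> c * exp (pi * \<bar>Im \<rho>\<bar>) \<le>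
        norm (jump_cos \<beta> d \<rho>)) \<and>
     (norm \<rho> = real n + 1 / 2 \<longrightarrow> c * exp (pi * \<bar>Im \<rho>\<bar>) \<le>
        norm (jump_sin \<beta> d \<rho>))"
proof -
  define bp bm where "bp = (\<beta> + 1 / \<beta>) / 2" and "bm = (\<beta> - 1 / \<beta>) / 2"
  have \<beta>0: "\<beta> \<noteq> 0" using \<beta> by simp
  have bm: "\<bar>bm\<bar> < bp" and bp: "bp > 0"
    using \<beta> unfolding bp_def bm_def by (auto simp: abs_less_iff add_pos_pos)
  \<comment> \<open>The midpoint between |bm| / bp and 1: less than 1, as
    \<open>trig_lower_bound\<close> requires, and large enough for bp \<kappa> to exceed
    |bm|.\<close>
  define \<kappa> where "\<kappa> = (1 + \<bar>bm\<bar> / bp) / 2"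
  have k: "0 < \<kappa>" "\<kappa> < 1" using bm bp by (auto simp: \<kappa>_def add_pos_nonneg)
  have bk: "bp * \<kappa> - \<bar>bm\<bar> = (bp - \<bar>bm\<bar>) / 2" using bp by (simp add: \<kappa>_def field_simps)
  obtain R0 where R0: "\<And>\<rho>::complex. R0 \<le> norm \<rho> \<Longrightarrow>
     (sin (pi * norm \<rho>) = 0 \<longrightarrow> norm (cos (of_real pi * \<rho>)) \<ge> \<kappa> * cosh (pi * Im \<rho>)) \<and>
     (cos (pi * norm \<rho>) = 0 \<longrightarrow> norm (sin (of_real pi * \<rho>)) \<ge> \<kappa> * cosh (pi * Im \<rho>))"
    using trig_lower_bound[OF pi_gt_zero k] by blast
  have low: "(bp - \<bar>bm\<bar>) / 4 * exp (pi * \<bar>Im \<rho>\<bar>) \<le> norm (of_real bp * u + of_real bm * v)"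
    if "norm u \<ge> \<kappa> * cosh (pi * Im \<rho>)" "norm v \<le> cosh ((2 * d - pi) * Im \<rho>)" for \<rho> u v :: complex
  proof -
    let ?C = "cosh (pi * Im \<rho>)"
    have "\<bar>(2 * d - pi) * Im \<rho>\<bar> \<le> \<bar>pi * Im \<rho>\<bar>" unfolding abs_mult using d by (intro mult_right_mono) auto
    hence "cosh \<bar>(2 * d - pi) * Im \<rho>\<bar> \<le> cosh \<bar>pi * Im \<rho>\<bar>" by (subst cosh_real_nonneg_le_iff) auto
    hence v: "norm v \<le> ?C" using that(2) unfolding cosh_real_abs by linarith
    have "(bp - \<bar>bm\<bar>) / 4 * exp \<bar>pi * Im \<rho>\<bar> \<le> (bp - \<bar>bm\<bar>) / 4 * (2 * ?C)"
      using bm exp_le_two_cosh[of "pi * Im \<rho>"] by (intro mult_left_mono) auto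
    also have "\<dots> = (bp * \<kappa> - \<bar>bm\<bar>) * ?C" unfolding bk by simp
    also have "\<dots> = bp * (\<kappa> * ?C) - \<bar>bm\<bar> * ?C" by (simp add: left_diff_distrib)
    also have "\<dots> \<le> bp * norm u - \<bar>bm\<bar> * norm v"
      using that(1) v bp by (intro diff_mono mult_left_mono) auto
    also have "\<dots> \<le> norm (of_real bp * u + of_real bm * v)"
      using norm_diff_ineq[of "of_real bp * u" "of_real bm * v"] bp by (simp add: norm_mult)
    finally show ?thesis by (simp add: abs_mult)
  qed
  have ab: "\<rho> * of_real d + \<rho> * of_real (pi - d) = of_real pi * \<rho>"
    "\<rho> * of_real d - \<rho> * of_real (pi - d) = of_real (2 * d - pi) * \<rho>"
    "\<rho> * of_real (pi - d) - \<rho> * of_real d = - (of_real (2 * d - pi) * \<rho>)" for \<rho> :: complex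
    by (simp_all add: algebra_simps)
  have "\<forall>(\<rho>::complex) n. R0 \<le> norm \<rho> \<longrightarrow>
     (norm \<rho> = real n + 0 \<longrightarrow> (bp - \<bar>bm\<bar>) / 4 * exp (pi * \<bar>Im \<rho>\<bar>) \<le>
        norm (jump_cos \<beta> d \<rho>)) \<and>
     (norm \<rho> = real n + 1 / 2 \<longrightarrow> (bp - \<bar>bm\<bar>) / 4 * exp (pi * \<bar>Im \<rho>\<bar>) \<le>
        norm (jump_sin \<beta> d \<rho>))"
  proof (intro allI impI conjI)
    fix \<rho> :: complex and n :: nat assume r: "R0 \<le> norm \<rho>"
    assume n: "norm \<rho> = real n + 0"
      have "sin (pi * norm \<rho>) = 0" unfolding n by (metis add.right_neutral mult.commute sin_npi)
      then have "norm (cos (of_real pi * \<rho>)) \<ge> \<kappa> * cosh (pi * Im \<rho>)" using R0[OF r] by blast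
      moreover have "norm (cos (of_real (2 * d - pi) * \<rho>)) \<le> cosh ((2 * d - pi) * Im \<rho>)"
        using norm_trig_le_cosh(2)[of "of_real (2 * d - pi) * \<rho>"] by simp
      ultimately show "(bp - \<bar>bm\<bar>) / 4 * exp (pi * \<bar>Im \<rho>\<bar>) \<le>
        norm (jump_cos \<beta> d \<rho>)"
        unfolding jump_cos_def jump_trig_identities(1)[OF \<beta>0] ab bp_def[symmetric] bm_def[symmetric] by (rule low)
    next
      fix \<rho> :: complex and n :: nat assume r: "R0 \<le> norm \<rho>"
    assume n: "norm \<rho> = real n + 1 / 2"
      have "cos (pi * norm \<rho>) = 0" unfolding n by (simp add: distrib_left cos_add mult.commute[of pi])
      then have "norm (sin (of_real pi * \<rho>)) \<ge> \<kappa> * cosh (pi * Im \<rho>)" using R0[OF r] by blast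
      moreover have "norm (sin (- (of_real (2 * d - pi) * \<rho>))) \<le> cosh ((2 * d - pi) * Im \<rho>)"
        using norm_trig_le_cosh(1)[of "of_real (2 * d - pi) * \<rho>"] by simp
      ultimately show "(bp - \<bar>bm\<bar>) / 4 * exp (pi * \<bar>Im \<rho>\<bar>) \<le>
        norm (jump_sin \<beta> d \<rho>)"
        unfolding jump_sin_def jump_trig_identities(2)[OF \<beta>0] ab bp_def[symmetric] bm_def[symmetric] by (rule low)
  qed
  moreover have "0 < (bp - \<bar>bm\<bar>) / 4" using bm by simp
  ultimately show ?thesis by blast
qed

text \<open>Comparison with cos (\<rho> x), the solution for q = 0 with data (1,0) at 0; both q and
  h are absorbed in the error constant \<open>k\<close>.\<close>

definition cosine_like :: "real \<Rightarrow> complex \<Rightarrow> real \<Rightarrow> (real \<Rightarrow> complex) \<Rightarrow> (real \<Rightarrow> complex) \<Rightarrow> bool" where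
  "cosine_like k \<rho> c y dy \<longleftrightarrow> (\<forall>x\<in>{0..c}.
     norm (y x - cos (\<rho> * of_real x)) \<le> k * exp (\<bar>Im \<rho>\<bar> * x) / norm \<rho> \<and>
     norm (dy x - (- \<rho> * sin (\<rho> * of_real x))) \<le> k * exp (\<bar>Im \<rho>\<bar> * x) \<and>
     norm (y x) \<le> (1 + k) * exp (\<bar>Im \<rho>\<bar> * x))"

lemma cosine_likeD:
  assumes "cosine_like k \<rho> c y dy" "x \<in> {0..c}"
  shows "norm (y x - cos (\<rho> * of_real x)) \<le> k * exp (\<bar>Im \<rho>\<bar> * x) / norm \<rho>"
    "norm (dy x - (- \<rho> * sin (\<rho> * of_real x))) \<le> k * exp (\<bar>Im \<rho>\<bar> * x)"
    "norm (y x) \<le> (1 + k) * exp (\<bar>Im \<rho>\<bar> * x)"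
  using assms unfolding cosine_like_def by blast+

lemma regular_solution_asymptotics:
  fixes q :: "real \<Rightarrow> complex" and h :: complex
  assumes q: "q absolutely_integrable_on {0..c}"
  obtains k where "k \<ge> 0" "\<And>\<rho> y dy. k \<le> norm \<rho> \<Longrightarrow> 1 \<le> norm \<rho> \<Longrightarrow> ode_sol q (\<rho>\<^sup>2) 0 c y dy \<Longrightarrow>
      y 0 = 1 \<Longrightarrow> dy 0 = h \<Longrightarrow> cosine_like k \<rho> c y dy"
proof -
  define Q where "Q = integral {0..c} (\<lambda>t. norm (q t))"
  have Q0: "Q \<ge> 0" unfolding Q_def using q by (intro integral_nonneg) (auto simp: absolutely_integrable_on_def)
  \<comment> \<open>The constant of \<open>ode_sol_asymptotics_perturbed\<close> with leading data 1
    and 0, E = m = 1 and perturbation \<open>norm h\<close> of the derivative.\<close>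
  define k where "k = 2 * norm h + 4 * Q * (1 + norm h)"
  have kQ: "2 * Q \<le> k" "k \<ge> 0" using Q0 mult_nonneg_nonneg[OF Q0 norm_ge_zero[of h]] unfolding k_def by (auto simp: distrib_left)
  show ?thesis
  proof (rule that[OF kQ(2)])
    fix \<rho> y dy assume r: "k \<le> norm \<rho>" "1 \<le> norm \<rho>" and s: "ode_sol q (\<rho>\<^sup>2) 0 c y dy" "y 0 = 1" "dy 0 = h"
    have r2: "\<rho> \<noteq> 0" "2 * integral {0..c} (\<lambda>t. norm (q t)) \<le> norm \<rho>" using r kQ unfolding Q_def by auto
    show "cosine_like k \<rho> c y dy"
      unfolding cosine_like_def
    proof (intro ballI conjI)
      fix x assume x: "x \<in> {0..c}"
      show e: "norm (y x - cos (\<rho> * of_real x)) \<le> k * exp (\<bar>Im \<rho>\<bar> * x) / norm \<rho>"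
        "norm (dy x - (- \<rho> * sin (\<rho> * of_real x))) \<le> k * exp (\<bar>Im \<rho>\<bar> * x)"
        using ode_sol_asymptotics_perturbed[OF q s(1) x r2, of 1 "norm h" 1 0 1] s(2,3) r unfolding Q_def[symmetric] k_def by auto
      have "norm (y x) \<le> norm (cos (\<rho> * of_real x)) + norm (y x - cos (\<rho> * of_real x))"
        by (metis norm_triangle_sub)
      moreover have "norm (cos (\<rho> * of_real x)) \<le> exp (\<bar>Im \<rho>\<bar> * x)"
        using norm_cos_le_exp_Im[of "\<rho> * of_real x"] x by (simp add: abs_mult)
      moreover have "k * exp (\<bar>Im \<rho>\<bar> * x) / norm \<rho> \<le> k * exp (\<bar>Im \<rho>\<bar> * x) / 1"
        using kQ r by (intro divide_left_mono) auto
      ultimately show "norm (y x) \<le> (1 + k) * exp (\<bar>Im \<rho>\<bar> * x)" using e(1) by (simp add: distrib_right)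
    qed
  qed
qed

text \<open>The estimate on [0,d] is carried through the jump and fed into the perturbed estimate on
  [d,\<pi>]. The term \<gamma> y is smaller by the factor 1 / |\<rho>| than the leading derivative,
  so \<gamma> affects only the error.\<close>

lemma jump_solution_asymptotics:
  fixes q :: "real \<Rightarrow> complex" and h \<gamma> :: complex and \<beta> d :: real
  assumes q: "q absolutely_integrable_on {0..pi}" and d: "0 < d" "d < pi" and \<beta>: "\<beta> > 0"
  obtains k R0 where "k \<ge> 0" "R0 \<ge> 1" "\<And>\<rho> y dy z dz. R0 \<le> norm \<rho> \<Longrightarrow> ode_sol q (\<rho>\<^sup>2) 0 d y dy \<Longrightarrow> y 0 = 1 \<Longrightarrow> dy 0 = h \<Longrightarrow>
      ode_sol q (\<rho>\<^sup>2) d pi z dz \<Longrightarrow> z d = of_real \<beta> * y d \<Longrightarrow> dz d = inverse (of_real \<beta>) * dy d + \<gamma> * y d \<Longrightarrow>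
      norm (z pi - jump_cos \<beta> d \<rho>)
        \<le> k * exp (pi * \<bar>Im \<rho>\<bar>) / norm \<rho> \<and>
      norm (dz pi - (- \<rho> * jump_sin \<beta> d \<rho>))
        \<le> k * exp (pi * \<bar>Im \<rho>\<bar>)"
proof -
  have q1: "q absolutely_integrable_on {0..d}" "q absolutely_integrable_on {d..pi}"
    using d by (auto intro: absolutely_integrable_on_subinterval[OF q])
  obtain k1 where k1: "k1 \<ge> 0" "\<And>\<rho> y dy. k1 \<le> norm \<rho> \<Longrightarrow> 1 \<le> norm \<rho> \<Longrightarrow> ode_sol q (\<rho>\<^sup>2) 0 d y dy \<Longrightarrow>
      y 0 = 1 \<Longrightarrow> dy 0 = h \<Longrightarrow> cosine_like k1 \<rho> d y dy"
    using regular_solution_asymptotics[OF q1(1), of h] by metis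
  define Q where "Q = integral {d..pi} (\<lambda>t. norm (q t))"
  have Q0: "Q \<ge> 0" unfolding Q_def using q1 by (intro integral_nonneg) (auto simp: absolutely_integrable_on_def)
  \<comment> \<open>A common bound for both jump factors \<beta> and 1 / \<beta>; \<open>k2\<close>
    bounds the error of the data just after the jump, with the contribution of \<gamma>.\<close>
  define m where "m = \<beta> + inverse \<beta>"
  define k2 where "k2 = m * k1 + norm \<gamma> * (1 + k1)"
  have m0: "m > 0" "\<beta> \<le> m" "inverse \<beta> \<le> m" using \<beta> by (auto simp: m_def add_pos_pos)
  have k20: "k2 \<ge> 0" using m0 k1(1) by (simp add: k2_def)
  let ?k = "2 * k2 + 4 * Q * (m + k2)" and ?R = "max (max k1 1) (2 * Q)"
  show ?thesis
  proof (rule that[of ?k ?R])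
    show "?k \<ge> 0" using k20 Q0 m0 by simp
    show "?R \<ge> 1" by simp
    fix \<rho> y dy z dz
    assume r: "?R \<le> norm \<rho>" and y: "ode_sol q (\<rho>\<^sup>2) 0 d y dy" "y 0 = 1" "dy 0 = h"
      and z: "ode_sol q (\<rho>\<^sup>2) d pi z dz" and j: "z d = of_real \<beta> * y d" "dz d = inverse (of_real \<beta>) * dy d + \<gamma> * y d"
    define E where "E = exp (\<bar>Im \<rho>\<bar> * d)"
    have E: "E > 0" by (simp add: E_def)
    have r1: "k1 \<le> norm \<rho>" "1 \<le> norm \<rho>" "2 * Q \<le> norm \<rho>" using r by auto
    hence r0: "\<rho> \<noteq> 0" by auto
    have Y: "norm (y d - cos (\<rho> * of_real d)) \<le> k1 * E / norm \<rho>" "norm (dy d - (- \<rho> * sin (\<rho> * of_real d))) \<le> k1 * E"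
       "norm (y d) \<le> (1 + k1) * E"
      using cosine_likeD[OF k1(2)[OF r1(1,2) y], of d] d unfolding E_def by auto
    have t: "norm (cos (\<rho> * of_real d)) \<le> E" "norm (sin (\<rho> * of_real d)) \<le> E"
      using norm_cos_le_exp_Im[of "\<rho> * of_real d"] norm_sin_le_exp_Im[of "\<rho> * of_real d"] d by (auto simp: abs_mult E_def)
    let ?c0 = "of_real \<beta> * cos (\<rho> * of_real d)" and ?c1 = "inverse (of_real \<beta>) * (- \<rho> * sin (\<rho> * of_real d))"
    have i1: "norm (z d - ?c0) \<le> k2 * E / norm \<rho>"
    proof -
      have "norm (z d - ?c0) = \<beta> * norm (y d - cos (\<rho> * of_real d))"
        unfolding j right_diff_distrib[symmetric] using \<beta> by (simp add: norm_mult)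
      also have "\<dots> \<le> m * (k1 * E / norm \<rho>)" using Y(1) m0 \<beta> by (intro mult_mono) auto
      also have "\<dots> = (m * k1) * E / norm \<rho>" by simp
      also have "\<dots> \<le> k2 * E / norm \<rho>"
        using k1(1) E by (intro divide_right_mono mult_right_mono) (auto simp: k2_def)
      finally show ?thesis .
    qed
    have i2: "norm (dz d - ?c1) \<le> k2 * E"
    proof -
      have "norm (dz d - ?c1) = norm (inverse (of_real \<beta>) * (dy d - (- \<rho> * sin (\<rho> * of_real d))) + \<gamma> * y d)"
        unfolding j by (simp add: algebra_simps)
      also have "\<dots> \<le> inverse \<beta> * norm (dy d - (- \<rho> * sin (\<rho> * of_real d))) + norm \<gamma> * norm (y d)"
        by (rule norm_triangle_le) (use \<beta> in \<open>simp add: norm_mult norm_inverse\<close>)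
      also have "\<dots> \<le> m * (k1 * E) + norm \<gamma> * ((1 + k1) * E)"
        using Y m0 \<beta> by (intro add_mono mult_mono) auto
      also have "\<dots> = k2 * E" by (simp add: k2_def algebra_simps)
      finally show ?thesis .
    qed
    have l1: "norm ?c0 \<le> m * E" using t(1) m0 \<beta> by (simp add: norm_mult mult_mono)
    have l2: "norm ?c1 \<le> m * norm \<rho> * E"
    proof -
      have "norm ?c1 = inverse \<beta> * (norm \<rho> * norm (sin (\<rho> * of_real d)))" using \<beta> by (simp add: norm_mult norm_inverse)
      also have "\<dots> \<le> m * (norm \<rho> * E)" using t(2) m0 \<beta> by (intro mult_mono) auto
      finally show ?thesis by simp
    qed
    have EE: "E * exp (\<bar>Im \<rho>\<bar> * (pi - d)) = exp (pi * \<bar>Im \<rho>\<bar>)"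
      unfolding E_def by (simp add: exp_add[symmetric] algebra_simps)
    have e1: "?c0 * cos (\<rho> * of_real (pi - d)) + ?c1 * sin (\<rho> * of_real (pi - d)) / \<rho> = jump_cos \<beta> d \<rho>"
      using r0 unfolding jump_cos_def by (simp add: field_simps del: of_real_diff)
    have e2: "- \<rho> * ?c0 * sin (\<rho> * of_real (pi - d)) + ?c1 * cos (\<rho> * of_real (pi - d)) =
       - \<rho> * jump_sin \<beta> d \<rho>"
      unfolding jump_sin_def by (simp add: algebra_simps del: of_real_diff)
    have pid: "pi \<in> {d..pi}" using d by auto
    note A = ode_sol_asymptotics_perturbed[OF q1(2) z pid r0 r1(3)[unfolded Q_def] i1 i2 l1 l2 r1(2), unfolded e1 e2 EE, folded Q_def]
    show "norm (z pi - jump_cos \<beta> d \<rho>)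
        \<le> ?k * exp (pi * \<bar>Im \<rho>\<bar>) / norm \<rho> \<and>
      norm (dz pi - (- \<rho> * jump_sin \<beta> d \<rho>))
        \<le> ?k * exp (pi * \<bar>Im \<rho>\<bar>)"
      using A by blast
  qed
qed

section \<open>Integrated counting of eigenvalues\<close>

text \<open>\<open>p\<close> is the power of \<rho> in front of the leading term, 1 for
  \<open>Delta\<close> and 0 for \<open>Delta_inf\<close>, and is the source of the logarithm. The
  error is smaller than the leading term by 1 / |\<rho>|; once |\<rho>| is at least 2 K / c, half of
  the lower bound survives.\<close>

lemma eigenvalue_log_sum_asymptotics:
  fixes f M :: "complex \<Rightarrow> complex" and K m c s R0 :: real and p :: nat
  assumes f: "f holomorphic_on UNIV" and c: "c > 0" and s: "0 \<le> s" "s < 1" and K: "K \<ge> 0"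
    and close: "\<And>\<rho>. R0 \<le> norm \<rho> \<Longrightarrow> \<bar>norm (f (\<rho>\<^sup>2)) - norm \<rho> ^ p * norm (M \<rho>)\<bar> \<le> K * norm \<rho> ^ p / norm \<rho> * exp (pi * \<bar>Im \<rho>\<bar>)"
    and up: "\<And>\<rho>. norm (M \<rho>) \<le> m * exp (pi * \<bar>Im \<rho>\<bar>)"
    and low: "\<And>\<rho> n. R0 \<le> norm \<rho> \<Longrightarrow> norm \<rho> = real n + s \<Longrightarrow> c * exp (pi * \<bar>Im \<rho>\<bar>) \<le> norm (M \<rho>)"
  shows "\<exists>w. f w \<noteq> 0"
    and "eigenvalue_sequence f x \<Longrightarrow> \<exists>r0 C. \<forall>r\<ge>r0. \<bar>log_counting_sum UNIV x r - 2 * sqrt r - real p / 2 * ln r\<bar> \<le> C"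
proof -
  define R1 where "R1 = max (max R0 2) (2 * K / c)"
  have R1: "R1 > 1" by (simp add: R1_def)
  have U: "norm (f (\<rho>\<^sup>2)) \<le> (m + K) * norm \<rho> powr real p * exp (pi * \<bar>Im \<rho>\<bar>)" if r: "R1 \<le> norm \<rho>" for \<rho>
  proof -
    let ?e = "exp (pi * \<bar>Im \<rho>\<bar>)"
    have rr: "norm \<rho> > 1" "R0 \<le> norm \<rho>" using r by (auto simp: R1_def)
    have "norm (f (\<rho>\<^sup>2)) \<le> norm \<rho> ^ p * norm (M \<rho>) + K * norm \<rho> ^ p / norm \<rho> * ?e"
      using close[OF rr(2)] by linarith
    also have "norm \<rho> ^ p * norm (M \<rho>) \<le> norm \<rho> ^ p * (m * ?e)"
      using up[of \<rho>] by (intro mult_left_mono) auto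
    also have "K * norm \<rho> ^ p / norm \<rho> * ?e \<le> K * norm \<rho> ^ p / 1 * ?e"
      using rr K by (intro mult_right_mono divide_left_mono) auto
    finally show ?thesis using powr_realpow[of "norm \<rho>" p] rr by (simp add: algebra_simps del: zero_less_norm_iff)
  qed
  have L: "c / 2 * norm \<rho> powr real p * exp (pi * \<bar>Im \<rho>\<bar>) \<le> norm (f (\<rho>\<^sup>2))"
    if r: "R1 \<le> norm \<rho>" and n: "norm \<rho> = real n + s" for \<rho> n
  proof -
    let ?e = "exp (pi * \<bar>Im \<rho>\<bar>)"
    have rr: "norm \<rho> > 1" "R0 \<le> norm \<rho>" "2 * K / c \<le> norm \<rho>" using r by (auto simp: R1_def)
    have "2 * K \<le> norm \<rho> * c" using rr(3) c by (simp add: pos_divide_le_eq)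
    hence "K / norm \<rho> \<le> c / 2" using rr(1) by (subst pos_divide_le_eq) (auto simp: mult.commute)
    hence "K / norm \<rho> * (norm \<rho> ^ p * ?e) \<le> c / 2 * (norm \<rho> ^ p * ?e)" by (intro mult_right_mono) auto
    moreover have "norm \<rho> ^ p * (c * ?e) \<le> norm \<rho> ^ p * norm (M \<rho>)"
      using low[OF rr(2) n] by (intro mult_left_mono) auto
    moreover have "norm \<rho> ^ p * norm (M \<rho>) - K * norm \<rho> ^ p / norm \<rho> * ?e \<le> norm (f (\<rho>\<^sup>2))"
      using close[OF rr(2)] by linarith
    ultimately have "c / 2 * (norm \<rho> ^ p * ?e) \<le> norm (f (\<rho>\<^sup>2))" by (simp add: mult_ac)
    then show ?thesis using powr_realpow[of "norm \<rho>" p] rr by (simp add: mult.assoc del: zero_less_norm_iff)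
  qed
  obtain n :: nat where n: "R1 - s \<le> real n" using real_arch_simple by blast
  show nz: "\<exists>w. f w \<noteq> 0"
  proof -
    let ?r = "of_real (real n + s) :: complex"
    have nr: "norm ?r = real n + s" using n R1 by (simp add: norm_of_real del: of_real_add)
    have "0 < c / 2 * norm ?r powr real p * exp (pi * \<bar>Im ?r\<bar>)" using c n R1 nr by (auto intro!: mult_pos_pos)
    also have "\<dots> \<le> norm (f (?r\<^sup>2))" using L[of ?r n] n nr by simp
    finally show ?thesis by auto
  qed
  assume x: "eigenvalue_sequence f x"
  obtain w where w: "f w \<noteq> 0" using nz by blast
  note P = eigenvalue_sequence_props[OF x f w]
  have c2: "c / 2 > 0" using c by simp
  obtain C where C: "\<And>n. R1 \<le> real n + s \<Longrightarrow> \<bar>log_zero_sum f ((real n + s)\<^sup>2) - 2 * (real n + s) - real p * ln (real n + s)\<bar> \<le> C"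
    using log_zero_sum_asymptotics_on_circles[OF f c2 R1, of "m + K" "real p" s] U L by metis
  show "\<exists>r0 C. \<forall>r\<ge>r0. \<bar>log_counting_sum UNIV x r - 2 * sqrt r - real p / 2 * ln r\<bar> \<le> C"
    by (rule log_sum_asymptotics_from_circles[OF _ s])
       (use C P(3) log_counting_sum_mono[of UNIV x] P(2) in auto)
qed

text \<open>The hypothesis is divided by t and integrated. The constant A/2 turns into (A/2) ln r,
  which cancels the logarithm in the asymptotics of \<open>s1\<close>. The signs of A and b/\<pi> -
  A are arbitrary, so the asymptotics of both spectra are used in two-sided form.\<close>

lemma log_counting_sum_lower_bound:
  fixes A b :: real
  assumes fin: "\<And>r. finite {n \<in> D1. norm (x1 n) < r}" "\<And>r. finite {n \<in> D2. norm (x2 n) < r}"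
      "\<And>r. finite {n. norm (s1 n) < r}" "\<And>r. finite {n. norm (s2 n) < r}"
    and a1: "\<exists>r0 C. \<forall>r\<ge>r0. \<bar>log_counting_sum UNIV s1 r - 2 * sqrt r - real 1 / 2 * ln r\<bar> \<le> C"
    and a2: "\<exists>r0 C. \<forall>r\<ge>r0. \<bar>log_counting_sum UNIV s2 r - 2 * sqrt r - real 0 / 2 * ln r\<bar> \<le> C"
    and ev: "\<forall>\<^sub>F t in at_top. real (counting D1 x1 t) + real (counting D2 x2 t)
             \<ge> A * real (counting UNIV s1 t) + (b / pi - A) * real (counting UNIV s2 t) - A / 2"
  shows "\<exists>r0 C. \<forall>r\<ge>r0. 2 * b / pi * sqrt r - C \<le> log_counting_sum D1 x1 r + log_counting_sum D2 x2 r"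
proof -
  obtain t0 where t0: "\<And>t. t0 \<le> t \<Longrightarrow> real (counting D1 x1 t) + real (counting D2 x2 t)
             \<ge> A * real (counting UNIV s1 t) + (b / pi - A) * real (counting UNIV s2 t) - A / 2"
    using ev unfolding eventually_at_top_linorder by blast
  obtain r1 C1 where a1: "\<And>r. r1 \<le> r \<Longrightarrow> \<bar>log_counting_sum UNIV s1 r - 2 * sqrt r - ln r / 2\<bar> \<le> C1"
    using a1 by auto
  obtain r2 C2 where a2: "\<And>r. r2 \<le> r \<Longrightarrow> \<bar>log_counting_sum UNIV s2 r - 2 * sqrt r\<bar> \<le> C2"
    using a2 by auto
  \<comment> \<open>The inequality is known only from \<open>t0\<close> on, and the integrals start
    at 1. What happens below \<open>T\<close> goes into the constant.\<close>
  define T where "T = max t0 1"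
  have T: "1 \<le> T" "t0 \<le> T" by (auto simp: T_def)
  have I: "((\<lambda>t. real (counting D x t) / t) has_integral (log_counting_sum D x r - log_counting_sum D x T)) {T..r}"
    if "\<And>r. finite {n \<in> D. norm (x n) < r}" "T \<le> r" for D :: "nat set" and x r
    by (rule has_integral_increment[OF counting_over_t_has_integral counting_over_t_has_integral])
       (use that T in auto)
  have nonneg: "0 \<le> log_counting_sum D x T" for D x
    unfolding log_counting_sum_def using T by (intro sum_nonneg ln_ge_zero) (auto simp: le_divide_eq max_def)
  have step: "((\<lambda>t. (if 0 < t then 1 else 0) / t) has_integral (ln r - ln T)) {T..r}" if "T \<le> r" for r
    using has_integral_increment[OF has_integral_step_over_t[of T 0] has_integral_step_over_t[of r 0] T(1) that] T that
    by simp
  define B1 where "B1 = log_counting_sum UNIV s1 T"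
  define B2 where "B2 = log_counting_sum UNIV s2 T"
  show ?thesis
  proof (rule exI[of _ "max T (max r1 r2)"],
      rule exI[of _ "\<bar>A\<bar> * C1 + \<bar>b / pi - A\<bar> * C2 + A * B1 + (b / pi - A) * B2 - A / 2 * ln T"], intro allI impI)
    fix r assume "max T (max r1 r2) \<le> r"
    hence r: "T \<le> r" "r1 \<le> r" "r2 \<le> r" by auto
    define L1 where "L1 = log_counting_sum UNIV s1 r"
    define L2 where "L2 = log_counting_sum UNIV s2 r"
    have lhs: "((\<lambda>t. A * (real (counting UNIV s1 t) / t) + (b / pi - A) * (real (counting UNIV s2 t) / t) - A / 2 * ((if 0 < t then 1 else 0) / t))
       has_integral (A * (L1 - B1) + (b / pi - A) * (L2 - B2) - A / 2 * (ln r - ln T))) {T..r}"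
      unfolding L1_def L2_def B1_def B2_def
      by (intro has_integral_diff has_integral_add has_integral_mult_right I step) (use fin r in auto)
    have rhs: "((\<lambda>t. real (counting D1 x1 t) / t + real (counting D2 x2 t) / t) has_integral
       (log_counting_sum D1 x1 r - log_counting_sum D1 x1 T + (log_counting_sum D2 x2 r - log_counting_sum D2 x2 T))) {T..r}"
      by (intro has_integral_add I) (use fin r in auto)
    have "A * (L1 - B1) + (b / pi - A) * (L2 - B2) - A / 2 * (ln r - ln T) \<le>
      log_counting_sum D1 x1 r - log_counting_sum D1 x1 T + (log_counting_sum D2 x2 r - log_counting_sum D2 x2 T)"
    proof (rule has_integral_le[OF lhs rhs])
      fix t assume "t \<in> {T..r}"
      hence t: "t > 0" "t0 \<le> t" using T by auto
      have "(A * real (counting UNIV s1 t) + (b / pi - A) * real (counting UNIV s2 t) - A / 2) / t \<le>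
         (real (counting D1 x1 t) + real (counting D2 x2 t)) / t"
        using t0[OF t(2)] t(1) by (intro divide_right_mono) auto
      then show "A * (real (counting UNIV s1 t) / t) + (b / pi - A) * (real (counting UNIV s2 t) / t) - A / 2 * ((if 0 < t then 1 else 0) / t)
         \<le> real (counting D1 x1 t) / t + real (counting D2 x2 t) / t"
        using t(1) by (simp add: add_divide_distrib diff_divide_distrib)
    qed
    moreover have "0 \<le> log_counting_sum D1 x1 T" "0 \<le> log_counting_sum D2 x2 T" by (rule nonneg)+
    moreover have "A * (2 * sqrt r + ln r / 2) - \<bar>A\<bar> * C1 \<le> A * L1"
    proof -
      have "\<bar>A * (L1 - (2 * sqrt r + ln r / 2))\<bar> \<le> \<bar>A\<bar> * C1"
        unfolding abs_mult using a1[OF r(2)] unfolding L1_def by (intro mult_left_mono) (auto simp: algebra_simps)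
      then show ?thesis by (simp add: right_diff_distrib abs_le_iff)
    qed
    moreover have "(b / pi - A) * (2 * sqrt r) - \<bar>b / pi - A\<bar> * C2 \<le> (b / pi - A) * L2"
    proof -
      have "\<bar>(b / pi - A) * (L2 - 2 * sqrt r)\<bar> \<le> \<bar>b / pi - A\<bar> * C2"
        unfolding abs_mult using a2[OF r(3)] unfolding L2_def by (intro mult_left_mono) auto
      then show ?thesis by (simp add: right_diff_distrib abs_le_iff)
    qed
    moreover have "A * (2 * sqrt r + ln r / 2) + (b / pi - A) * (2 * sqrt r) - A / 2 * ln r = 2 * b / pi * sqrt r"
      by (simp add: algebra_simps)
    ultimately show "2 * b / pi * sqrt r - (\<bar>A\<bar> * C1 + \<bar>b / pi - A\<bar> * C2 + A * B1 + (b / pi - A) * B2 - A / 2 * ln T)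
       \<le> log_counting_sum D1 x1 r + log_counting_sum D2 x2 r"
      by (simp add: right_diff_distrib)
  qed
qed

lemma log_zero_sum_ge_subsequences:
  assumes F: "F holomorphic_on UNIV" and nz: "F w \<noteq> 0" and r: "1 \<le> r"
    and fin: "finite {n \<in> D1. norm (x1 n) < r}" "finite {n \<in> D2. norm (x2 n) < r}"
    and fin': "\<And>z. finite {n \<in> D1. x1 n = z}" "\<And>z. finite {n \<in> D2. x2 n = z}"
    and occ: "\<And>z. occurrences D1 x1 z + occurrences D2 x2 z \<le> alg_mult F z"
  shows "log_counting_sum D1 x1 r + log_counting_sum D2 x2 r \<le> log_zero_sum F r"
proof -
  let ?T = "{z. F z = 0 \<and> norm z < r}"
  have T: "finite ?T" by (rule finite_zeros_ball[OF F nz])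
  have zero: "F z = 0" if "alg_mult F z \<noteq> 0" for z using that by (auto simp: alg_mult_def split: if_splits)
  have in1: "x1 ` {n \<in> D1. norm (x1 n) < r} \<subseteq> ?T"
  proof (rule image_subsetI)
    fix n assume "n \<in> {n \<in> D1. norm (x1 n) < r}"
    hence n: "n \<in> D1" "norm (x1 n) < r" by auto
    have "occurrences D1 x1 (x1 n) \<noteq> 0" unfolding occurrences_def using fin'(1)[of "x1 n"] n by auto
    hence "alg_mult F (x1 n) \<noteq> 0" using occ[of "x1 n"] by simp
    then show "x1 n \<in> ?T" using zero n by blast
  qed
  have in2: "x2 ` {n \<in> D2. norm (x2 n) < r} \<subseteq> ?T"
  proof (rule image_subsetI)
    fix n assume "n \<in> {n \<in> D2. norm (x2 n) < r}"
    hence n: "n \<in> D2" "norm (x2 n) < r" by auto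
    have "occurrences D2 x2 (x2 n) \<noteq> 0" unfolding occurrences_def using fin'(2)[of "x2 n"] n by auto
    hence "alg_mult F (x2 n) \<noteq> 0" using occ[of "x2 n"] by simp
    then show "x2 n \<in> ?T" using zero n by blast
  qed
  have "log_counting_sum D1 x1 r + log_counting_sum D2 x2 r =
     (\<Sum>z\<in>?T. real (occurrences D1 x1 z) * ln (r / max 1 (norm z)) + real (occurrences D2 x2 z) * ln (r / max 1 (norm z)))"
    using log_counting_sum_by_value[OF fin(1) T in1] log_counting_sum_by_value[OF fin(2) T in2]
    by (simp add: sum.distrib)
  also have "\<dots> \<le> log_zero_sum F r"
    unfolding log_zero_sum_def
  proof (rule sum_mono)
    fix z assume "z \<in> ?T"
    hence "0 \<le> ln (r / max 1 (norm z))" using r by (intro ln_ge_zero) (auto simp: le_divide_eq max_def)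
    moreover have "real (occurrences D1 x1 z) + real (occurrences D2 x2 z) \<le> real (alg_mult F z)" using occ[of z] by linarith
    ultimately have "(real (occurrences D1 x1 z) + real (occurrences D2 x2 z)) * ln (r / max 1 (norm z)) \<le> real (alg_mult F z) * ln (r / max 1 (norm z))"
      by (intro mult_right_mono)
    then show "real (occurrences D1 x1 z) * ln (r / max 1 (norm z)) + real (occurrences D2 x2 z) * ln (r / max 1 (norm z)) \<le> real (alg_mult F z) * ln (r / max 1 (norm z))"
      by (simp add: distrib_right)
  qed
  finally show ?thesis .
qed

subsection \<open>Borg-Marchenko uniqueness\<close>

text \<open>|cos z|^2 is at least sinh^2 (Im z), and |Im z| \<ge> 1 makes the exponential at least
  2, so the decaying part of sinh costs at most half.\<close>

lemma norm_cos_ge_exp_quarter: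
  fixes z :: complex
  assumes "1 \<le> \<bar>Im z\<bar>"
  shows "exp \<bar>Im z\<bar> / 4 \<le> norm (cos z)"
proof -
  let ?v = "\<bar>Im z\<bar>"
  have E: "2 \<le> exp ?v" using exp_ge_add_one_self[of ?v] assms by linarith
  have "exp (- ?v) \<le> 1 / 2" using E by (simp add: exp_minus field_simps)
  hence s: "exp ?v / 4 \<le> sinh ?v" using E by (simp add: sinh_field_def)
  have "(sinh ?v)\<^sup>2 = (cosh (Im z))\<^sup>2 - 1" by (metis cosh_real_abs sinh_square_eq)
  also have "\<dots> \<le> (norm (cos z))\<^sup>2"
    unfolding norm_cos_squared_cosh using abs_square_le_1[of "sin (Re z)"] by simp
  finally have "sinh ?v \<le> norm (cos z)" by (rule power2_le_imp_le) simp
  then show ?thesis using s by linarith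
qed

text \<open>Since the values at \<open>b\<close> agree, the Wronskian there is - Y(b) times the
  difference sought. It is also ht - h plus the integral of (qt - q) Y Yt, whose integrand grows
  like exp (2 \<tau> t): the part near \<open>b\<close> is small by integrability of qt - q, the
  rest is exponentially smaller. Dividing by Y(b), of size exp (\<tau> b), gives the claim.\<close>

lemma derivative_difference_small:
  fixes q qt :: "real \<Rightarrow> complex" and h ht :: complex
  assumes q: "q absolutely_integrable_on {0..b}" and qt: "qt absolutely_integrable_on {0..b}" and b: "0 < b"
    and y: "\<And>l. ode_sol q l 0 b (Y l) (dY l)" "\<And>l. Y l 0 = 1" "\<And>l. dY l 0 = h"
    and yt: "\<And>l. ode_sol qt l 0 b (Yt l) (dYt l)" "\<And>l. Yt l 0 = 1" "\<And>l. dYt l 0 = ht"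
    and eq: "\<And>l. Y l b = Yt l b" and e: "\<epsilon> > 0"
  shows "\<exists>R. \<forall>\<rho>. R \<le> norm \<rho> \<longrightarrow> norm \<rho> \<le> 2 * \<bar>Im \<rho>\<bar> \<longrightarrow> norm (dY (\<rho>\<^sup>2) b - dYt (\<rho>\<^sup>2) b) \<le> \<epsilon> * exp (b * \<bar>Im \<rho>\<bar>)"
proof -
  obtain k where k: "k \<ge> 0" "\<And>\<rho> y dy. k \<le> norm \<rho> \<Longrightarrow> 1 \<le> norm \<rho> \<Longrightarrow> ode_sol q (\<rho>\<^sup>2) 0 b y dy \<Longrightarrow>
      y 0 = 1 \<Longrightarrow> dy 0 = h \<Longrightarrow> cosine_like k \<rho> b y dy"
    using regular_solution_asymptotics[OF q, of h] by metis
  obtain kt where kt: "kt \<ge> 0" "\<And>\<rho> y dy. kt \<le> norm \<rho> \<Longrightarrow> 1 \<le> norm \<rho> \<Longrightarrow> ode_sol qt (\<rho>\<^sup>2) 0 b y dy \<Longrightarrow>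
      y 0 = 1 \<Longrightarrow> dy 0 = ht \<Longrightarrow> cosine_like kt \<rho> b y dy"
    using regular_solution_asymptotics[OF qt, of ht] by metis
  define K where "K = (1 + k) * (1 + kt)"
  have K: "K > 0" using k(1) kt(1) by (simp add: K_def add_pos_nonneg)
  define p where "p t = qt t - q t" for t
  have p: "p absolutely_integrable_on {0..b}" unfolding p_def using q qt by (intro set_integral_diff(1))
  hence pn: "(\<lambda>t. norm (p t)) integrable_on {0..b}" by (simp add: absolutely_integrable_on_def)
  define P where "P x = integral {0..x} (\<lambda>t. norm (p t))" for x
  have PI: "((\<lambda>t. norm (p t)) has_integral P x) {0..x}" if "x \<in> {0..b}" for x
    using integrable_on_subinterval[OF pn, of 0 x] that unfolding P_def by auto
  have Pcont: "continuous_on {0..b} P" unfolding P_def by (rule indefinite_integral_continuous_1[OF pn])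
  have bb: "b \<in> {0..b}" using b by simp
  have Pb: "P b \<ge> 0" by (rule has_integral_nonneg[OF PI[OF bb]]) simp
  \<comment> \<open>Of the 16, a factor 8 compensates the lower bound exp (\<tau> b) / 8 for |Y(b)|,
    and a factor 2 splits \<epsilon> between the parts left and right of \<open>x0\<close>.\<close>
  define \<epsilon>' where "\<epsilon>' = \<epsilon> / (16 * K)"
  have e': "\<epsilon>' > 0" using e K by (simp add: \<epsilon>'_def)
  obtain \<eta> where eta: "\<eta> > 0" "\<And>x. x \<in> {0..b} \<Longrightarrow> dist x b < \<eta> \<Longrightarrow> dist (P x) (P b) < \<epsilon>'"
    using Pcont bb e' unfolding continuous_on_iff by metis
  define \<delta> where "\<delta> = min \<eta> b / 2"
  have d: "0 < \<delta>" "\<delta> < b" "\<delta> < \<eta>" using eta(1) b by (auto simp: \<delta>_def min_def)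
  define x0 where "x0 = b - \<delta>"
  have x0: "x0 \<in> {0..b}" "0 \<le> x0" "x0 \<le> b" using d by (auto simp: x0_def)
  have tail: "P b - P x0 \<le> \<epsilon>'" using eta(2)[OF x0(1)] d by (simp add: x0_def dist_real_def)
  have P0: "P x0 \<le> P b"
    by (rule has_integral_subset_le[OF _ PI[OF x0(1)] PI[OF bb]]) (use x0 in auto)
  have P00: "0 \<le> P x0" by (rule has_integral_nonneg[OF PI[OF x0(1)]]) simp
  define M where "M = norm (ht - h) + K * P b"
  have M: "M \<ge> 0" using K Pb by (simp add: M_def)
  \<comment> \<open>The first entry makes \<tau> b \<ge> 1 for the lower bound on the cosine; the
    second makes M exp (- 2 \<tau> \<delta>) at most \<epsilon> / 16, using exp (- x) \<le> 1 /
    x.\<close>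
  define T where "T = max (1 / b) (8 * M / (\<delta> * \<epsilon>) + 1)"
  show ?thesis
  \<comment> \<open>In the region considered, |\<rho>| \<ge> 2 T gives \<tau> \<ge> T. The entry 8 k
    keeps the error of Y(b) below exp (\<tau> b) / 8, half of the lower bound for the
    cosine.\<close>
  proof (rule exI[of _ "max (max (2 * T) (8 * k)) (max (max k kt) 1)"], intro allI impI)
    fix \<rho> :: complex
    assume r: "max (max (2 * T) (8 * k)) (max (max k kt) 1) \<le> norm \<rho>" and im: "norm \<rho> \<le> 2 * \<bar>Im \<rho>\<bar>"
    let ?\<tau> = "\<bar>Im \<rho>\<bar>" and ?l = "\<rho>\<^sup>2"
    have rr: "k \<le> norm \<rho>" "kt \<le> norm \<rho>" "1 \<le> norm \<rho>" "8 * k \<le> norm \<rho>" "T \<le> ?\<tau>" using r im by auto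
    have tau: "1 / b \<le> ?\<tau>" "8 * M / (\<delta> * \<epsilon>) \<le> ?\<tau>" "0 < ?\<tau>" using rr(5) b unfolding T_def by (auto simp: less_le_trans[of 0 "1/b"])
    have Yb: "norm (Y ?l x) \<le> (1 + k) * exp (?\<tau> * x)" "norm (Yt ?l x) \<le> (1 + kt) * exp (?\<tau> * x)" if "x \<in> {0..b}" for x
      using cosine_likeD(3)[OF k(2)[OF rr(1,3) y] that] cosine_likeD(3)[OF kt(2)[OF rr(2,3) yt] that] .
    have prod: "norm (p t * (Y ?l t * Yt ?l t)) \<le> K * exp (2 * ?\<tau> * x) * norm (p t)" if t: "t \<in> {0..b}" "t \<le> x" for t x
    proof -
      have "norm (Y ?l t) * norm (Yt ?l t) \<le> ((1 + k) * exp (?\<tau> * t)) * ((1 + kt) * exp (?\<tau> * t))"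
        using Yb[OF t(1)] k(1) by (intro mult_mono) auto
      also have "\<dots> = K * exp (2 * ?\<tau> * t)"
      proof -
        have "exp (2 * ?\<tau> * t) = exp (?\<tau> * t) * exp (?\<tau> * t)" by (simp add: exp_add[symmetric])
        then show ?thesis unfolding K_def by simp
      qed
      also have "\<dots> \<le> K * exp (2 * ?\<tau> * x)" using K t(2) by (intro mult_left_mono) (auto intro!: mult_left_mono)
      finally have "norm (p t) * (norm (Y ?l t) * norm (Yt ?l t)) \<le> norm (p t) * (K * exp (2 * ?\<tau> * x))"
        by (intro mult_left_mono) auto
      then show ?thesis by (simp add: norm_mult mult_ac)
    qed
    define w where "w x = Y ?l x * dYt ?l x - dY ?l x * Yt ?l x" for x
    have wI: "((\<lambda>t. p t * (Y ?l t * Yt ?l t)) has_integral (w x - w 0)) {0..x}" if "x \<in> {0..b}" for x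
      using wronskian_has_integral[OF q qt y(1) yt(1) that, of ?l] unfolding p_def w_def .
    have w1: "norm (w x0 - w 0) \<le> K * exp (2 * ?\<tau> * x0) * P x0"
    proof -
      have "norm (integral {0..x0} (\<lambda>t. p t * (Y ?l t * Yt ?l t))) \<le> integral {0..x0} (\<lambda>t. K * exp (2 * ?\<tau> * x0) * norm (p t))"
        using wI[OF x0(1)] PI[OF x0(1)] x0
        by (intro integral_norm_bound_integral integrable_on_mult_right prod) auto
      then show ?thesis using integral_unique[OF wI[OF x0(1)]] by (simp add: P_def)
    qed
    have w2: "norm (w b - w x0) \<le> K * exp (2 * ?\<tau> * b) * (P b - P x0)"
    proof -
      have i: "((\<lambda>t. p t * (Y ?l t * Yt ?l t)) has_integral (w b - w x0)) {x0..b}"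
        using has_integral_increment[OF wI[OF x0(1)] wI[OF bb] x0(2,3)] by simp
      have j: "((\<lambda>t. norm (p t)) has_integral (P b - P x0)) {x0..b}"
        by (rule has_integral_increment[OF PI[OF x0(1)] PI[OF bb] x0(2,3)])
      have "norm (integral {x0..b} (\<lambda>t. p t * (Y ?l t * Yt ?l t))) \<le> integral {x0..b} (\<lambda>t. K * exp (2 * ?\<tau> * b) * norm (p t))"
        using i j x0 by (intro integral_norm_bound_integral integrable_on_mult_right prod) auto
      then show ?thesis using integral_unique[OF i] integral_unique[OF j] by simp
    qed
    have w0: "w 0 = ht - h" unfolding w_def using y(2,3) yt(2,3) by simp
    have wb: "w b = - Y ?l b * (dY ?l b - dYt ?l b)" unfolding w_def eq by (simp add: algebra_simps)
    have ex: "exp (2 * ?\<tau> * x0) = exp (2 * ?\<tau> * b) * exp (- 2 * ?\<tau> * \<delta>)"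
      unfolding x0_def by (simp add: exp_add[symmetric] algebra_simps)
    have small: "M * exp (- 2 * ?\<tau> * \<delta>) \<le> \<epsilon> / 16"
    proof -
      have "8 * M / (\<delta> * \<epsilon>) * (\<delta> * \<epsilon>) \<le> ?\<tau> * (\<delta> * \<epsilon>)" using tau(2) d e by (intro mult_right_mono) auto
      hence m: "8 * M \<le> ?\<tau> * (\<delta> * \<epsilon>)" using d e by simp
      have x: "2 * ?\<tau> * \<delta> > 0" using tau d by simp
      have "2 * ?\<tau> * \<delta> \<le> exp (2 * ?\<tau> * \<delta>)" using exp_ge_add_one_self[of "2 * ?\<tau> * \<delta>"] by linarith
      hence "exp (- 2 * ?\<tau> * \<delta>) \<le> 1 / (2 * ?\<tau> * \<delta>)" using x by (simp add: exp_minus field_simps)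
      hence "M * exp (- 2 * ?\<tau> * \<delta>) \<le> M * (1 / (2 * ?\<tau> * \<delta>))" using M by (rule mult_left_mono)
      also have "\<dots> \<le> \<epsilon> / 16" using m x by (simp add: field_simps)
      finally show ?thesis .
    qed
    have one: "1 \<le> exp (2 * ?\<tau> * x0)" using x0 tau by simp
    have "norm (w b) \<le> norm (w 0) + norm (w x0 - w 0) + norm (w b - w x0)"
      using norm_triangle_ineq[of "w 0" "w x0 - w 0"] norm_triangle_ineq[of "w x0" "w b - w x0"] by simp
    also have "\<dots> \<le> norm (ht - h) * exp (2 * ?\<tau> * x0) + K * exp (2 * ?\<tau> * x0) * P b + K * exp (2 * ?\<tau> * b) * \<epsilon>'"
    proof (intro add_mono)
      show "norm (w 0) \<le> norm (ht - h) * exp (2 * ?\<tau> * x0)"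
        using mult_left_mono[OF one, of "norm (ht - h)"] by (simp add: w0)
      show "norm (w x0 - w 0) \<le> K * exp (2 * ?\<tau> * x0) * P b"
        by (rule order_trans[OF w1]) (use K P0 in \<open>auto intro!: mult_left_mono\<close>)
      show "norm (w b - w x0) \<le> K * exp (2 * ?\<tau> * b) * \<epsilon>'"
        by (rule order_trans[OF w2]) (use K tail in \<open>auto intro!: mult_left_mono\<close>)
    qed
    also have "\<dots> = exp (2 * ?\<tau> * b) * (M * exp (- 2 * ?\<tau> * \<delta>)) + exp (2 * ?\<tau> * b) * (K * \<epsilon>')"
      unfolding ex M_def by (simp add: algebra_simps)
    also have "\<dots> \<le> exp (2 * ?\<tau> * b) * (\<epsilon> / 16) + exp (2 * ?\<tau> * b) * (\<epsilon> / 16)"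
      using small K e by (intro add_mono mult_left_mono) (auto simp: \<epsilon>'_def)
    also have "\<dots> = exp (?\<tau> * b) * (exp (?\<tau> * b) * (\<epsilon> / 8))"
    proof -
      have "exp (2 * ?\<tau> * b) = exp (?\<tau> * b) * exp (?\<tau> * b)" by (simp add: exp_add[symmetric])
      then show ?thesis by simp
    qed
    finally have wbound: "norm (w b) \<le> exp (?\<tau> * b) * (exp (?\<tau> * b) * (\<epsilon> / 8))" .
    have "1 \<le> ?\<tau> * b" using tau(1) b by (simp add: field_simps)
    hence "1 \<le> \<bar>Im (\<rho> * of_real b)\<bar>" using b by (simp add: abs_mult)
    hence "exp (?\<tau> * b) / 4 \<le> norm (cos (\<rho> * of_real b))"
      using norm_cos_ge_exp_quarter[of "\<rho> * of_real b"] b by (simp add: abs_mult)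
    moreover have "norm (Y ?l b - cos (\<rho> * of_real b)) \<le> k * exp (?\<tau> * b) / norm \<rho>"
      using cosine_likeD(1)[OF k(2)[OF rr(1,3) y] bb] .
    moreover have "k * exp (?\<tau> * b) / norm \<rho> \<le> exp (?\<tau> * b) / 8"
    proof -
      have "8 * (k * exp (?\<tau> * b)) \<le> norm \<rho> * exp (?\<tau> * b)" using mult_right_mono[OF rr(4), of "exp (?\<tau> * b)"] by simp
      moreover have "0 < norm \<rho>" using rr(3) by linarith
      ultimately show ?thesis by (subst pos_divide_le_eq) argo+
    qed
    moreover have "norm (cos (\<rho> * of_real b)) \<le> norm (Y ?l b) + norm (Y ?l b - cos (\<rho> * of_real b))"
      by (metis norm_minus_commute norm_triangle_sub)
    ultimately have "exp (?\<tau> * b) / 8 \<le> norm (Y ?l b)" by argo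
    hence "exp (?\<tau> * b) / 8 * norm (dY ?l b - dYt ?l b) \<le> norm (Y ?l b) * norm (dY ?l b - dYt ?l b)"
      by (intro mult_right_mono) auto
    also have "\<dots> = norm (w b)" unfolding wb by (simp add: norm_mult)
    finally have "exp (?\<tau> * b) / 8 * norm (dY ?l b - dYt ?l b) \<le> exp (?\<tau> * b) * (exp (?\<tau> * b) * (\<epsilon> / 8))"
      using wbound by linarith
    hence "exp (?\<tau> * b) * (norm (dY ?l b - dYt ?l b) / 8) \<le> exp (?\<tau> * b) * (exp (?\<tau> * b) * (\<epsilon> / 8))" by simp
    hence "norm (dY ?l b - dYt ?l b) / 8 \<le> exp (?\<tau> * b) * (\<epsilon> / 8)" by (simp only: mult_le_cancel_left_pos exp_gt_zero)
    then show "norm (dY ?l b - dYt ?l b) \<le> \<epsilon> * exp (b * ?\<tau>)" by (simp add: mult.commute)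
  qed
qed

text \<open>Data at \<open>b\<close> are imposed by applying the inverse transfer matrix to the
  solutions with data at 0; its determinant is 1, so dependence on \<open>l\<close> stays
  entire.\<close>

lemma backward_fundamental_solutions:
  assumes q: "q absolutely_integrable_on {0..b}" and b: "0 \<le> b"
  obtains \<omega> \<psi> d\<psi> where
    "\<And>l. ode_sol q l 0 b (\<psi> l) (d\<psi> l)" "\<And>l. \<psi> l b = 0" "\<And>l. d\<psi> l b = 1"
    "\<And>x. x \<in> {0..b} \<Longrightarrow> (\<lambda>l. \<omega> l x) holomorphic_on UNIV" "\<And>x. x \<in> {0..b} \<Longrightarrow> (\<lambda>l. \<psi> l x) holomorphic_on UNIV"
    "\<And>l y dy x. ode_sol q l 0 b y dy \<Longrightarrow> x \<in> {0..b} \<Longrightarrow> y x = y b * \<omega> l x + dy b * \<psi> l x"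
proof -
  have bb: "b \<in> {0..b}" using b by simp
  obtain C dC where C: "\<And>l. ode_sol q l 0 b (C l) (dC l)" "\<And>l. C l 0 = 1" "\<And>l. dC l 0 = 0"
    "\<And>x. x \<in> {0..b} \<Longrightarrow> (\<lambda>l. C l x) holomorphic_on UNIV" "\<And>x. x \<in> {0..b} \<Longrightarrow> (\<lambda>l. dC l x) holomorphic_on UNIV"
    using ode_sol_exists[OF q, of 1 0] b by fastforce
  obtain S dS where S: "\<And>l. ode_sol q l 0 b (S l) (dS l)" "\<And>l. S l 0 = 0" "\<And>l. dS l 0 = 1"
    "\<And>x. x \<in> {0..b} \<Longrightarrow> (\<lambda>l. S l x) holomorphic_on UNIV" "\<And>x. x \<in> {0..b} \<Longrightarrow> (\<lambda>l. dS l x) holomorphic_on UNIV"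
    using ode_sol_exists[OF q, of 0 1] b by fastforce
  have w: "C l b * dS l b - dC l b * S l b = 1" for l
    using wronskian_constant[OF q C(1) S(1) bb, of l] C(2,3) S(2,3) by simp
  define \<omega> \<psi> d\<psi> where "\<omega> l = (\<lambda>x. dS l b * C l x + (- dC l b) * S l x)"
    and "\<psi> l = (\<lambda>x. (- S l b) * C l x + C l b * S l x)"
    and "d\<psi> l = (\<lambda>x. (- S l b) * dC l x + C l b * dS l x)" for l
  show ?thesis
  proof (rule that[of \<psi> d\<psi> \<omega>])
    show "ode_sol q l 0 b (\<psi> l) (d\<psi> l)" for l
      unfolding \<psi>_def d\<psi>_def by (rule ode_sol_combination[OF C(1) S(1)])
    show "\<psi> l b = 0" for l by (simp add: \<psi>_def)
    show "d\<psi> l b = 1" for l using w[of l] by (simp add: d\<psi>_def algebra_simps)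
    show "(\<lambda>l. \<omega> l x) holomorphic_on UNIV" "(\<lambda>l. \<psi> l x) holomorphic_on UNIV" if "x \<in> {0..b}" for x
      unfolding \<omega>_def \<psi>_def using C(4,5)[OF that] S(4,5)[OF that] C(4,5)[OF bb] S(4,5)[OF bb]
      by (auto intro!: holomorphic_intros)
    fix l y dy x assume y: "ode_sol q l 0 b y dy" and x: "x \<in> {0..b}"
    note r = ode_sol_representation[OF q C(1) S(1) C(2,3) S(2,3) y x]
    note k = ode_sol_backward[OF q b C(1) S(1) C(2,3) S(2,3) y]
    show "y x = y b * \<omega> l x + dy b * \<psi> l x"
      unfolding r(1) k \<omega>_def \<psi>_def by (simp add: algebra_simps)
  qed
qed

text \<open>After reflection the data at the left endpoint are 0 and -1, so the quantity
  \<open>S\<close> of \<open>ode_sol_asymptotics\<close> equals 1.\<close>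

lemma backward_solution_bound:
  fixes \<rho> :: complex
  assumes q: "q absolutely_integrable_on {0..b}" and s: "ode_sol q (\<rho>\<^sup>2) 0 b \<psi> d\<psi>" "\<psi> b = 0" "d\<psi> b = 1"
    and rho: "\<rho> \<noteq> 0" "2 * integral {0..b} (\<lambda>t. norm (q (b - t))) \<le> norm \<rho>" and x: "x \<in> {0..b}"
  shows "norm (\<psi> x) \<le> 2 / norm \<rho> * exp (\<bar>Im \<rho>\<bar> * (b - x))"
proof -
  have q': "(\<lambda>t. q (b - t)) absolutely_integrable_on {0..b}"
    using absolutely_integrable_reflect_interval[OF q] by simp
  have s': "ode_sol (\<lambda>t. q (b - t)) (\<rho>\<^sup>2) 0 b (\<lambda>t. \<psi> (b - t)) (\<lambda>t. - d\<psi> (b - t))"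
    using ode_sol_reflect[OF s(1)] by simp
  have x': "b - x \<in> {0..b}" using x by auto
  show ?thesis using ode_sol_asymptotics(1)[OF q' s' x' rho] s(2,3) x by simp
qed

text \<open>By the maximum principle smallness on arbitrarily large circles suffices; this matters
  because the estimate of P involves division by a function with zeros.\<close>

lemma entire_zero_if_small_on_circles:
  fixes P :: "complex \<Rightarrow> complex"
  assumes P: "P holomorphic_on UNIV" and small: "\<And>\<epsilon> R. \<epsilon> > 0 \<Longrightarrow> \<exists>r\<ge>R. \<forall>z. norm z = r \<longrightarrow> norm (P z) \<le> \<epsilon>"
  shows "P z = 0"
proof -
  have "norm (P z) \<le> 0 + \<epsilon>" if e: "\<epsilon> > 0" for \<epsilon>
  proof -
    obtain r where r: "r \<ge> norm z + 1" "\<And>w. norm w = r \<Longrightarrow> norm (P w) \<le> \<epsilon>" using small[OF e] by blast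
    have r0: "0 < r" using r(1) norm_ge_zero[of z] by linarith
    have "norm (P z) \<le> \<epsilon>"
    proof (rule maximum_modulus_frontier[where S="ball 0 r" and f=P and \<xi>=z])
      show "P holomorphic_on interior (ball 0 r)" using P by (rule holomorphic_on_subset) auto
      show "continuous_on (closure (ball 0 r)) P"
        using holomorphic_on_imp_continuous_on[OF P] by (rule continuous_on_subset) auto
      show "norm (P w) \<le> \<epsilon>" if "w \<in> frontier (ball 0 r)" for w using that r(2) r0 by auto
      show "z \<in> ball 0 r" using r(1) by simp
    qed auto
    then show ?thesis by simp
  qed
  then have "norm (P z) \<le> 0" by (rule field_le_epsilon)
  then show ?thesis by simp
qed

text \<open>
  \<open>\<omega>\<close> and \<open>\<psi>\<close> are the solutions with Cauchy data \<open>(1,0)\<close> and \<open>(0,1)\<close> at \<open>b\<close>. The difference of the two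
  sides is \<open>Y(b) P\<close> with the entire function \<open>P = \<omega> \<psi>t - \<omega>t \<psi>\<close>, and \<open>P = O(1/\<bar>\<rho>\<bar>)\<close> on circles that keep away
  from the zeros of \<open>Y(b)\<close>.
\<close>

lemma borg_cross_identity:
  fixes q qt :: "real \<Rightarrow> complex" and h ht :: complex
  assumes q: "q absolutely_integrable_on {0..b}" and qt: "qt absolutely_integrable_on {0..b}" and b: "0 < b"
    and y: "\<And>l. ode_sol q l 0 b (Y l) (dY l)" "\<And>l. Y l 0 = 1" "\<And>l. dY l 0 = h"
    and yt: "\<And>l. ode_sol qt l 0 b (Yt l) (dYt l)" "\<And>l. Yt l 0 = 1" "\<And>l. dYt l 0 = ht"
    and eq: "\<And>l. Y l b = Yt l b" "\<And>l. dY l b = dYt l b"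
    and psi: "\<And>l. ode_sol q l 0 b (\<psi> l) (d\<psi> l)" "\<And>l. \<psi> l b = 0" "\<And>l. d\<psi> l b = 1"
    and psit: "\<And>l. ode_sol qt l 0 b (\<psi>t l) (d\<psi>t l)" "\<And>l. \<psi>t l b = 0" "\<And>l. d\<psi>t l b = 1"
    and hol: "(\<lambda>l. \<omega> l x) holomorphic_on UNIV" "(\<lambda>l. \<psi> l x) holomorphic_on UNIV" "(\<lambda>l. \<omega>t l x) holomorphic_on UNIV" "(\<lambda>l. \<psi>t l x) holomorphic_on UNIV"
    and rep: "\<And>l. Y l x = Y l b * \<omega> l x + dY l b * \<psi> l x" "\<And>l. Yt l x = Yt l b * \<omega>t l x + dYt l b * \<psi>t l x"
    and x: "x \<in> {0..b}"
  shows "Y l x * \<psi>t l x = Yt l x * \<psi> l x"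
proof -
  obtain k where k: "k \<ge> 0" "\<And>\<rho> y dy. k \<le> norm \<rho> \<Longrightarrow> 1 \<le> norm \<rho> \<Longrightarrow> ode_sol q (\<rho>\<^sup>2) 0 b y dy \<Longrightarrow>
      y 0 = 1 \<Longrightarrow> dy 0 = h \<Longrightarrow> cosine_like k \<rho> b y dy"
    using regular_solution_asymptotics[OF q, of h] by metis
  obtain kt where kt: "kt \<ge> 0" "\<And>\<rho> y dy. kt \<le> norm \<rho> \<Longrightarrow> 1 \<le> norm \<rho> \<Longrightarrow> ode_sol qt (\<rho>\<^sup>2) 0 b y dy \<Longrightarrow>
      y 0 = 1 \<Longrightarrow> dy 0 = ht \<Longrightarrow> cosine_like kt \<rho> b y dy"
    using regular_solution_asymptotics[OF qt, of ht] by metis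
  have "\<exists>R0>0. \<forall>\<rho>::complex. norm \<rho> \<ge> R0 \<longrightarrow>
     (sin (b * norm \<rho>) = 0 \<longrightarrow> norm (cos (of_real b * \<rho>)) \<ge> (1 / 2) * cosh (b * Im \<rho>)) \<and>
     (cos (b * norm \<rho>) = 0 \<longrightarrow> norm (sin (of_real b * \<rho>)) \<ge> (1 / 2) * cosh (b * Im \<rho>))"
    by (rule trig_lower_bound[OF b]) auto
  then obtain R0 where R0: "\<And>\<rho>::complex. R0 \<le> norm \<rho> \<Longrightarrow> sin (b * norm \<rho>) = 0 \<Longrightarrow> norm (cos (of_real b * \<rho>)) \<ge> (1 / 2) * cosh (b * Im \<rho>)"
    by blast
  define P where "P l = \<omega> l x * \<psi>t l x - \<omega>t l x * \<psi> l x" for l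
  have P: "P holomorphic_on UNIV" unfolding P_def using hol by (auto intro!: holomorphic_intros)
  \<comment> \<open>The products of \<open>\<psi>\<close> and \<open>\<psi>t\<close> have the common
    coefficient dY(b) and cancel, which leaves Y(b) as a factor.\<close>
  have cross: "Y l x * \<psi>t l x - Yt l x * \<psi> l x = Y l b * P l" for l
    unfolding rep P_def eq by (simp add: algebra_simps)
  define Q where "Q = 2 * integral {0..b} (\<lambda>t. norm (q (b - t)))"
  define Qt where "Qt = 2 * integral {0..b} (\<lambda>t. norm (qt (b - t)))"
  define N where "N = max (max R0 (8 * k)) (max (max k kt) (max 1 (max Q Qt)))"
  define B where "B = 2 * (1 + k) + 2 * (1 + kt)"
  have B: "B > 0" using k(1) kt(1) by (simp add: B_def)
  have bound: "norm (P (\<rho>\<^sup>2)) \<le> 8 * B / norm \<rho>" if r: "N \<le> norm \<rho>" and s: "sin (b * norm \<rho>) = 0" for \<rho>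
  proof -
    let ?\<tau> = "\<bar>Im \<rho>\<bar>" and ?l = "\<rho>\<^sup>2"
    let ?E = "exp (?\<tau> * b)"
    have rr: "R0 \<le> norm \<rho>" "8 * k \<le> norm \<rho>" "k \<le> norm \<rho>" "kt \<le> norm \<rho>" "1 \<le> norm \<rho>" "Q \<le> norm \<rho>" "Qt \<le> norm \<rho>"
      using r by (auto simp: N_def)
    hence r0: "\<rho> \<noteq> 0" by auto
    have bb: "b \<in> {0..b}" using b by simp
    have Yx: "norm (Y ?l x) \<le> (1 + k) * exp (?\<tau> * x)" "norm (Yt ?l x) \<le> (1 + kt) * exp (?\<tau> * x)"
      using cosine_likeD(3)[OF k(2)[OF rr(3,5) y] x] cosine_likeD(3)[OF kt(2)[OF rr(4,5) yt] x] .
    have ps: "norm (\<psi> ?l x) \<le> 2 / norm \<rho> * exp (?\<tau> * (b - x))" "norm (\<psi>t ?l x) \<le> 2 / norm \<rho> * exp (?\<tau> * (b - x))"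
      using backward_solution_bound[OF q psi r0 _ x] backward_solution_bound[OF qt psit r0 _ x] rr(6,7) unfolding Q_def Qt_def by auto
    have EE: "exp (?\<tau> * x) * exp (?\<tau> * (b - x)) = ?E" by (simp add: exp_add[symmetric] algebra_simps)
    have "norm (Y ?l x) * norm (\<psi>t ?l x) \<le> ((1 + k) * exp (?\<tau> * x)) * (2 / norm \<rho> * exp (?\<tau> * (b - x)))"
      using Yx ps k(1) by (intro mult_mono) auto
    also have "\<dots> = (1 + k) * (2 / norm \<rho>) * (exp (?\<tau> * x) * exp (?\<tau> * (b - x)))" by simp
    finally have 1: "norm (Y ?l x) * norm (\<psi>t ?l x) \<le> (1 + k) * (2 / norm \<rho>) * ?E" unfolding EE .
    have "norm (Yt ?l x) * norm (\<psi> ?l x) \<le> ((1 + kt) * exp (?\<tau> * x)) * (2 / norm \<rho> * exp (?\<tau> * (b - x)))"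
      using Yx ps kt(1) by (intro mult_mono) auto
    also have "\<dots> = (1 + kt) * (2 / norm \<rho>) * (exp (?\<tau> * x) * exp (?\<tau> * (b - x)))" by simp
    finally have 2: "norm (Yt ?l x) * norm (\<psi> ?l x) \<le> (1 + kt) * (2 / norm \<rho>) * ?E" unfolding EE .
    have "norm (Y ?l b * P ?l) \<le> norm (Y ?l x) * norm (\<psi>t ?l x) + norm (Yt ?l x) * norm (\<psi> ?l x)"
      unfolding cross[symmetric] using norm_triangle_ineq4[of "Y ?l x * \<psi>t ?l x" "Yt ?l x * \<psi> ?l x"] by (simp add: norm_mult)
    also have "\<dots> \<le> (1 + k) * (2 / norm \<rho>) * ?E + (1 + kt) * (2 / norm \<rho>) * ?E" using 1 2 by linarith
    also have "\<dots> = ?E * (B / norm \<rho>)" by (simp add: B_def add_divide_distrib algebra_simps)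
    finally have up: "norm (Y ?l b) * norm (P ?l) \<le> ?E * (B / norm \<rho>)" by (simp add: norm_mult)
    have "?E \<le> 2 * cosh (b * Im \<rho>)" using exp_le_two_cosh[of "b * Im \<rho>"] b by (simp add: abs_mult mult.commute)
    hence "?E / 4 \<le> norm (cos (\<rho> * of_real b))" using R0[OF rr(1) s] by (simp add: mult.commute)
    moreover have "norm (Y ?l b - cos (\<rho> * of_real b)) \<le> k * ?E / norm \<rho>"
      using cosine_likeD(1)[OF k(2)[OF rr(3,5) y] bb] .
    moreover have "k * ?E / norm \<rho> \<le> ?E / 8"
    proof -
      have "8 * (k * ?E) \<le> norm \<rho> * ?E" using mult_right_mono[OF rr(2), of "?E"] by simp
      moreover have "0 < norm \<rho>" using rr(5) by linarith
      ultimately show ?thesis by (subst pos_divide_le_eq) argo+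
    qed
    moreover have "norm (cos (\<rho> * of_real b)) \<le> norm (Y ?l b) + norm (Y ?l b - cos (\<rho> * of_real b))"
      by (metis norm_minus_commute norm_triangle_sub)
    ultimately have "?E / 8 \<le> norm (Y ?l b)" by argo
    hence "?E / 8 * norm (P ?l) \<le> norm (Y ?l b) * norm (P ?l)" by (intro mult_right_mono) auto
    moreover have "?E * (norm (P ?l) / 8) = ?E / 8 * norm (P ?l)" by simp
    ultimately have "?E * (norm (P ?l) / 8) \<le> ?E * (B / norm \<rho>)" using up by linarith
    hence "norm (P ?l) / 8 \<le> B / norm \<rho>" by (simp only: mult_le_cancel_left_pos exp_gt_zero)
    moreover have "8 * B / norm \<rho> = 8 * (B / norm \<rho>)" by simp
    ultimately show ?thesis by linarith
  qed
  have "P l = 0"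
  proof (rule entire_zero_if_small_on_circles[OF P])
    fix \<epsilon> R :: real assume e: "\<epsilon> > 0"
    define m where "m = max (max N 1) (max R (8 * B / \<epsilon>))"
    obtain n :: nat where n: "b / pi * m \<le> real n" using real_arch_simple by blast
    \<comment> \<open>Makes b s an integer multiple of \<pi>, so that the circle |\<rho>| = s keeps
      away from the zeros of the cosine.\<close>
    define s where "s = real n * pi / b"
    have "m \<le> s" using n b by (simp add: s_def field_simps)
    hence s: "N \<le> s" "1 \<le> s" "R \<le> s" "8 * B / \<epsilon> \<le> s" by (auto simp: m_def)
    have sb: "sin (b * s) = 0" using b by (simp add: s_def mult.commute)
    show "\<exists>r\<ge>R. \<forall>z. norm z = r \<longrightarrow> norm (P z) \<le> \<epsilon>"
    proof (intro exI[of _ "s\<^sup>2"] conjI allI impI)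
      have "s \<le> s\<^sup>2" using s(2) by (simp add: power2_eq_square)
      then show "R \<le> s\<^sup>2" using s(3) by linarith
      fix z :: complex assume z: "norm z = s\<^sup>2"
      have nz: "norm (csqrt z) = s" using z s(2) by (simp add: real_sqrt_unique)
      have "norm (P z) \<le> 8 * B / s" using bound[of "csqrt z"] nz s sb by simp
      also have "\<dots> \<le> \<epsilon>" using s(2,4) e by (simp add: field_simps)
      finally show "norm (P z) \<le> \<epsilon>" .
    qed
  qed
  then show ?thesis using cross[of l] by simp
qed

lemma ode_sol_has_vector_derivative:
  assumes "ode_sol q l a c y dy" "x \<in> {a..c}"
  shows "(y has_vector_derivative dy x) (at x within {a..c})"
  using ode_sol_imp_solves_on[OF assms(1) subset_refl] assms(2) unfolding solves_on_def by blast

text \<open>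
  One large negative \<open>l\<close> suffices: differentiating the cross identity and using that both Wronskians
  equal \<open>Y(b)\<close> gives \<open>Y\<^sup>2 = Yt\<^sup>2\<close>, and neither function has a zero.
\<close>

lemma borg_uniqueness:
  fixes q qt :: "real \<Rightarrow> complex" and h ht :: complex
  assumes q: "q absolutely_integrable_on {0..b}" and qt: "qt absolutely_integrable_on {0..b}" and b: "0 < b"
    and y: "\<And>l. ode_sol q l 0 b (Y l) (dY l)" "\<And>l. Y l 0 = 1" "\<And>l. dY l 0 = h"
    and yt: "\<And>l. ode_sol qt l 0 b (Yt l) (dYt l)" "\<And>l. Yt l 0 = 1" "\<And>l. dYt l 0 = ht"
    and eq: "\<And>l. Y l b = Yt l b" "\<And>l. dY l b = dYt l b"
  shows "h = ht" "negligible {x \<in> {0..b}. q x \<noteq> qt x}"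
proof -
  have b0: "0 \<le> b" and bb: "b \<in> {0..b}" using b by auto
  obtain \<omega> \<psi> d\<psi> where psi: "\<And>l. ode_sol q l 0 b (\<psi> l) (d\<psi> l)" "\<And>l. \<psi> l b = 0" "\<And>l. d\<psi> l b = 1"
    and hol: "\<And>x. x \<in> {0..b} \<Longrightarrow> (\<lambda>l. \<omega> l x) holomorphic_on UNIV" "\<And>x. x \<in> {0..b} \<Longrightarrow> (\<lambda>l. \<psi> l x) holomorphic_on UNIV"
    and rep: "\<And>l y dy x. ode_sol q l 0 b y dy \<Longrightarrow> x \<in> {0..b} \<Longrightarrow> y x = y b * \<omega> l x + dy b * \<psi> l x"
    by (rule backward_fundamental_solutions[OF q b0]) (rule that)
  obtain \<omega>t \<psi>t d\<psi>t where psit: "\<And>l. ode_sol qt l 0 b (\<psi>t l) (d\<psi>t l)" "\<And>l. \<psi>t l b = 0" "\<And>l. d\<psi>t l b = 1"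
    and holt: "\<And>x. x \<in> {0..b} \<Longrightarrow> (\<lambda>l. \<omega>t l x) holomorphic_on UNIV" "\<And>x. x \<in> {0..b} \<Longrightarrow> (\<lambda>l. \<psi>t l x) holomorphic_on UNIV"
    and rept: "\<And>l y dy x. ode_sol qt l 0 b y dy \<Longrightarrow> x \<in> {0..b} \<Longrightarrow> y x = y b * \<omega>t l x + dy b * \<psi>t l x"
    by (rule backward_fundamental_solutions[OF qt b0]) (rule that)
  have cross: "Y l x * \<psi>t l x = Yt l x * \<psi> l x" if x: "x \<in> {0..b}" for l x
    by (rule borg_cross_identity[where Y=Y and dY=dY and Yt=Yt and dYt=dYt and \<psi>=\<psi> and \<psi>t=\<psi>t and \<omega>=\<omega> and \<omega>t=\<omega>t,
          OF q qt b y yt eq psi psit hol[OF x] holt[OF x] rep[OF y(1) x] rept[OF yt(1) x] x])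
  obtain k where k: "k \<ge> 0" "\<And>\<rho> y dy. k \<le> norm \<rho> \<Longrightarrow> 1 \<le> norm \<rho> \<Longrightarrow> ode_sol q (\<rho>\<^sup>2) 0 b y dy \<Longrightarrow>
      y 0 = 1 \<Longrightarrow> dy 0 = h \<Longrightarrow> cosine_like k \<rho> b y dy"
    using regular_solution_asymptotics[OF q, of h] by metis
  obtain kt where kt: "kt \<ge> 0" "\<And>\<rho> y dy. kt \<le> norm \<rho> \<Longrightarrow> 1 \<le> norm \<rho> \<Longrightarrow> ode_sol qt (\<rho>\<^sup>2) 0 b y dy \<Longrightarrow>
      y 0 = 1 \<Longrightarrow> dy 0 = ht \<Longrightarrow> cosine_like kt \<rho> b y dy"
    using regular_solution_asymptotics[OF qt, of ht] by metis
  \<comment> \<open>At \<rho> = \<i> t the cosine is cosh (t x), at least half of exp (t x). With t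
    above 2 k and 2 kt the errors stay below this on the whole interval, so neither solution
    vanishes.\<close>
  define t where "t = 2 * k + 2 * kt + 1"
  have t: "t \<ge> 1" "2 * k < t" "2 * kt < t" "k \<le> t" "kt \<le> t" using k(1) kt(1) by (auto simp: t_def)
  define \<rho> where "\<rho> = \<i> * of_real t"
  define l where "l = \<rho>\<^sup>2"
  have rho: "norm \<rho> = t" "\<bar>Im \<rho>\<bar> = t" using t by (auto simp: \<rho>_def norm_mult)
  have cosl: "exp (t * x) / 2 \<le> norm (cos (\<rho> * of_real x))" if "0 \<le> x" for x
  proof -
    have "(norm (cos (\<rho> * of_real x)))\<^sup>2 = (cosh (t * x))\<^sup>2"
      unfolding norm_cos_squared_cosh by (simp add: \<rho>_def)
    hence "norm (cos (\<rho> * of_real x)) = cosh (t * x)" by (simp add: power2_eq_iff_nonneg)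
    moreover have "exp (t * x) / 2 \<le> cosh (t * x)" by (simp add: cosh_field_def)
    ultimately show ?thesis by simp
  qed
  have nzgen: "u \<noteq> 0" if "norm (u - cos (\<rho> * of_real x)) \<le> c * exp (t * x) / t" "2 * c < t" "0 \<le> x" for u c x
  proof
    assume "u = 0"
    hence "exp (t * x) / 2 \<le> c * exp (t * x) / t" using that(1) cosl[OF that(3)] by (simp only: diff_0 norm_minus_cancel)
    hence "exp (t * x) * t \<le> exp (t * x) * (2 * c)" using t(1) by (simp add: field_simps)
    hence "t \<le> 2 * c" by (simp only: mult_le_cancel_left_pos exp_gt_zero)
    then show False using that(2) by simp
  qed
  have nz: "Y l x \<noteq> 0" "Yt l x \<noteq> 0" if x: "x \<in> {0..b}" for x
  proof -
    have "norm (Y l x - cos (\<rho> * of_real x)) \<le> k * exp (t * x) / t"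
      using cosine_likeD(1)[OF k(2)[of \<rho>, OF _ _ y] x] rho t unfolding l_def by auto
    then show "Y l x \<noteq> 0" using nzgen t x by auto
    have "norm (Yt l x - cos (\<rho> * of_real x)) \<le> kt * exp (t * x) / t"
      using cosine_likeD(1)[OF kt(2)[of \<rho>, OF _ _ yt] x] rho t unfolding l_def by auto
    then show "Yt l x \<noteq> 0" using nzgen t x by auto
  qed
  have W: "Y l x * d\<psi> l x - dY l x * \<psi> l x = Y l b" "Yt l x * d\<psi>t l x - dYt l x * \<psi>t l x = Y l b" if x: "x \<in> {0..b}" for x
    using wronskian_constant[OF q y(1) psi(1) x, of l] wronskian_constant[OF q y(1) psi(1) bb, of l]
      wronskian_constant[OF qt yt(1) psit(1) x, of l] wronskian_constant[OF qt yt(1) psit(1) bb, of l] psi(2,3) psit(2,3) eq(1)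
    by simp_all
  have sq: "(Y l x)\<^sup>2 = (Yt l x)\<^sup>2" if x: "x \<in> {0..b}" for x
  proof -
    let ?D = "Y l x * d\<psi>t l x + dY l x * \<psi>t l x - (Yt l x * d\<psi> l x + dYt l x * \<psi> l x)"
    have "((\<lambda>u. Y l u * \<psi>t l u - Yt l u * \<psi> l u) has_vector_derivative ?D) (at x within {0..b})"
      using ode_sol_has_vector_derivative[OF y(1) x, of l] ode_sol_has_vector_derivative[OF yt(1) x, of l]
        ode_sol_has_vector_derivative[OF psi(1) x, of l] ode_sol_has_vector_derivative[OF psit(1) x, of l]
      by (intro has_vector_derivative_diff has_vector_derivative_mult)
    hence "((\<lambda>u. 0) has_vector_derivative ?D) (at x within {0..b})"
      by (rule has_vector_derivative_transform[rotated 2]) (use x cross in auto)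
    moreover have "((\<lambda>u. 0 :: complex) has_vector_derivative 0) (at x within {0..b})" by simp
    ultimately have D: "?D = 0"
      using vector_derivative_unique_within_closed_interval[of 0 b x "\<lambda>u. 0" ?D 0] b x by auto
    have c: "Y l x * \<psi>t l x = Yt l x * \<psi> l x" using cross[OF x] .
    let ?y = "Y l x" and ?z = "Yt l x" and ?y' = "dY l x" and ?z' = "dYt l x" and ?p = "\<psi> l x" and ?r = "\<psi>t l x" and ?p' = "d\<psi> l x" and ?r' = "d\<psi>t l x"
    \<comment> \<open>Multiplying by \<open>?y * ?z\<close> makes it possible to exchange
      \<open>?y * ?r\<close> and \<open>?z * ?p\<close> by the cross identity, so that the terms
      group into the two Wronskians.\<close>
    have "?y * ?z * ?D = ?y\<^sup>2 * (?z * ?r') + ?z * ?y' * (?y * ?r) - ?z\<^sup>2 * (?y * ?p') - ?y * ?z' * (?z * ?p)"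
      by (simp add: algebra_simps power2_eq_square)
    also have "\<dots> = ?y\<^sup>2 * (?z * ?r') + ?z * ?y' * (?z * ?p) - ?z\<^sup>2 * (?y * ?p') - ?y * ?z' * (?y * ?r)"
      unfolding c ..
    also have "\<dots> = ?y\<^sup>2 * (?z * ?r' - ?z' * ?r) - ?z\<^sup>2 * (?y * ?p' - ?y' * ?p)"
      by (simp add: algebra_simps power2_eq_square)
    also have "\<dots> = Y l b * (?y\<^sup>2 - ?z\<^sup>2)" unfolding W[OF x] by (simp add: algebra_simps)
    finally show ?thesis using D nz(1)[OF bb] by simp
  qed
  let ?f = "\<lambda>x. Y l x / Yt l x"
  \<comment> \<open>The quotient is continuous with values 1 and -1, hence constant; its value at 0
    selects 1.\<close>
  have "?f constant_on {0..b}"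
  proof (rule continuous_finite_range_constant)
    show "connected {0..b}" by simp
    show "continuous_on {0..b} ?f"
      using ode_sol_continuous(1)[OF y(1)] ode_sol_continuous(1)[OF yt(1)] nz(2) by (intro continuous_intros) auto
    have "?f ` {0..b} \<subseteq> {1, -1}"
    proof (rule image_subsetI)
      fix x assume x: "x \<in> {0..b}"
      have "(?f x)\<^sup>2 = 1" using sq[OF x] nz(2)[OF x] by (simp add: power_divide)
      then show "?f x \<in> {1, -1}" by (auto simp: power2_eq_1_iff)
    qed
    then show "finite (?f ` {0..b})" by (rule finite_subset) simp
  qed
  then obtain v where v: "\<And>x. x \<in> {0..b} \<Longrightarrow> ?f x = v" unfolding constant_on_def by blast
  have "v = 1" using v[of 0] b y(2) yt(2) by simp
  hence same: "Y l x = Yt l x" if "x \<in> {0..b}" for x using v[OF that] nz(2)[OF that] by simp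
  have dsame: "dY l x = dYt l x" if x: "x \<in> {0..b}" for x
  proof -
    have "(Yt l has_vector_derivative dY l x) (at x within {0..b})"
      by (rule has_vector_derivative_transform[OF x _ ode_sol_has_vector_derivative[OF y(1) x]]) (use same in auto)
    then show ?thesis
      using vector_derivative_unique_within_closed_interval[of 0 b x] b x ode_sol_has_vector_derivative[OF yt(1) x, of l] by auto
  qed
  show "h = ht" using dsame[of 0] y(3) yt(3) b by simp
  have "ode_sol qt l 0 b (Y l) (dY l)"
    by (rule ode_sol_cong[OF yt(1)]) (use same dsame in auto)
  then show "negligible {x \<in> {0..b}. q x \<noteq> qt x}"
    using ode_sol_determines_coefficient[OF q qt y(1)] nz(1) by blast
qed

subsection \<open>The main theorem\<close>

lemma deriv_zeros_combination:
  assumes "e holomorphic_on UNIV" "e' holomorphic_on UNIV" "f holomorphic_on UNIV" "g holomorphic_on UNIV"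
    and "\<And>\<nu>. \<nu> < k \<Longrightarrow> (deriv ^^ \<nu>) f z = 0" "\<And>\<nu>. \<nu> < k \<Longrightarrow> (deriv ^^ \<nu>) g z = 0" "\<nu> < k"
  shows "(deriv ^^ \<nu>) (\<lambda>w. e w * f w + e' w * g w) z = 0"
proof -
  have "(deriv ^^ \<nu>) (\<lambda>w. e w * f w + e' w * g w) z = (deriv ^^ \<nu>) (\<lambda>w. e w * f w) z + (deriv ^^ \<nu>) (\<lambda>w. e' w * g w) z"
    by (rule higher_deriv_add[of _ UNIV]) (use assms in \<open>auto intro!: holomorphic_intros\<close>)
  then show ?thesis
    using deriv_zeros_mult[of f e k z \<nu>] deriv_zeros_mult[of g e' k z \<nu>] assms by simp
qed

lemma alg_mult_ge:
  assumes "F holomorphic_on UNIV" "F w \<noteq> 0" "\<And>\<nu>. \<nu> < k \<Longrightarrow> (deriv ^^ \<nu>) F z = 0"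
  shows "k \<le> alg_mult F z"
  using alg_mult_eq_Least(1)[OF assms(1,2), of z] assms(3)[of "alg_mult F z"] by (meson not_le)

text \<open>An order below the number of occurrences is below both multiplicities, so n + \<nu>
  stays inside the block in either spectrum. There the ratios are Taylor coefficients at z, and
  their equality is vanishing of the difference to that order.\<close>

lemma common_ratio_derivatives:
  assumes s: "eigenvalue_sequence f s" "eigenvalue_sequence ft st"
    and sub: "is_subsequence D x s" "is_subsequence D x st"
    and g: "g holomorphic_on UNIV" "gt holomorphic_on UNIV"
    and ratio: "\<And>n nt \<nu>. n \<in> block_starts s \<Longrightarrow> nt \<in> block_starts st \<Longrightarrow> s n = st nt \<Longrightarrow>
           s n \<in> x ` D \<Longrightarrow> \<nu> < occurrences D x (s n) \<Longrightarrow> gen_ratio g s (n + \<nu>) = gen_ratio gt st (nt + \<nu>)"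
    and nu: "\<nu> < occurrences D x z"
  shows "(deriv ^^ \<nu>) (\<lambda>w. g w - gt w) z = 0"
proof -
  have "{k \<in> D. x k = z} \<noteq> {}" using nu unfolding occurrences_def by (metis card.empty not_less_zero)
  then obtain k where k: "k \<in> D" "x k = z" by auto
  have zr: "z \<in> range s" "z \<in> range st"
    using subsequence_occurrences(4)[OF sub(1) s(1) k(1)] subsequence_occurrences(4)[OF sub(2) s(2) k(1)] k(2) by auto
  obtain n where n: "n \<in> block_starts s" "s n = z" using block_start_exists[OF zr(1)] by blast
  obtain m where m: "m \<in> block_starts st" "st m = z" using block_start_exists[OF zr(2)] by blast
  have c: "card {k. s k = z} = alg_mult f z" "card {k. st k = z} = alg_mult ft z"
    using s(1)[unfolded eigenvalue_sequence_def, THEN conjunct1] s(2)[unfolded eigenvalue_sequence_def, THEN conjunct1] by simp_all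
  have "\<nu> < card {k. s k = s n}" "\<nu> < card {k. st k = st m}"
    using subsequence_occurrences(1)[OF sub(1) s(1), of z] subsequence_occurrences(1)[OF sub(2) s(2), of z] nu c n(2) m(2) by auto
  note blocks = eigenvalue_block[OF s(1) n(1) this(1), of g] eigenvalue_block[OF s(2) m(1) this(2), of gt]
  have "gen_ratio g s (n + \<nu>) = gen_ratio gt st (m + \<nu>)"
    by (rule ratio[OF n(1) m(1)]) (use n(2) m(2) k nu in \<open>auto intro: rev_image_eqI\<close>)
  hence "(deriv ^^ \<nu>) g z = (deriv ^^ \<nu>) gt z" unfolding blocks n(2) m(2) by simp
  then show ?thesis using higher_deriv_diff[OF g open_UNIV, of z \<nu>] by simp
qed

theorem theorem6:
  fixes q qt :: "real \<Rightarrow> complex"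
    and h ht H \<gamma> \<gamma>t :: complex
    and \<beta> \<beta>t d b A :: real
    and lam lamt lam_inf lamt_inf :: "nat \<Rightarrow> complex"
    and D D_inf :: "nat set"
    and W W_inf :: "nat \<Rightarrow> complex"
  assumes "q absolutely_integrable_on {0..pi}" and "qt absolutely_integrable_on {0..pi}"
    and "\<beta> > 0" and "\<beta>t > 0" and "0 < d" and "d < pi"
    and "eigenvalue_sequence (Delta q h H \<beta> \<gamma> d) lam"
    and "eigenvalue_sequence (Delta qt ht H \<beta>t \<gamma>t d) lamt"
    and "eigenvalue_sequence (Delta_inf q h \<beta> \<gamma> d) lam_inf"
    and "eigenvalue_sequence (Delta_inf qt ht \<beta>t \<gamma>t d) lamt_inf"
    and "is_subsequence D W lam" and "is_subsequence D W lamt"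
    and "is_subsequence D_inf W_inf lam_inf" and "is_subsequence D_inf W_inf lamt_inf"
    and "\<And>n nt \<nu>. n \<in> block_starts lam \<Longrightarrow> nt \<in> block_starts lamt \<Longrightarrow> lam n = lamt nt \<Longrightarrow>
           lam n \<in> W ` D \<Longrightarrow> \<nu> < occurrences D W (lam n) \<Longrightarrow>
           kappa q h \<beta> \<gamma> d lam (n + \<nu>) = kappa qt ht \<beta>t \<gamma>t d lamt (nt + \<nu>)"
    and "\<And>n nt \<nu>. n \<in> block_starts lam_inf \<Longrightarrow> nt \<in> block_starts lamt_inf \<Longrightarrow>
           lam_inf n = lamt_inf nt \<Longrightarrow>
           lam_inf n \<in> W_inf ` D_inf \<Longrightarrow> \<nu> < occurrences D_inf W_inf (lam_inf n) \<Longrightarrow>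
           kappa_inf q h \<beta> \<gamma> d lam_inf (n + \<nu>) = kappa_inf qt ht \<beta>t \<gamma>t d lamt_inf (nt + \<nu>)"
    and "0 < b" and "b < d"
    and "AE x\<in>{b..pi} in lebesgue. q x = qt x"
    and "\<beta> = \<beta>t" and "\<gamma> = \<gamma>t"
    and "\<forall>\<^sub>F t in at_top.
           real (counting D W t) + real (counting D_inf W_inf t)
             \<ge> A * real (counting UNIV lam t) + (b / pi - A) * real (counting UNIV lam_inf t) - A / 2"
  shows "h = ht \<and> (AE x\<in>{0..pi} in lebesgue. q x = qt x)"
proof -
  note q = assms(1) and qt = assms(2) and \<beta> = assms(3) and d = assms(5,6) and b = assms(17,18)
  note bt = assms(20)[symmetric] and gt = assms(21)[symmetric]
  note ev = assms(7) assms(8)[unfolded bt gt] assms(9) assms(10)[unfolded bt gt]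
  note sub = assms(11-14)
  have \<beta>0: "\<beta> \<noteq> 0" using \<beta> by simp
  let ?f = "phi q h \<beta> \<gamma> d pi" and ?df = "dphi q h \<beta> \<gamma> d pi"
  let ?ft = "phi qt ht \<beta> \<gamma> d pi" and ?dft = "dphi qt ht \<beta> \<gamma> d pi"
  let ?D = "Delta q h H \<beta> \<gamma> d" and ?Dt = "Delta qt ht H \<beta> \<gamma> d"
  let ?I = "Delta_inf q h \<beta> \<gamma> d" and ?It = "Delta_inf qt ht \<beta> \<gamma> d"
  obtain Y dY Z dZ where Y: "\<And>l. ode_sol q l 0 d (Y l) (dY l)" "\<And>l. Y l 0 = 1" "\<And>l. dY l 0 = h"
    and Z: "\<And>l. ode_sol q l d pi (Z l) (dZ l)" "\<And>l. Z l d = of_real \<beta> * Y l d"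
      "\<And>l. dZ l d = inverse (of_real \<beta>) * dY l d + \<gamma> * Y l d"
    and Yhol: "\<And>x. x \<in> {0..d} \<Longrightarrow> (\<lambda>l. Y l x) holomorphic_on UNIV" "\<And>x. x \<in> {0..d} \<Longrightarrow> (\<lambda>l. dY l x) holomorphic_on UNIV"
    and fpi: "\<And>l. ?f l = Z l pi" "\<And>l. ?df l = dZ l pi"
    and fhol: "?f holomorphic_on UNIV" "?df holomorphic_on UNIV"
    by (rule phi_structure[OF q d, of h \<beta> \<gamma>]) (rule that)
  obtain Yt dYt Zt dZt where Yt: "\<And>l. ode_sol qt l 0 d (Yt l) (dYt l)" "\<And>l. Yt l 0 = 1" "\<And>l. dYt l 0 = ht"
    and Zt: "\<And>l. ode_sol qt l d pi (Zt l) (dZt l)" "\<And>l. Zt l d = of_real \<beta> * Yt l d"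
      "\<And>l. dZt l d = inverse (of_real \<beta>) * dYt l d + \<gamma> * Yt l d"
    and Ythol: "\<And>x. x \<in> {0..d} \<Longrightarrow> (\<lambda>l. Yt l x) holomorphic_on UNIV" "\<And>x. x \<in> {0..d} \<Longrightarrow> (\<lambda>l. dYt l x) holomorphic_on UNIV"
    and ftpi: "\<And>l. ?ft l = Zt l pi" "\<And>l. ?dft l = dZt l pi"
    and fthol: "?ft holomorphic_on UNIV" "?dft holomorphic_on UNIV"
    by (rule phi_structure[OF qt d, of ht \<beta> \<gamma>]) (rule that)
  have Dhol: "?D holomorphic_on UNIV" "?Dt holomorphic_on UNIV" "?I holomorphic_on UNIV" "?It holomorphic_on UNIV"
    unfolding Delta_def[abs_def] Delta_inf_def[abs_def] using fhol fthol by (auto intro!: holomorphic_intros)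

  define N where "N = {x \<in> {b..pi}. q x \<noteq> qt x}"
  have N: "negligible N"
  proof -
    obtain N' where "negligible N'" "{x. \<not> (x \<in> {b..pi} \<longrightarrow> q x = qt x)} \<subseteq> N'"
      using assms(19) unfolding eventually_ae_filter_negligible by blast
    then show ?thesis by (elim negligible_subset) (auto simp: N_def)
  qed
  have qb: "q absolutely_integrable_on {0..b}" "qt absolutely_integrable_on {0..b}" "q absolutely_integrable_on {b..pi}"
    using absolutely_integrable_on_subinterval[OF q] absolutely_integrable_on_subinterval[OF qt] b d by auto
  have Ybd: "ode_sol q l b d (Y l) (dY l)" for l
    by (rule ode_sol_subinterval[OF Y(1)]) (use b in auto)
  have Y0b: "ode_sol q l 0 b (Y l) (dY l)" "ode_sol qt l 0 b (Yt l) (dYt l)" for l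
    using ode_sol_subinterval[OF Y(1)] ode_sol_subinterval[OF Yt(1)] b by auto
  \<comment> \<open>On [b,d] the second solution also solves the equation with \<open>q\<close>,
    since the coefficients differ only on a null set; likewise on [d,\<pi>]. This allows one
    transfer matrix for both problems.\<close>
  have Ytbd: "ode_sol q l b d (Yt l) (dYt l)" for l
    by (rule ode_sol_coefficient_AE[OF ode_sol_subinterval[OF Yt(1)]])
       (use b d in \<open>auto intro!: negligible_subset[OF N] simp: N_def\<close>)
  have Ztd: "ode_sol q l d pi (Zt l) (dZt l)" for l
    by (rule ode_sol_coefficient_AE[OF Zt(1)])
       (use b d in \<open>auto intro!: negligible_subset[OF N] simp: N_def\<close>)
  obtain e11 e12 e21 e22 where ehol:
      "e11 holomorphic_on UNIV" "e12 holomorphic_on UNIV" "e21 holomorphic_on UNIV" "e22 holomorphic_on UNIV"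
    and e: "\<And>l y dy z dz. ode_sol q l b d y dy \<Longrightarrow> ode_sol q l d pi z dz \<Longrightarrow> z d = of_real \<beta> * y d \<Longrightarrow>
        dz d = inverse (of_real \<beta>) * dy d + \<gamma> * y d \<Longrightarrow>
        y b = e11 l * z pi + e12 l * dz pi \<and> dy b = e21 l * z pi + e22 l * dz pi"
    by (rule transfer_from_pi[OF qb(3), of d \<beta> \<gamma>]) (use b d \<beta> that in auto)
  have eY: "Y l b = e11 l * ?f l + e12 l * ?df l" "dY l b = e21 l * ?f l + e22 l * ?df l" for l
    using e[OF Ybd Z] by (auto simp: fpi)
  have eYt: "Yt l b = e11 l * ?ft l + e12 l * ?dft l" "dYt l b = e21 l * ?ft l + e22 l * ?dft l" for l
    using e[OF Ytbd Ztd Zt(2,3)] by (auto simp: ftpi)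
  define F1 F2 where "F1 l = Y l b - Yt l b" and "F2 l = dY l b - dYt l b" for l
  \<comment> \<open>The matrix entries are entire, so a common order of vanishing of the two
    differences at \<pi> passes to \<open>F1\<close> and \<open>F2\<close>.\<close>
  have F: "F1 l = e11 l * (?f l - ?ft l) + e12 l * (?df l - ?dft l)" "F2 l = e21 l * (?f l - ?ft l) + e22 l * (?df l - ?dft l)" for l
    unfolding F1_def F2_def eY eYt by (simp_all add: algebra_simps)
  have Fhol: "F1 holomorphic_on UNIV" "F2 holomorphic_on UNIV"
    unfolding F[abs_def] using ehol fhol fthol by (auto intro!: holomorphic_intros)

  obtain k R0 where kR: "k \<ge> 0" "R0 \<ge> 1" and as: "\<And>\<rho> y dy z dz. R0 \<le> norm \<rho> \<Longrightarrow> ode_sol q (\<rho>\<^sup>2) 0 d y dy \<Longrightarrow> y 0 = 1 \<Longrightarrow> dy 0 = h \<Longrightarrow>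
      ode_sol q (\<rho>\<^sup>2) d pi z dz \<Longrightarrow> z d = of_real \<beta> * y d \<Longrightarrow> dz d = inverse (of_real \<beta>) * dy d + \<gamma> * y d \<Longrightarrow>
      norm (z pi - jump_cos \<beta> d \<rho>)
        \<le> k * exp (pi * \<bar>Im \<rho>\<bar>) / norm \<rho> \<and>
      norm (dz pi - (- \<rho> * jump_sin \<beta> d \<rho>))
        \<le> k * exp (pi * \<bar>Im \<rho>\<bar>)"
    by (rule jump_solution_asymptotics[OF q d \<beta>, of h \<gamma>]) (rule that)
  let ?P = "jump_cos \<beta> d" and ?S = "jump_sin \<beta> d"
  have as1: "norm (?f (\<rho>\<^sup>2) - ?P \<rho>) \<le> k * exp (pi * \<bar>Im \<rho>\<bar>) / norm \<rho>" "norm (?df (\<rho>\<^sup>2) - (- \<rho> * ?S \<rho>)) \<le> k * exp (pi * \<bar>Im \<rho>\<bar>)"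
    if "R0 \<le> norm \<rho>" for \<rho>
    using as[OF that Y Z] unfolding fpi by blast+
  define m where "m = \<beta> + inverse \<beta>"
  have m0: "m > 0" using \<beta> by (simp add: m_def add_pos_pos)
  have PS: "norm (?P \<rho>) \<le> m * exp (pi * \<bar>Im \<rho>\<bar>)" "norm (?S \<rho>) \<le> m * exp (pi * \<bar>Im \<rho>\<bar>)" for \<rho>
  proof -
    let ?e1 = "exp (\<bar>Im \<rho>\<bar> * d)" and ?e2 = "exp (\<bar>Im \<rho>\<bar> * (pi - d))"
    have t: "norm (cos (\<rho> * of_real d)) \<le> ?e1" "norm (sin (\<rho> * of_real d)) \<le> ?e1"
        "norm (cos (\<rho> * of_real (pi - d))) \<le> ?e2" "norm (sin (\<rho> * of_real (pi - d))) \<le> ?e2"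
      using norm_cos_le_exp_Im[of "\<rho> * of_real d"] norm_sin_le_exp_Im[of "\<rho> * of_real d"]
        norm_cos_le_exp_Im[of "\<rho> * of_real (pi - d)"] norm_sin_le_exp_Im[of "\<rho> * of_real (pi - d)"] d
      by (auto simp: abs_mult simp del: of_real_diff)
    have ee: "?e1 * ?e2 = exp (pi * \<bar>Im \<rho>\<bar>)" by (simp add: exp_add[symmetric] algebra_simps)
    have gen: "\<beta> * (norm u * norm v) + inverse \<beta> * (norm u' * norm v') \<le> m * exp (pi * \<bar>Im \<rho>\<bar>)"
      if "norm u \<le> ?e1" "norm u' \<le> ?e1" "norm v \<le> ?e2" "norm v' \<le> ?e2" for u v u' v' :: complex
    proof -
      have "\<beta> * (norm u * norm v) + inverse \<beta> * (norm u' * norm v') \<le> \<beta> * (?e1 * ?e2) + inverse \<beta> * (?e1 * ?e2)"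
        using that \<beta> by (intro add_mono mult_left_mono mult_mono) auto
      then show ?thesis unfolding ee m_def by (simp add: distrib_right)
    qed
    have "norm (?P \<rho>) \<le> \<beta> * (norm (cos (\<rho> * of_real d)) * norm (cos (\<rho> * of_real (pi - d)))) + inverse \<beta> * (norm (sin (\<rho> * of_real d)) * norm (sin (\<rho> * of_real (pi - d))))"
      unfolding jump_cos_def
      by (rule order_trans[OF norm_triangle_ineq4]) (use \<beta> in \<open>simp add: norm_mult norm_inverse mult.assoc del: of_real_diff\<close>)
    then show "norm (?P \<rho>) \<le> m * exp (pi * \<bar>Im \<rho>\<bar>)" using gen[OF t(1,2,3,4)] by (rule order_trans)
    have "norm (?S \<rho>) \<le> \<beta> * (norm (cos (\<rho> * of_real d)) * norm (sin (\<rho> * of_real (pi - d)))) + inverse \<beta> * (norm (sin (\<rho> * of_real d)) * norm (cos (\<rho> * of_real (pi - d))))"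
      unfolding jump_sin_def
      by (rule order_trans[OF norm_triangle_ineq]) (use \<beta> in \<open>simp add: norm_mult norm_inverse mult.assoc del: of_real_diff\<close>)
    then show "norm (?S \<rho>) \<le> m * exp (pi * \<bar>Im \<rho>\<bar>)" using gen[OF t(1,2,4,3)] by (rule order_trans)
  qed
  obtain c R1 where c: "c > 0" and low: "\<And>\<rho> n. R1 \<le> norm \<rho> \<Longrightarrow> norm \<rho> = real n + 0 \<Longrightarrow> c * exp (pi * \<bar>Im \<rho>\<bar>) \<le> norm (?P \<rho>)"
    "\<And>\<rho> n. R1 \<le> norm \<rho> \<Longrightarrow> norm \<rho> = real n + 1 / 2 \<Longrightarrow> c * exp (pi * \<bar>Im \<rho>\<bar>) \<le> norm (?S \<rho>)"
    using jump_trig_lower_bound[OF \<beta> d] by blast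
  define R2 where "R2 = max R0 R1"
  have closeI: "\<bar>norm (?I (\<rho>\<^sup>2)) - norm \<rho> ^ 0 * norm (?P \<rho>)\<bar> \<le> k * norm \<rho> ^ 0 / norm \<rho> * exp (pi * \<bar>Im \<rho>\<bar>)" if "R2 \<le> norm \<rho>" for \<rho>
  proof -
    have "\<bar>norm (?f (\<rho>\<^sup>2)) - norm (?P \<rho>)\<bar> \<le> norm (?f (\<rho>\<^sup>2) - ?P \<rho>)" by (rule norm_triangle_ineq3)
    also have "\<dots> \<le> k * exp (pi * \<bar>Im \<rho>\<bar>) / norm \<rho>" using as1(1) that by (simp add: R2_def)
    finally show ?thesis by (simp add: Delta_inf_def)
  qed
  \<comment> \<open>The summand H \<phi>(\<pi>) of \<open>Delta\<close> lacks the factor \<rho> of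
    the leading term and is treated as part of the error.\<close>
  define K where "K = k + norm H * (m + k)"
  have K0: "K \<ge> 0" using kR(1) m0 by (simp add: K_def)
  have closeD: "\<bar>norm (?D (\<rho>\<^sup>2)) - norm \<rho> ^ 1 * norm (?S \<rho>)\<bar> \<le> K * norm \<rho> ^ 1 / norm \<rho> * exp (pi * \<bar>Im \<rho>\<bar>)" if r: "R2 \<le> norm \<rho>" for \<rho>
  proof -
    let ?e = "exp (pi * \<bar>Im \<rho>\<bar>)"
    have rr: "R0 \<le> norm \<rho>" "norm \<rho> \<ge> 1" using r kR by (auto simp: R2_def)
    have "k * ?e / norm \<rho> \<le> k * ?e / 1" using rr kR(1) by (intro divide_left_mono) auto
    hence "norm (?f (\<rho>\<^sup>2)) \<le> m * ?e + k * ?e"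
      using norm_triangle_sub[of "?f (\<rho>\<^sup>2)" "?P \<rho>"] PS(1)[of \<rho>] as1(1)[OF rr(1)] by simp
    hence "norm H * norm (?f (\<rho>\<^sup>2)) \<le> norm H * (m * ?e + k * ?e)" by (intro mult_left_mono) auto
    moreover have "\<bar>norm (?D (\<rho>\<^sup>2)) - norm (- \<rho> * ?S \<rho>)\<bar> \<le> norm (?D (\<rho>\<^sup>2) - (- \<rho> * ?S \<rho>))" by (rule norm_triangle_ineq3)
    moreover have "norm (?D (\<rho>\<^sup>2) - (- \<rho> * ?S \<rho>)) \<le> norm (?df (\<rho>\<^sup>2) - (- \<rho> * ?S \<rho>)) + norm H * norm (?f (\<rho>\<^sup>2))"
      unfolding Delta_def using norm_triangle_ineq[of "?df (\<rho>\<^sup>2) - (- \<rho> * ?S \<rho>)" "H * ?f (\<rho>\<^sup>2)"] by (simp add: algebra_simps norm_mult)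
    ultimately have "\<bar>norm (?D (\<rho>\<^sup>2)) - norm (- \<rho> * ?S \<rho>)\<bar> \<le> k * ?e + norm H * (m * ?e + k * ?e)"
      using as1(2)[OF rr(1)] by linarith
    also have "k * ?e + norm H * (m * ?e + k * ?e) = K * ?e" by (simp add: K_def algebra_simps)
    finally have "\<bar>norm (?D (\<rho>\<^sup>2)) - norm (- \<rho> * ?S \<rho>)\<bar> \<le> K * ?e" .
    moreover have "\<rho> \<noteq> 0" using rr(2) by auto
    ultimately show ?thesis by (simp add: norm_mult)
  qed
  have lowI: "c * exp (pi * \<bar>Im \<rho>\<bar>) \<le> norm (?P \<rho>)" if "R2 \<le> norm \<rho>" "norm \<rho> = real n + 0" for \<rho> n
    by (rule low(1)[OF _ that(2)]) (use that(1) in \<open>simp add: R2_def\<close>)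
  have lowD: "c * exp (pi * \<bar>Im \<rho>\<bar>) \<le> norm (?S \<rho>)" if "R2 \<le> norm \<rho>" "norm \<rho> = real n + 1 / 2" for \<rho> n
    by (rule low(2)[OF _ that(2)]) (use that(1) in \<open>simp add: R2_def\<close>)
  have z01: "(0::real) \<le> 0" "(0::real) < 1" "(0::real) \<le> 1 / 2" "(1 / 2 :: real) < 1" by simp_all
  have asI: "\<exists>w. ?I w \<noteq> 0"
    "\<exists>r0 C. \<forall>r\<ge>r0. \<bar>log_counting_sum UNIV lam_inf r - 2 * sqrt r - real 0 / 2 * ln r\<bar> \<le> C"
    by (rule eigenvalue_log_sum_asymptotics[where ?R0.0=R2 and M="?P" and m=m, OF Dhol(3) c z01(1,2) kR(1)];
        fact closeI PS(1) lowI ev(3))+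
  have asD: "\<exists>w. ?D w \<noteq> 0"
    "\<exists>r0 C. \<forall>r\<ge>r0. \<bar>log_counting_sum UNIV lam r - 2 * sqrt r - real 1 / 2 * ln r\<bar> \<le> C"
    by (rule eigenvalue_log_sum_asymptotics[where ?R0.0=R2 and M="?S" and m=m, OF Dhol(1) c z01(3,4) K0];
        fact closeD PS(2) lowD ev(1))+
  obtain wI where wI: "?I wI \<noteq> 0" using asI(1) by blast
  obtain wD where wD: "?D wD \<noteq> 0" using asD(1) by blast
  note pI = eigenvalue_sequence_props[OF ev(3) Dhol(3) wI] and pD = eigenvalue_sequence_props[OF ev(1) Dhol(1) wD]
  have finW: "finite {n \<in> D. norm (W n) < r}" "finite {n \<in> D_inf. norm (W_inf n) < r}" for r
    using subsequence_occurrences(3)[OF sub(1) ev(1) pD(2)] subsequence_occurrences(3)[OF sub(3) ev(3) pI(2)] by auto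
  have finz: "finite {n \<in> D. W n = z}" "finite {n \<in> D_inf. W_inf n = z}" for z
    using subsequence_occurrences(2)[OF sub(1) ev(1)] subsequence_occurrences(2)[OF sub(3) ev(3)] by auto
  obtain r0 C where count: "\<And>r. r0 \<le> r \<Longrightarrow> 2 * b / pi * sqrt r - C \<le> log_counting_sum D W r + log_counting_sum D_inf W_inf r"
    using log_counting_sum_lower_bound[OF finW pD(2) pI(2) asD(2) asI(2) assms(22)] by blast

  \<comment> \<open>An identically vanishing \<open>g\<close> is covered as well, because
    nonvanishing is established only for the characteristic functions of the first problem.\<close>
  have low_order: "(deriv ^^ \<nu>) g z = 0" if g: "eigenvalue_sequence g s" "g holomorphic_on UNIV" and x: "is_subsequence E x s" and nu: "\<nu> < occurrences E x z" for g s E x z \<nu>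
  proof (cases "\<exists>w. g w \<noteq> 0")
    case True
    then obtain w where "g w \<noteq> 0" by blast
    then show ?thesis
      using alg_mult_eq_Least(2)[OF g(2), of w \<nu> z] subsequence_occurrences(1)[OF x g(1), of z] nu by simp
  next
    case False
    hence "g = (\<lambda>w. 0)" by auto
    then show ?thesis by simp
  qed
  \<comment> \<open>A common zero of \<phi>(\<pi>) and \<open>Delta\<close> would annihilate the
    Cauchy data at \<pi>, hence at b and at 0, contrary to \<phi>(0) = 1. So at each point only one
    subsequence contributes, and the occurrences may be added.\<close>
  have disj: "occurrences D W z = 0 \<or> occurrences D_inf W_inf z = 0" for z
  proof (rule ccontr)
    assume "\<not> ?thesis"
    hence o: "0 < occurrences D W z" "0 < occurrences D_inf W_inf z" by auto
    have "?D z = 0" "?I z = 0"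
      using low_order[OF ev(1) Dhol(1) sub(1) o(1)] low_order[OF ev(3) Dhol(3) sub(3) o(2)] by auto
    hence "?f z = 0" "?df z = 0" by (auto simp: Delta_def Delta_inf_def)
    hence yb: "Y z b = 0" "dY z b = 0" unfolding eY by auto
    obtain f11 f12 f21 f22 where "\<And>l y dy. ode_sol q l 0 b y dy \<Longrightarrow> y 0 = f11 l * y b + f12 l * dy b"
      by (rule backward_transfer[OF qb(1)]) (use b in auto)
    from this[OF Y0b(1)[of z]] show False using yb Y(2)[of z] by simp
  qed
  \<comment> \<open>At a value of \<open>W\<close> the ratios control the difference of
    \<phi>(\<pi>), and the difference of \<phi>'(\<pi>) follows from the vanishing of both
    \<open>Delta\<close> because H is common. At a value of \<open>W_inf\<close> the ratios control
    \<phi>'(\<pi>), while \<phi>(\<pi>) itself vanishes in both problems.\<close>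
  have van: "(deriv ^^ \<nu>) (\<lambda>l. ?f l - ?ft l) z = 0 \<and> (deriv ^^ \<nu>) (\<lambda>l. ?df l - ?dft l) z = 0"
    if nu: "\<nu> < occurrences D W z + occurrences D_inf W_inf z" for \<nu> z
  proof (cases "occurrences D_inf W_inf z = 0")
    case True
    hence nu1: "\<nu> < occurrences D W z" using nu by simp
    have f0: "(deriv ^^ j) (\<lambda>l. ?f l - ?ft l) z = 0" if "j < occurrences D W z" for j
      by (rule common_ratio_derivatives[OF ev(1,2) sub(1,2) fhol(1) fthol(1) _ that])
         (use assms(15) in \<open>simp add: kappa_def bt gt\<close>)
    have D0: "(deriv ^^ j) (\<lambda>l. ?D l - ?Dt l) z = 0" if "j < occurrences D W z" for j
      using low_order[OF ev(1) Dhol(1) sub(1) that] low_order[OF ev(2) Dhol(2) sub(2) that]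
        higher_deriv_diff[OF Dhol(1,2) open_UNIV, of z j] by simp
    have "(deriv ^^ \<nu>) (\<lambda>l. 1 * (?D l - ?Dt l) + (- H) * (?f l - ?ft l)) z = 0"
      by (rule deriv_zeros_combination[OF _ _ _ _ D0 f0 nu1]) (use Dhol fhol fthol in \<open>auto intro!: holomorphic_intros\<close>)
    moreover have "(\<lambda>l. 1 * (?D l - ?Dt l) + (- H) * (?f l - ?ft l)) = (\<lambda>l. ?df l - ?dft l)"
      by (rule ext) (simp add: Delta_def algebra_simps)
    ultimately show ?thesis using f0[OF nu1] by simp
  next
    case False
    hence nu2: "\<nu> < occurrences D_inf W_inf z" using nu disj[of z] by auto
    have "(deriv ^^ \<nu>) (\<lambda>l. ?df l - ?dft l) z = 0"
      by (rule common_ratio_derivatives[OF ev(3,4) sub(3,4) fhol(2) fthol(2) _ nu2])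
         (use assms(16) in \<open>simp add: kappa_inf_def bt gt\<close>)
    moreover have "(deriv ^^ \<nu>) (\<lambda>l. ?It l - ?I l) z = 0"
      using low_order[OF ev(3) Dhol(3) sub(3) nu2] low_order[OF ev(4) Dhol(4) sub(4) nu2]
        higher_deriv_diff[OF Dhol(4,3) open_UNIV, of z \<nu>] by simp
    moreover have "(\<lambda>l. ?It l - ?I l) = (\<lambda>l. ?f l - ?ft l)" by (rule ext) (simp add: Delta_inf_def)
    ultimately show ?thesis by simp
  qed
  have dhol: "(\<lambda>l. ?f l - ?ft l) holomorphic_on UNIV" "(\<lambda>l. ?df l - ?dft l) holomorphic_on UNIV"
    using fhol fthol by (auto intro!: holomorphic_intros)
  have occF: "occurrences D W z + occurrences D_inf W_inf z \<le> alg_mult F z"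
    if "F w \<noteq> 0" "F = F1 \<or> F = F2" for F w z
  proof -
    have Fh: "F holomorphic_on UNIV" using that(2) Fhol by auto
    show ?thesis
    proof (rule alg_mult_ge[OF Fh that(1)])
      fix \<nu> assume nu: "\<nu> < occurrences D W z + occurrences D_inf W_inf z"
      have "(deriv ^^ \<nu>) (\<lambda>l. e11 l * (?f l - ?ft l) + e12 l * (?df l - ?dft l)) z = 0"
        by (rule deriv_zeros_combination[OF ehol(1,2) dhol _ _ nu]) (use van in blast)+
      moreover have "(deriv ^^ \<nu>) (\<lambda>l. e21 l * (?f l - ?ft l) + e22 l * (?df l - ?dft l)) z = 0"
        by (rule deriv_zeros_combination[OF ehol(3,4) dhol _ _ nu]) (use van in blast)+
      moreover have "F1 = (\<lambda>l. e11 l * (?f l - ?ft l) + e12 l * (?df l - ?dft l))" "F2 = (\<lambda>l. e21 l * (?f l - ?ft l) + e22 l * (?df l - ?dft l))"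
        by (auto simp: F)
      ultimately show "(deriv ^^ \<nu>) F z = 0" using that(2) by auto
    qed
  qed
  have many: "2 * b / pi * sqrt r - C \<le> log_zero_sum F r" if F: "F = F1 \<or> F = F2" and w: "F w \<noteq> 0" and r: "max r0 1 \<le> r" for F w r
  proof -
    have Fh: "F holomorphic_on UNIV" using F Fhol by auto
    have "log_counting_sum D W r + log_counting_sum D_inf W_inf r \<le> log_zero_sum F r"
      by (rule log_zero_sum_ge_subsequences[OF Fh w _ finW finz occF[OF w F]]) (use r in auto)
    then show ?thesis using count[of r] r by simp
  qed

  have bb: "b \<in> {0..b}" using b by simp
  obtain k1 where k1: "k1 \<ge> 0" and k1': "\<And>\<rho> y dy. k1 \<le> norm \<rho> \<Longrightarrow> 1 \<le> norm \<rho> \<Longrightarrow> ode_sol q (\<rho>\<^sup>2) 0 b y dy \<Longrightarrow>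
      y 0 = 1 \<Longrightarrow> dy 0 = h \<Longrightarrow> cosine_like k1 \<rho> b y dy"
    by (rule regular_solution_asymptotics[OF qb(1), of h]) (rule that)
  obtain k2 where k2: "k2 \<ge> 0" and k2': "\<And>\<rho> y dy. k2 \<le> norm \<rho> \<Longrightarrow> 1 \<le> norm \<rho> \<Longrightarrow> ode_sol qt (\<rho>\<^sup>2) 0 b y dy \<Longrightarrow>
      y 0 = 1 \<Longrightarrow> dy 0 = ht \<Longrightarrow> cosine_like k2 \<rho> b y dy"
    by (rule regular_solution_asymptotics[OF qb(2), of ht]) (rule that)
  define R3 where "R3 = max (max k1 k2) 1"
  \<comment> \<open>The added 1 makes the constant positive, so that its logarithm is defined in the
    zero argument.\<close>
  define k3 where "k3 = k1 + k2 + 1"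
  have k3: "k3 > 0" using k1 k2 by (simp add: k3_def)
  have F1b: "norm (F1 (\<rho>\<^sup>2)) \<le> k3 / norm \<rho> * exp (b * \<bar>Im \<rho>\<bar>)" and F2b: "norm (F2 (\<rho>\<^sup>2)) \<le> k3 * exp (b * \<bar>Im \<rho>\<bar>)"
    if r: "R3 \<le> norm \<rho>" for \<rho>
  proof -
    let ?e = "exp (\<bar>Im \<rho>\<bar> * b)"
    have rr: "k1 \<le> norm \<rho>" "k2 \<le> norm \<rho>" "1 \<le> norm \<rho>" using r by (auto simp: R3_def)
    note a1 = cosine_likeD[OF k1'[OF rr(1,3) Y0b(1) Y(2,3)] bb] and a2 = cosine_likeD[OF k2'[OF rr(2,3) Y0b(2) Yt(2,3)] bb]
    have tri: "norm (u - v) \<le> norm (u - w) + norm (v - w)" for u v w :: complex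
      using norm_triangle_ineq4[of "u - w" "v - w"] by simp
    have "norm (F1 (\<rho>\<^sup>2)) \<le> k1 * ?e / norm \<rho> + k2 * ?e / norm \<rho>"
      unfolding F1_def using tri[of "Y (\<rho>\<^sup>2) b" "Yt (\<rho>\<^sup>2) b" "cos (\<rho> * of_real b)"] a1 a2 by linarith
    also have "\<dots> = (k1 + k2) * (?e / norm \<rho>)" by (simp add: add_divide_distrib distrib_right)
    also have "\<dots> \<le> k3 * (?e / norm \<rho>)" by (intro mult_right_mono) (auto simp: k3_def)
    finally show "norm (F1 (\<rho>\<^sup>2)) \<le> k3 / norm \<rho> * exp (b * \<bar>Im \<rho>\<bar>)" by (simp add: mult.commute)
    have "norm (F2 (\<rho>\<^sup>2)) \<le> k1 * ?e + k2 * ?e"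
      unfolding F2_def using tri[of "dY (\<rho>\<^sup>2) b" "dYt (\<rho>\<^sup>2) b" "- \<rho> * sin (\<rho> * of_real b)"] a1 a2 by linarith
    also have "\<dots> = (k1 + k2) * ?e" by (simp add: distrib_right)
    also have "\<dots> \<le> k3 * ?e" by (intro mult_right_mono) (auto simp: k3_def)
    finally show "norm (F2 (\<rho>\<^sup>2)) \<le> k3 * exp (b * \<bar>Im \<rho>\<bar>)" by (simp add: mult.commute)
  qed
  have b0: "0 \<le> b" using b by simp
  \<comment> \<open>The factor 1 / |\<rho>| in the bound for \<open>F1\<close> supplies the
    arbitrarily small constants; for \<open>F2\<close> they come from
    \<open>derivative_difference_small\<close>, which uses the equality of values at
    \<open>b\<close> obtained here.\<close>
  have F1z: "F1 l = 0" for l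
  proof (rule entire_zero_if_too_many_zeros[OF Fhol(1) b0 k3 _ _ many[OF disjI1[OF refl]]])
    fix \<rho> :: complex assume r: "R3 \<le> norm \<rho>"
    have "k3 / norm \<rho> \<le> k3 / 1" using r k3 by (intro divide_left_mono) (auto simp: R3_def)
    hence "k3 / norm \<rho> * exp (b * \<bar>Im \<rho>\<bar>) \<le> k3 * exp (b * \<bar>Im \<rho>\<bar>)" by (intro mult_right_mono) auto
    then show "norm (F1 (\<rho>\<^sup>2)) \<le> k3 * exp (b * \<bar>Im \<rho>\<bar>)" using F1b[OF r] by linarith
  next
    fix \<epsilon> :: real assume e: "\<epsilon> > 0"
    show "\<exists>R. \<forall>\<rho>. R \<le> norm \<rho> \<longrightarrow> norm \<rho> \<le> 2 * \<bar>Im \<rho>\<bar> \<longrightarrow> norm (F1 (\<rho>\<^sup>2)) \<le> \<epsilon> * exp (b * \<bar>Im \<rho>\<bar>)"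
    proof (intro exI[of _ "max R3 (k3 / \<epsilon>)"] allI impI)
      fix \<rho> :: complex assume r: "max R3 (k3 / \<epsilon>) \<le> norm \<rho>"
      hence rr: "R3 \<le> norm \<rho>" "k3 / \<epsilon> \<le> norm \<rho>" "1 \<le> norm \<rho>" by (auto simp: R3_def)
      have "k3 \<le> \<epsilon> * norm \<rho>" using rr(2) e by (simp add: pos_divide_le_eq mult.commute)
      moreover have "0 < norm \<rho>" using rr(3) by linarith
      ultimately have "k3 / norm \<rho> \<le> \<epsilon>" by (subst pos_divide_le_eq)
      hence "k3 / norm \<rho> * exp (b * \<bar>Im \<rho>\<bar>) \<le> \<epsilon> * exp (b * \<bar>Im \<rho>\<bar>)" by (intro mult_right_mono) auto
      then show "norm (F1 (\<rho>\<^sup>2)) \<le> \<epsilon> * exp (b * \<bar>Im \<rho>\<bar>)" using F1b[OF rr(1)] by linarith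
    qed
  qed
  have Yb: "Y l b = Yt l b" for l using F1z[of l] by (simp add: F1_def)
  have F2z: "F2 l = 0" for l
  proof (rule entire_zero_if_too_many_zeros[OF Fhol(2) b0 k3 F2b _ many[OF disjI2[OF refl]]])
    fix \<epsilon> :: real assume e: "\<epsilon> > 0"
    show "\<exists>R. \<forall>\<rho>. R \<le> norm \<rho> \<longrightarrow> norm \<rho> \<le> 2 * \<bar>Im \<rho>\<bar> \<longrightarrow> norm (F2 (\<rho>\<^sup>2)) \<le> \<epsilon> * exp (b * \<bar>Im \<rho>\<bar>)"
      unfolding F2_def
      by (rule derivative_difference_small[OF qb(1,2) b(1) Y0b(1) Y(2,3) Y0b(2) Yt(2,3) Yb e])
  qed
  have dYb: "dY l b = dYt l b" for l using F2z[of l] by (simp add: F2_def)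
  have hh: "h = ht" and neg: "negligible {x \<in> {0..b}. q x \<noteq> qt x}"
    by (rule borg_uniqueness[where Y=Y and dY=dY and Yt=Yt and dYt=dYt,
          OF qb(1,2) b(1) Y0b(1) Y(2,3) Y0b(2) Yt(2,3) Yb dYb])+
  have "negligible {x \<in> {0..pi}. q x \<noteq> qt x}"
    by (rule negligible_subset[OF negligible_Un[OF neg N]]) (auto simp: N_def)
  hence "AE x in lebesgue. x \<notin> {x \<in> {0..pi}. q x \<noteq> qt x}"
    unfolding negligible_iff_null_sets by (rule AE_not_in)
  hence "AE x\<in>{0..pi} in lebesgue. q x = qt x" by (rule AE_mp) auto
  then show ?thesis using hh by simp
qed

end
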